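(* Let $\mathbf{T}=\mathbf{Top}$ or $\mathbf{T}=\mathbf{Prox}$ or $\mathbf{T}=\mathbf{Unif}$. Let ${\mathcal C}$ be a subcategory of $\mathbf{T}$. Then the following are equivalent: 1) ${\mathcal C}$ is an epireflective subcategory of $\mathbf{T}$ that is algebraic. 2) Either $\mathrm{Ob}\,{\mathcal C}=\{X\in \mathrm{Ob}\,\mathbf{T}\mid |X|\le 1\}$, or $\mathrm{Ob}\,{\mathcal C}=\{X\in \mathrm{Ob}\,\mathbf{T}\mid X\text{ is indiscrete}\}$. Moreover, if 1) is written as the conjunction of the three properties: closedness under products, closedness under extremal subobjects, and being algebraic, then none of these three properties can be omitted without invalidating the implication $1)\Rightarrow 2)$ (that is, for each of the three properties there is a subcategory of $\mathbf{T}$ having the other two properties but not of the form in 2)).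
   Context: $\mathbf{Top}$, $\mathbf{Prox}$, $\mathbf{Unif}$ are the categories of all topological spaces, proximity spaces and uniform spaces (without the $T_0$, $T_2$, $T_2$ axioms, respectively), with continuous, proximally continuous and uniformly continuous maps. (Proximity spaces can be identified with precompact uniform spaces.) Subcategories are always full and isomorphism closed, and are identified with the classes of their objects; they are regarded as concrete categories over $\mathbf{Set}$ via the underlying set functor $U$. A subcategory is epireflective if it is reflective with all reflection arrows epimorphisms of the ambient category; in each of $\mathbf{Top}$, $\mathbf{Prox}$, $\mathbf{Unif}$ this is equivalent to being closed under products (including the empty product) and extremal subobjects, where epimorphisms are the surjective morphisms and extremal monomorphisms are the embeddings (so extremal subobjects are the subspaces). A concrete category $\langle{\mathcal C}, U:{\mathcal C}\to\mathbf{Set}\rangle$ is called algebraic if ${\mathcal C}$ has coequalizers, $U$ has a left adjoint, and $U$ preserves and reflects regular epimorphisms. *)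

theory Defs
  imports "HOL-Analysis.Abstract_Topology" "HOL-Library.Equipollence" "HOL-Library.FuncSet"
begin

section \<open>Universes of small sets\<close>

text \<open>
  HOL has no type of all sets, so "all sets", "all spaces" and "all products" are taken relative to a
  collection \<open>\<U>\<close> of sets over an arbitrary type, whose members are the small sets. Only two
  properties are required: smallness depends downwards on cardinality alone, and there is a small set
  of size at least the continuum. Every Grothendieck universe with an infinite member (transported to
  subsets of a type) has them, see \<open>set_universe_if_Pow\<close>, and they are satisfiable in plain HOL, see
  \<open>set_universe_nat_set\<close>.
\<close>

definition set_universe :: "'u set set \<Rightarrow> bool" where
  "set_universe \<U> \<longleftrightarrow>
     (\<forall>A\<in>\<U>. \<forall>B. B \<lesssim> A \<longrightarrow> B \<in> \<U>) \<and>
     (\<exists>A\<in>\<U>. (UNIV :: nat set set) \<lesssim> A)"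

lemma set_universe_if_Pow:
  assumes "\<And>A B. A \<in> \<U> \<Longrightarrow> B \<lesssim> A \<Longrightarrow> B \<in> \<U>"
    and "\<And>A. A \<in> \<U> \<Longrightarrow> \<exists>B\<in>\<U>. Pow A \<lesssim> B"
    and "A \<in> \<U>" "infinite A"
  shows "set_universe \<U>"
proof -
  obtain B where B: "B \<in> \<U>" "Pow A \<lesssim> B" using assms(2,3) by blast
  have "(UNIV :: nat set) \<lesssim> A"
    using assms(4) infinite_le_lepoll by blast
  then obtain f :: "nat \<Rightarrow> 'a" where f: "inj f" "range f \<subseteq> A"
    by (auto simp: lepoll_def)
  have "inj ((`) f)" "range ((`) f) \<subseteq> Pow A"
    using f by (auto simp: inj_def inj_image_eq_iff)
  then have "(UNIV :: nat set set) \<lesssim> Pow A"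
    by (auto simp: lepoll_def)
  then have "(UNIV :: nat set set) \<lesssim> B" using B(2) lepoll_trans by blast
  then show ?thesis using assms(1) B(1) unfolding set_universe_def by blast
qed

lemma set_universe_nat_set: "set_universe (UNIV :: nat set set set)"
  unfolding set_universe_def by (auto intro: lepoll_refl)


section \<open>Concrete categories\<close>

text \<open>
  Morphisms are extensional functions between underlying sets, so that equality of morphisms is
  equality of functions; composition of \<open>f\<close> from \<open>X\<close> and \<open>g\<close> is \<open>compose (und K X) g f\<close>.
\<close>

record ('o, 'u) concrete_cat =
  Obj :: "'o set"
  und :: "'o \<Rightarrow> 'u set"
  Mor :: "'o \<Rightarrow> 'o \<Rightarrow> ('u \<Rightarrow> 'u) set"

definition ident :: "('o, 'u) concrete_cat \<Rightarrow> 'o \<Rightarrow> 'u \<Rightarrow> 'u" where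
  "ident K X = (\<lambda>x\<in>und K X. x)"

definition SetCat :: "'u set set \<Rightarrow> ('u set, 'u) concrete_cat" where
  "SetCat \<U> = \<lparr>Obj = \<U>, und = (\<lambda>A. A), Mor = (\<lambda>A B. A \<rightarrow>\<^sub>E B)\<rparr>"

definition full_sub :: "('o, 'u) concrete_cat \<Rightarrow> 'o set \<Rightarrow> ('o, 'u) concrete_cat" where
  "full_sub T C = \<lparr>Obj = C, und = und T, Mor = Mor T\<rparr>"

definition is_iso :: "('o, 'u) concrete_cat \<Rightarrow> 'o \<Rightarrow> 'o \<Rightarrow> ('u \<Rightarrow> 'u) \<Rightarrow> bool" where
  "is_iso K X Y f \<longleftrightarrow> f \<in> Mor K X Y \<and>
     (\<exists>g\<in>Mor K Y X. compose (und K X) g f = ident K X \<and> compose (und K Y) f g = ident K Y)"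

definition is_epi :: "('o, 'u) concrete_cat \<Rightarrow> 'o \<Rightarrow> 'o \<Rightarrow> ('u \<Rightarrow> 'u) \<Rightarrow> bool" where
  "is_epi K X Y f \<longleftrightarrow> f \<in> Mor K X Y \<and>
     (\<forall>Z\<in>Obj K. \<forall>g\<in>Mor K Y Z. \<forall>h\<in>Mor K Y Z.
        compose (und K X) g f = compose (und K X) h f \<longrightarrow> g = h)"

definition is_mono :: "('o, 'u) concrete_cat \<Rightarrow> 'o \<Rightarrow> 'o \<Rightarrow> ('u \<Rightarrow> 'u) \<Rightarrow> bool" where
  "is_mono K X Y f \<longleftrightarrow> f \<in> Mor K X Y \<and>
     (\<forall>Z\<in>Obj K. \<forall>g\<in>Mor K Z X. \<forall>h\<in>Mor K Z X.
        compose (und K Z) f g = compose (und K Z) f h \<longrightarrow> g = h)"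

definition is_extremal_mono :: "('o, 'u) concrete_cat \<Rightarrow> 'o \<Rightarrow> 'o \<Rightarrow> ('u \<Rightarrow> 'u) \<Rightarrow> bool" where
  "is_extremal_mono K X Y m \<longleftrightarrow> is_mono K X Y m \<and>
     (\<forall>Z\<in>Obj K. \<forall>e f. is_epi K X Z e \<and> f \<in> Mor K Z Y \<and> m = compose (und K X) f e
        \<longrightarrow> is_iso K X Z e)"

definition is_product ::
  "('o, 'u) concrete_cat \<Rightarrow> 'i set \<Rightarrow> ('i \<Rightarrow> 'o) \<Rightarrow> 'o \<Rightarrow> ('i \<Rightarrow> 'u \<Rightarrow> 'u) \<Rightarrow> bool" where
  "is_product K I X P p \<longleftrightarrow> P \<in> Obj K \<and> (\<forall>i\<in>I. p i \<in> Mor K P (X i)) \<and>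
     (\<forall>Q\<in>Obj K. \<forall>q. (\<forall>i\<in>I. q i \<in> Mor K Q (X i)) \<longrightarrow>
        (\<exists>!h. h \<in> Mor K Q P \<and> (\<forall>i\<in>I. compose (und K Q) (p i) h = q i)))"

definition is_coequalizer ::
  "('o, 'u) concrete_cat \<Rightarrow> 'o \<Rightarrow> 'o \<Rightarrow> ('u \<Rightarrow> 'u) \<Rightarrow> ('u \<Rightarrow> 'u) \<Rightarrow> 'o \<Rightarrow> ('u \<Rightarrow> 'u) \<Rightarrow> bool" where
  "is_coequalizer K X Y f g Q q \<longleftrightarrow>
     f \<in> Mor K X Y \<and> g \<in> Mor K X Y \<and> Q \<in> Obj K \<and> q \<in> Mor K Y Q \<and>
     compose (und K X) q f = compose (und K X) q g \<and>
     (\<forall>Z\<in>Obj K. \<forall>h\<in>Mor K Y Z. compose (und K X) h f = compose (und K X) h g \<longrightarrow>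
        (\<exists>!k. k \<in> Mor K Q Z \<and> compose (und K Y) k q = h))"

definition has_coequalizers :: "('o, 'u) concrete_cat \<Rightarrow> bool" where
  "has_coequalizers K \<longleftrightarrow>
     (\<forall>X\<in>Obj K. \<forall>Y\<in>Obj K. \<forall>f\<in>Mor K X Y. \<forall>g\<in>Mor K X Y. \<exists>Q q. is_coequalizer K X Y f g Q q)"

definition is_regular_epi :: "('o, 'u) concrete_cat \<Rightarrow> 'o \<Rightarrow> 'o \<Rightarrow> ('u \<Rightarrow> 'u) \<Rightarrow> bool" where
  "is_regular_epi K Y Q q \<longleftrightarrow> (\<exists>X\<in>Obj K. \<exists>f g. is_coequalizer K X Y f g Q q)"

text \<open>
  A left adjoint of the underlying set functor: a functor \<open>(F, Fm)\<close> from small sets to \<open>K\<close> and a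
  family of bijections \<open>Mor K (F S) A \<cong> (S \<rightarrow>\<^sub>E und K A)\<close> natural in \<open>S\<close> and \<open>A\<close>.
\<close>

definition is_functor_from_Set ::
  "'u set set \<Rightarrow> ('o, 'u) concrete_cat \<Rightarrow> ('u set \<Rightarrow> 'o)
    \<Rightarrow> ('u set \<Rightarrow> 'u set \<Rightarrow> ('u \<Rightarrow> 'u) \<Rightarrow> 'u \<Rightarrow> 'u) \<Rightarrow> bool" where
  "is_functor_from_Set \<U> K F Fm \<longleftrightarrow>
     (\<forall>S\<in>\<U>. F S \<in> Obj K \<and> Fm S S (ident (SetCat \<U>) S) = ident K (F S)) \<and>
     (\<forall>S\<in>\<U>. \<forall>S'\<in>\<U>. \<forall>s\<in>Mor (SetCat \<U>) S S'. Fm S S' s \<in> Mor K (F S) (F S')) \<and>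
     (\<forall>S\<in>\<U>. \<forall>S'\<in>\<U>. \<forall>S''\<in>\<U>. \<forall>s\<in>Mor (SetCat \<U>) S S'. \<forall>t\<in>Mor (SetCat \<U>) S' S''.
        Fm S S'' (compose S t s) = compose (und K (F S)) (Fm S' S'' t) (Fm S S' s))"

definition has_left_adjoint :: "'u set set \<Rightarrow> ('o, 'u) concrete_cat \<Rightarrow> bool" where
  "has_left_adjoint \<U> K \<longleftrightarrow>
     (\<exists>F Fm \<phi>. is_functor_from_Set \<U> K F Fm \<and>
        (\<forall>S\<in>\<U>. \<forall>A\<in>Obj K. bij_betw (\<phi> S A) (Mor K (F S) A) (Mor (SetCat \<U>) S (und K A))) \<and>
        (\<forall>S\<in>\<U>. \<forall>S'\<in>\<U>. \<forall>A\<in>Obj K. \<forall>A'\<in>Obj K.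
           \<forall>s\<in>Mor (SetCat \<U>) S' S. \<forall>a\<in>Mor K A A'. \<forall>h\<in>Mor K (F S) A.
             \<phi> S' A' (compose (und K (F S')) a (compose (und K (F S')) h (Fm S' S s)))
               = compose S' a (compose S' (\<phi> S A h) s)))"

definition preserves_regular_epis :: "'u set set \<Rightarrow> ('o, 'u) concrete_cat \<Rightarrow> bool" where
  "preserves_regular_epis \<U> K \<longleftrightarrow>
     (\<forall>X\<in>Obj K. \<forall>Y\<in>Obj K. \<forall>f\<in>Mor K X Y.
        is_regular_epi K X Y f \<longrightarrow> is_regular_epi (SetCat \<U>) (und K X) (und K Y) f)"

definition reflects_regular_epis :: "'u set set \<Rightarrow> ('o, 'u) concrete_cat \<Rightarrow> bool" where
  "reflects_regular_epis \<U> K \<longleftrightarrow>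
     (\<forall>X\<in>Obj K. \<forall>Y\<in>Obj K. \<forall>f\<in>Mor K X Y.
        is_regular_epi (SetCat \<U>) (und K X) (und K Y) f \<longrightarrow> is_regular_epi K X Y f)"

definition algebraic :: "'u set set \<Rightarrow> ('o, 'u) concrete_cat \<Rightarrow> bool" where
  "algebraic \<U> K \<longleftrightarrow> has_coequalizers K \<and> has_left_adjoint \<U> K \<and>
     preserves_regular_epis \<U> K \<and> reflects_regular_epis \<U> K"


section \<open>Full, isomorphism-closed subcategories\<close>

definition subcategory :: "('o, 'u) concrete_cat \<Rightarrow> 'o set \<Rightarrow> bool" where
  "subcategory T C \<longleftrightarrow> C \<subseteq> Obj T \<and>
     (\<forall>X\<in>C. \<forall>Y\<in>Obj T. (\<exists>f. is_iso T X Y f) \<longrightarrow> Y \<in> C)"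

definition is_reflection ::
  "('o, 'u) concrete_cat \<Rightarrow> 'o set \<Rightarrow> 'o \<Rightarrow> 'o \<Rightarrow> ('u \<Rightarrow> 'u) \<Rightarrow> bool" where
  "is_reflection T C X A r \<longleftrightarrow> A \<in> C \<and> r \<in> Mor T X A \<and>
     (\<forall>B\<in>C. \<forall>f\<in>Mor T X B. \<exists>!g. g \<in> Mor T A B \<and> compose (und T X) g r = f)"

definition reflective :: "('o, 'u) concrete_cat \<Rightarrow> 'o set \<Rightarrow> bool" where
  "reflective T C \<longleftrightarrow> (\<forall>X\<in>Obj T. \<exists>A r. is_reflection T C X A r)"

definition epireflective :: "('o, 'u) concrete_cat \<Rightarrow> 'o set \<Rightarrow> bool" where
  "epireflective T C \<longleftrightarrow> reflective T C \<and>
     (\<forall>X\<in>Obj T. \<forall>A r. is_reflection T C X A r \<longrightarrow> is_epi T X A r)"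

text \<open>
  Families are indexed by small sets, and \<open>P\<close> is any product object formed in \<open>T\<close>, not in \<open>C\<close>;
  \<open>I = {}\<close> is allowed. If \<open>\<U>\<close> is a Grothendieck universe, all these products exist in the
  categories of spaces below.
\<close>

definition closed_under_products :: "'u set set \<Rightarrow> ('o, 'u) concrete_cat \<Rightarrow> 'o set \<Rightarrow> bool" where
  "closed_under_products \<U> T C \<longleftrightarrow>
     (\<forall>I\<in>\<U>. \<forall>X\<in>I \<rightarrow> C. \<forall>P p. is_product T I X P p \<longrightarrow> P \<in> C)"

definition closed_under_extremal_subobjects :: "('o, 'u) concrete_cat \<Rightarrow> 'o set \<Rightarrow> bool" where
  "closed_under_extremal_subobjects T C \<longleftrightarrow>
     (\<forall>Y\<in>C. \<forall>X\<in>Obj T. \<forall>m. is_extremal_mono T X Y m \<longrightarrow> X \<in> C)"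


section \<open>Topological, proximity and uniform spaces\<close>

text \<open>
  Efremovic proximities without the separation axiom; \<open>near\<close> relates subsets of the carrier only,
  so that a proximity is determined by its values there.
\<close>

definition proximity_on :: "'u set \<Rightarrow> ('u set \<Rightarrow> 'u set \<Rightarrow> bool) \<Rightarrow> bool" where
  "proximity_on S near \<longleftrightarrow>
     (\<forall>A B. near A B \<longrightarrow> A \<subseteq> S \<and> B \<subseteq> S \<and> A \<noteq> {} \<and> B \<noteq> {}) \<and>
     (\<forall>A B. near A B \<longrightarrow> near B A) \<and>
     (\<forall>A B. A \<subseteq> S \<and> B \<subseteq> S \<and> A \<inter> B \<noteq> {} \<longrightarrow> near A B) \<and>
     (\<forall>A B D. A \<subseteq> S \<and> B \<subseteq> S \<and> D \<subseteq> S \<longrightarrow> (near (A \<union> B) D \<longleftrightarrow> near A D \<or> near B D)) \<and>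
     (\<forall>A B. A \<subseteq> S \<and> B \<subseteq> S \<and> \<not> near A B \<longrightarrow> (\<exists>E\<subseteq>S. \<not> near A E \<and> \<not> near (S - E) B))"

definition uniformity_on :: "'u set \<Rightarrow> ('u \<times> 'u) set set \<Rightarrow> bool" where
  "uniformity_on S \<D> \<longleftrightarrow> \<D> \<noteq> {} \<and>
     (\<forall>D\<in>\<D>. Id_on S \<subseteq> D \<and> D \<subseteq> S \<times> S \<and> D\<inverse> \<in> \<D> \<and> (\<exists>E\<in>\<D>. E O E \<subseteq> D)) \<and>
     (\<forall>D\<in>\<D>. \<forall>E\<in>\<D>. D \<inter> E \<in> \<D>) \<and>
     (\<forall>D\<in>\<D>. \<forall>E. D \<subseteq> E \<and> E \<subseteq> S \<times> S \<longrightarrow> E \<in> \<D>)"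

datatype 'u space_obj =
    TopSpace "'u topology"
  | ProxSpace "'u set" "'u set \<Rightarrow> 'u set \<Rightarrow> bool"
  | UnifSpace "'u set" "('u \<times> 'u) set set"

fun pts :: "'u space_obj \<Rightarrow> 'u set" where
  "pts (TopSpace X) = topspace X"
| "pts (ProxSpace S near) = S"
| "pts (UnifSpace S \<D>) = S"

fun space_maps :: "'u space_obj \<Rightarrow> 'u space_obj \<Rightarrow> ('u \<Rightarrow> 'u) set" where
  "space_maps (TopSpace X) (TopSpace Y) = {f \<in> topspace X \<rightarrow>\<^sub>E topspace Y. continuous_map X Y f}"
| "space_maps (ProxSpace S near) (ProxSpace S' near') =
     {f \<in> S \<rightarrow>\<^sub>E S'. \<forall>A B. near A B \<longrightarrow> near' (f ` A) (f ` B)}"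
| "space_maps (UnifSpace S \<D>) (UnifSpace S' \<D>') =
     {f \<in> S \<rightarrow>\<^sub>E S'. \<forall>E\<in>\<D>'. {(x, y) \<in> S \<times> S. (f x, f y) \<in> E} \<in> \<D>}"
| "space_maps _ _ = {}"

fun indiscrete :: "'u space_obj \<Rightarrow> bool" where
  "indiscrete (TopSpace X) \<longleftrightarrow> (\<forall>V. openin X V \<longleftrightarrow> V = {} \<or> V = topspace X)"
| "indiscrete (ProxSpace S near) \<longleftrightarrow>
     (\<forall>A B. near A B \<longleftrightarrow> A \<subseteq> S \<and> B \<subseteq> S \<and> A \<noteq> {} \<and> B \<noteq> {})"
| "indiscrete (UnifSpace S \<D>) \<longleftrightarrow> \<D> = {S \<times> S}"

definition TopCat :: "'u set set \<Rightarrow> ('u space_obj, 'u) concrete_cat" where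
  "TopCat \<U> = \<lparr>Obj = {TopSpace X | X. topspace X \<in> \<U>}, und = pts, Mor = space_maps\<rparr>"

definition ProxCat :: "'u set set \<Rightarrow> ('u space_obj, 'u) concrete_cat" where
  "ProxCat \<U> =
     \<lparr>Obj = {ProxSpace S near | S near. S \<in> \<U> \<and> proximity_on S near}, und = pts, Mor = space_maps\<rparr>"

definition UnifCat :: "'u set set \<Rightarrow> ('u space_obj, 'u) concrete_cat" where
  "UnifCat \<U> =
     \<lparr>Obj = {UnifSpace S \<D> | S \<D>. S \<in> \<U> \<and> uniformity_on S \<D>}, und = pts, Mor = space_maps\<rparr>"

definition trivial_or_indiscrete_class :: "('u space_obj, 'u) concrete_cat \<Rightarrow> 'u space_obj set \<Rightarrow> bool" where
  "trivial_or_indiscrete_class T C \<longleftrightarrow>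
     C = {X \<in> Obj T. finite (und T X) \<and> card (und T X) \<le> 1} \<or> C = {X \<in> Obj T. indiscrete X}"

end

theory Submission
  imports Defs
begin

text \<open>
  Let \<open>C\<close> be closed under products and subspaces and algebraic. Then a bijective morphism of \<open>C\<close> is an
  isomorphism, as it is a regular epimorphism of sets. Suppose \<open>C\<close> has a member \<open>X\<close> that is not
  indiscrete. In the free object on two points the two generators are distinct, and since every map
  from them to \<open>X\<close> extends to a morphism, they form a discrete subspace \<open>D\<close>. So the Cantor space \<open>D\<^sup>\<nat>\<close>
  and its subspaces belong to \<open>C\<close>; but the shift map restricts to a bijective morphism from a subspace
  onto \<open>D\<^sup>\<nat>\<close> whose inverse is not a morphism. Hence all members of \<open>C\<close> are indiscrete. If one of them
  has two points, then every indiscrete space embeds into the free object on its points, and therefore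
  belongs to \<open>C\<close>. (Powers of the indiscrete space with two points would not suffice here, because a
  power of the required size need not be small.)

  Discrete spaces, one-point spaces and all spaces show that closedness under products, closedness under
  extremal subobjects and algebraicity, respectively, cannot be omitted.
\<close>

text \<open>All three cases run through one locale, \<open>space_category\<close>, whose assumptions
  are the facts about spaces that the argument consumes; each category is then an instance.
  Smallness is the obstacle that shapes the rest: a power of small sets over a small index set need
  not be small, so products cannot be formed at will. The only infinite product whose existence is
  used is the Cantor space, built by hand on a small set of the size of the continuum; this is why
  \<open>set_universe\<close> asks for a set of that size. For the same reason epireflectivity is
  not deduced from the closure properties by embedding into products: the closure properties follow
  from epireflectivity in any concrete category, and the way back passes through the classification,
  where the reflections are explicit. The free object enters because two points of a non-indiscrete
  topological space may form an indiscrete or a Sierpinski space, whereas a pair of generators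
  admits, along with a map into \<open>X\<close>, also the map with the two values exchanged. The
  shift works because on the chosen subspace the discarded head of a sequence is determined by its
  tail, but not continuously.\<close>

lemma compose_eqD: "compose A g f = compose A g' f' \<Longrightarrow> x \<in> A \<Longrightarrow> g (f x) = g' (f' x)"
  by (metis compose_eq)

lemma full_sub_simps [simp]:
  "Obj (full_sub T C) = C" "und (full_sub T C) = und T" "Mor (full_sub T C) = Mor T"
  by (simp_all add: full_sub_def)

lemma SetCat_simps [simp]:
  "Obj (SetCat \<U>) = \<U>" "und (SetCat \<U>) = (\<lambda>A. A)" "Mor (SetCat \<U>) = (\<lambda>A B. A \<rightarrow>\<^sub>E B)"
  by (simp_all add: SetCat_def)

lemma ident_apply: "x \<in> und K X \<Longrightarrow> ident K X x = x"
  by (simp add: ident_def)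

lemma ident_PiE: "ident K X \<in> und K X \<rightarrow>\<^sub>E und K X"
  by (auto simp: ident_def)

lemma compose_PiE: "f \<in> A \<rightarrow>\<^sub>E B \<Longrightarrow> g \<in> B \<rightarrow>\<^sub>E D \<Longrightarrow> compose A g f \<in> A \<rightarrow>\<^sub>E D"
  by (auto simp: compose_def)

lemma compose_ident_left: "f \<in> A \<rightarrow>\<^sub>E und K Y \<Longrightarrow> compose A (ident K Y) f = f"
  by (auto simp: compose_def ident_def fun_eq_iff PiE_def extensional_def)

lemma compose_ident_right: "f \<in> und K X \<rightarrow>\<^sub>E B \<Longrightarrow> compose (und K X) f (ident K X) = f"
  by (auto simp: compose_def ident_def fun_eq_iff PiE_def extensional_def)

section \<open>Universes\<close>

lemma universe_lepoll: "set_universe \<U> \<Longrightarrow> A \<in> \<U> \<Longrightarrow> B \<lesssim> A \<Longrightarrow> B \<in> \<U>"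
  unfolding set_universe_def by blast

lemma universe_subset: "set_universe \<U> \<Longrightarrow> A \<in> \<U> \<Longrightarrow> B \<subseteq> A \<Longrightarrow> B \<in> \<U>"
  using universe_lepoll subset_imp_lepoll by blast

text \<open>The set obtained here is the carrier of the Cantor space in all three categories. Its
  points are elements of \<open>'u\<close>, so \<open>\<kappa>\<close> is what lets them be read as
  binary sequences.\<close>

lemma universe_binary_sequences:
  assumes "set_universe (\<U> :: 'u set set)"
  obtains B \<kappa> where "B \<in> \<U>" "bij_betw \<kappa> (B :: 'u set) (UNIV :: (nat \<Rightarrow> bool) set)"
proof -
  obtain A where A: "A \<in> \<U>" "(UNIV :: nat set set) \<lesssim> A"
    using assms unfolding set_universe_def by blast
  then obtain f :: "nat set \<Rightarrow> 'u" where f: "inj f" "range f \<subseteq> A"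
    by (auto simp: lepoll_def)
  have "bij_betw (\<lambda>p. f (Collect p)) (UNIV :: (nat \<Rightarrow> bool) set) (range f)"
    unfolding bij_betw_def using f
    by (auto simp: inj_def) (metis Collect_mem_eq rangeI)
  then obtain \<kappa> where "bij_betw \<kappa> (range f) (UNIV :: (nat \<Rightarrow> bool) set)"
    using bij_betw_inv by blast
  moreover have "range f \<in> \<U>" using universe_subset[OF assms A(1) f(2)] .
  ultimately show ?thesis using that by blast
qed

text \<open>A countable product has to be indexed by a small set over \<open>'u\<close>;
  \<open>range h\<close> is that copy of the natural numbers.\<close>

lemma universe_nat:
  assumes "set_universe (\<U> :: 'u set set)"
  obtains h :: "nat \<Rightarrow> 'u" where "inj h" "range h \<in> \<U>"
proof -
  obtain A where A: "A \<in> \<U>" "(UNIV :: nat set set) \<lesssim> A"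
    using assms unfolding set_universe_def by blast
  then obtain f :: "nat set \<Rightarrow> 'u" where f: "inj f" "range f \<subseteq> A"
    by (auto simp: lepoll_def)
  have "inj (\<lambda>n. f {n})" using f(1) by (auto simp: inj_def)
  moreover have "range (\<lambda>n. f {n}) \<in> \<U>"
    by (rule universe_subset[OF assms A(1)]) (use f(2) in auto)
  ultimately show ?thesis using that by blast
qed

lemma universe_finite:
  assumes "set_universe \<U>" "finite A"
  shows "A \<in> \<U>"
proof -
  obtain h :: "nat \<Rightarrow> 'a" where h: "inj h" "range h \<in> \<U>" using universe_nat[OF assms(1)] .
  then have "infinite (range h)" using finite_imageD by blast
  then have "A \<lesssim> range h" using assms(2) by (simp add: finite_lepoll_infinite)
  then show ?thesis using universe_lepoll[OF assms(1) h(2)] by blast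
qed

lemma universe_two_points:
  assumes "set_universe (\<U> :: 'u set set)"
  obtains a b :: 'u where "a \<noteq> b"
proof -
  obtain h :: "nat \<Rightarrow> 'u" where "inj h" using universe_nat[OF assms] .
  then have "h 0 \<noteq> h 1" by (auto simp: inj_def)
  then show ?thesis using that by blast
qed

text \<open>A coequalizer is an epimorphism, and a point outside the image could be sent to
  \<open>p\<close> or to \<open>q\<close> without changing the composite with \<open>f\<close>.
  Conversely, if \<open>s\<close> is a section of \<open>f\<close>, then \<open>f\<close> is the
  coequalizer of the identity and \<open>s\<close> after \<open>f\<close>: a map \<open>h\<close>
  that respects this pair is recovered from its values on the section.\<close>

lemma Set_regular_epi_iff:
  assumes U: "set_universe (\<U> :: 'u set set)" and "X \<in> \<U>" "Y \<in> \<U>" and f: "f \<in> X \<rightarrow>\<^sub>E Y"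
  shows "is_regular_epi (SetCat \<U>) X Y f \<longleftrightarrow> f ` X = Y"
proof
  assume "is_regular_epi (SetCat \<U>) X Y f"
  then obtain Z a b where c: "is_coequalizer (SetCat \<U>) Z X a b Y f"
    unfolding is_regular_epi_def by blast
  obtain p q :: 'u where pq: "p \<noteq> q" using universe_two_points[OF U] .
  let ?u = "\<lambda>y\<in>Y. p" and ?v = "\<lambda>y\<in>Y. if y \<in> f ` X then p else q"
  have ab: "a \<in> Z \<rightarrow>\<^sub>E X" "b \<in> Z \<rightarrow>\<^sub>E X" using c by (auto simp: is_coequalizer_def)
  have h: "(\<lambda>x\<in>X. p) \<in> X \<rightarrow>\<^sub>E {p, q}" by auto
  have "compose Z (\<lambda>x\<in>X. p) a = compose Z (\<lambda>x\<in>X. p) b"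
    using ab by (auto simp: compose_def fun_eq_iff)
  then have ex1: "\<exists>!k. k \<in> Y \<rightarrow>\<^sub>E {p, q} \<and> compose X k f = (\<lambda>x\<in>X. p)"
    using c h universe_finite[OF U, of "{p, q}"] unfolding is_coequalizer_def by auto
  moreover have "?u \<in> Y \<rightarrow>\<^sub>E {p, q} \<and> compose X ?u f = (\<lambda>x\<in>X. p)"
    using f by (auto simp: compose_def fun_eq_iff)
  moreover have "?v \<in> Y \<rightarrow>\<^sub>E {p, q} \<and> compose X ?v f = (\<lambda>x\<in>X. p)"
    using f by (auto simp: compose_def fun_eq_iff)
  ultimately have uv: "?u = ?v" by blast
  have "y \<in> f ` X" if "y \<in> Y" for y
    using fun_cong[OF uv, of y] pq that by (simp split: if_splits)
  then show "f ` X = Y" using f by auto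
next
  assume surj: "f ` X = Y"
  define s where "s = inv_into X f"
  have s: "\<And>y. y \<in> Y \<Longrightarrow> s y \<in> X \<and> f (s y) = y"
    unfolding s_def using surj by (metis f_inv_into_f inv_into_into)
  then have sf: "s (f x) \<in> X" "f (s (f x)) = f x" if "x \<in> X" for x
    using f that by auto
  have "is_coequalizer (SetCat \<U>) X X (\<lambda>x\<in>X. x) (\<lambda>x\<in>X. s (f x)) Y f"
    unfolding is_coequalizer_def SetCat_simps
  proof (intro conjI ballI impI)
    fix Z h assume h: "h \<in> X \<rightarrow>\<^sub>E Z"
      and e: "compose X h (\<lambda>x\<in>X. x) = compose X h (\<lambda>x\<in>X. s (f x))"
    have e': "\<And>x. x \<in> X \<Longrightarrow> h (s (f x)) = h x" using compose_eqD[OF e] by simp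
    show "\<exists>!k. k \<in> Y \<rightarrow>\<^sub>E Z \<and> compose X k f = h"
    proof
      show "(\<lambda>y\<in>Y. h (s y)) \<in> Y \<rightarrow>\<^sub>E Z \<and> compose X (\<lambda>y\<in>Y. h (s y)) f = h"
        using h s f e' by (auto simp: compose_def fun_eq_iff PiE_def extensional_def)
      fix k assume k: "k \<in> Y \<rightarrow>\<^sub>E Z \<and> compose X k f = h"
      show "k = (\<lambda>y\<in>Y. h (s y))"
      proof
        fix y show "k y = (\<lambda>y\<in>Y. h (s y)) y"
          using k s by (cases "y \<in> Y") (auto simp: compose_def PiE_def extensional_def)
      qed
    qed
  qed (use assms sf f in \<open>auto simp: compose_def fun_eq_iff\<close>)
  then show "is_regular_epi (SetCat \<U>) X Y f"
    unfolding is_regular_epi_def using assms(2) by auto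
qed


section \<open>Concrete categories\<close>

text \<open>Morphisms are extensional functions composed as functions, so associativity and the unit
  laws are inherited from functions; what has to be supplied is closure under identities and
  composition.\<close>

locale concrete_category =
  fixes K :: "('o, 'u) concrete_cat"
  assumes mor_fun: "X \<in> Obj K \<Longrightarrow> Y \<in> Obj K \<Longrightarrow> f \<in> Mor K X Y \<Longrightarrow> f \<in> und K X \<rightarrow>\<^sub>E und K Y"
    and ident_mor: "X \<in> Obj K \<Longrightarrow> ident K X \<in> Mor K X X"
    and comp_mor: "X \<in> Obj K \<Longrightarrow> Y \<in> Obj K \<Longrightarrow> Z \<in> Obj K \<Longrightarrow>
      f \<in> Mor K X Y \<Longrightarrow> g \<in> Mor K Y Z \<Longrightarrow> compose (und K X) g f \<in> Mor K X Z"
begin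

lemma mor_eqI:
  assumes "X \<in> Obj K" "Y \<in> Obj K" "f \<in> Mor K X Y" "g \<in> Mor K X Y"
    and "\<And>x. x \<in> und K X \<Longrightarrow> f x = g x"
  shows "f = g"
  using mor_fun[OF assms(1-3)] mor_fun[OF assms(1,2,4)] assms(5) by (rule PiE_ext)

lemma mor_apply: "X \<in> Obj K \<Longrightarrow> Y \<in> Obj K \<Longrightarrow> f \<in> Mor K X Y \<Longrightarrow> x \<in> und K X \<Longrightarrow> f x \<in> und K Y"
  using mor_fun by blast

lemma comp_assoc:
  assumes "X \<in> Obj K" "Y \<in> Obj K" "f \<in> Mor K X Y"
  shows "compose (und K X) (compose (und K Y) h g) f = compose (und K X) h (compose (und K X) g f)"
  using mor_fun[OF assms] by (auto simp: compose_def fun_eq_iff)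

lemma surj_epi:
  assumes "X \<in> Obj K" "Y \<in> Obj K" "f \<in> Mor K X Y" "f ` und K X = und K Y"
  shows "is_epi K X Y f"
  unfolding is_epi_def
proof (intro conjI ballI impI)
  fix Z g h assume Z: "Z \<in> Obj K" "g \<in> Mor K Y Z" "h \<in> Mor K Y Z"
    and e: "compose (und K X) g f = compose (und K X) h f"
  show "g = h"
  proof (rule mor_eqI[OF assms(2) Z])
    fix y assume "y \<in> und K Y"
    then obtain x where "x \<in> und K X" "y = f x" using assms(4) by blast
    then show "g y = h y" using compose_eqD[OF e] by simp
  qed
qed (fact assms(3))

lemma inj_mono:
  assumes "X \<in> Obj K" "Y \<in> Obj K" "f \<in> Mor K X Y" "inj_on f (und K X)"
  shows "is_mono K X Y f"
  unfolding is_mono_def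
proof (intro conjI ballI impI)
  fix Z g h assume Z: "Z \<in> Obj K" "g \<in> Mor K Z X" "h \<in> Mor K Z X"
    and e: "compose (und K Z) f g = compose (und K Z) f h"
  show "g = h"
  proof (rule mor_eqI[OF Z(1) assms(1) Z(2,3)])
    fix x assume x: "x \<in> und K Z"
    show "g x = h x"
      using inj_onD[OF assms(4) compose_eqD[OF e x]] mor_apply[OF Z(1) assms(1) _ x] Z by blast
  qed
qed (fact assms(3))

section \<open>Left adjoints of the underlying set functor as universal arrows\<close>

text \<open>Universal arrows determine the functor: \<open>Fm S S' s\<close> has to be the unique
  morphism that extends \<open>\<eta> S'\<close> after \<open>s\<close>. The functor laws then hold
  because both sides agree on the generators, that is, after composition with
  \<open>\<eta> S\<close>, and the bijection is composition with \<open>\<eta> S\<close>.\<close>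

lemma left_adjointI:
  assumes F: "\<And>S. S \<in> \<U> \<Longrightarrow> F S \<in> Obj K" and \<eta>: "\<And>S. S \<in> \<U> \<Longrightarrow> \<eta> S \<in> S \<rightarrow>\<^sub>E und K (F S)"
    and univ: "\<And>S A h. S \<in> \<U> \<Longrightarrow> A \<in> Obj K \<Longrightarrow> h \<in> S \<rightarrow>\<^sub>E und K A \<Longrightarrow>
      \<exists>!k. k \<in> Mor K (F S) A \<and> compose S k (\<eta> S) = h"
  shows "has_left_adjoint \<U> K"
proof -
  define Fm where "Fm S S' s = (THE k. k \<in> Mor K (F S) (F S') \<and> compose S k (\<eta> S) = compose S (\<eta> S') s)"
    for S S' s
  define \<phi> where "\<phi> S (A :: 'o) h = compose S h (\<eta> S)" for S A and h :: "'u \<Rightarrow> 'u"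
  have Fm: "Fm S S' s \<in> Mor K (F S) (F S')" "compose S (Fm S S' s) (\<eta> S) = compose S (\<eta> S') s"
    if "S \<in> \<U>" "S' \<in> \<U>" "s \<in> S \<rightarrow>\<^sub>E S'" for S S' s
    using theI'[OF univ[OF that(1) F[OF that(2)] compose_PiE[OF that(3) \<eta>[OF that(2)]]]]
    unfolding Fm_def by auto
  have eqI: "k = k'" if "S \<in> \<U>" "A \<in> Obj K" "k \<in> Mor K (F S) A" "k' \<in> Mor K (F S) A"
    "compose S k (\<eta> S) = compose S k' (\<eta> S)" for S A k k'
  proof -
    have "compose S k' (\<eta> S) \<in> S \<rightarrow>\<^sub>E und K A"
      by (intro compose_PiE[OF \<eta>[OF that(1)]] mor_fun[OF F[OF that(1)] that(2,4)])
    from univ[OF that(1,2) this] show ?thesis using that by blast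
  qed
  have "is_functor_from_Set \<U> K F Fm"
    unfolding is_functor_from_Set_def SetCat_simps
  proof (intro conjI ballI)
    fix S assume S: "S \<in> \<U>"
    show "F S \<in> Obj K" using F S .
    have i: "ident (SetCat \<U>) S \<in> S \<rightarrow>\<^sub>E S" using ident_PiE[of "SetCat \<U>" S] by simp
    show "Fm S S (ident (SetCat \<U>) S) = ident K (F S)"
    proof (rule eqI[OF S F[OF S] Fm(1)[OF S S i] ident_mor[OF F[OF S]]])
      show "compose S (Fm S S (ident (SetCat \<U>) S)) (\<eta> S) = compose S (ident K (F S)) (\<eta> S)"
        using Fm(2)[OF S S i] compose_ident_left[OF \<eta>[OF S]] compose_ident_right[of "\<eta> S" "SetCat \<U>" S] \<eta>[OF S]
        by simp
    qed
  next
    fix S S' s assume "S \<in> \<U>" "S' \<in> \<U>" "s \<in> S \<rightarrow>\<^sub>E S'"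
    then show "Fm S S' s \<in> Mor K (F S) (F S')" by (rule Fm)
  next
    fix S S' S'' s t
    assume a: "S \<in> \<U>" "S' \<in> \<U>" "S'' \<in> \<U>" "s \<in> S \<rightarrow>\<^sub>E S'" "t \<in> S' \<rightarrow>\<^sub>E S''"
    have st: "compose S t s \<in> S \<rightarrow>\<^sub>E S''" using a by (intro compose_PiE)
    show "Fm S S'' (compose S t s) = compose (und K (F S)) (Fm S' S'' t) (Fm S S' s)"
    proof (rule eqI[OF a(1) F[OF a(3)] Fm(1)[OF a(1,3) st]])
      show "compose (und K (F S)) (Fm S' S'' t) (Fm S S' s) \<in> Mor K (F S) (F S'')"
        using a F Fm by (meson comp_mor)
      show "compose S (Fm S S'' (compose S t s)) (\<eta> S) =
          compose S (compose (und K (F S)) (Fm S' S'' t) (Fm S S' s)) (\<eta> S)" (is "?l = ?r")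
      proof
        fix x show "?l x = ?r x"
        proof (cases "x \<in> S")
          case True
          then have "s x \<in> S'" "\<eta> S x \<in> und K (F S)" using a \<eta>[OF a(1)] by auto
          then show ?thesis
            using compose_eqD[OF Fm(2)[OF a(1,3) st] True] compose_eqD[OF Fm(2)[OF a(1,2,4)] True]
              compose_eqD[OF Fm(2)[OF a(2,3,5)]] True
            by (simp add: compose_def)
        qed (simp add: compose_def)
      qed
    qed
  qed
  moreover have "bij_betw (\<phi> S A) (Mor K (F S) A) (Mor (SetCat \<U>) S (und K A))"
    if "S \<in> \<U>" "A \<in> Obj K" for S A
  proof (rule bij_betw_imageI)
    show "inj_on (\<phi> S A) (Mor K (F S) A)"
      using eqI[OF that] by (auto simp: inj_on_def \<phi>_def)
    show "\<phi> S A ` Mor K (F S) A = Mor (SetCat \<U>) S (und K A)"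
    proof (intro equalityI subsetI)
      fix h assume "h \<in> \<phi> S A ` Mor K (F S) A"
      then show "h \<in> Mor (SetCat \<U>) S (und K A)"
        using compose_PiE[OF \<eta>[OF that(1)] mor_fun[OF F[OF that(1)] that(2)]]
        unfolding \<phi>_def SetCat_simps by blast
    next
      fix h assume "h \<in> Mor (SetCat \<U>) S (und K A)"
      then show "h \<in> \<phi> S A ` Mor K (F S) A" using univ[OF that, of h] by (auto simp: \<phi>_def)
    qed
  qed
  moreover have "\<phi> S' A' (compose (und K (F S')) a (compose (und K (F S')) h (Fm S' S s)))
      = compose S' a (compose S' (\<phi> S A h) s)"
    if "S \<in> \<U>" "S' \<in> \<U>" "s \<in> S' \<rightarrow>\<^sub>E S" for S S' A A' s a h
  proof
    fix x show "\<phi> S' A' (compose (und K (F S')) a (compose (und K (F S')) h (Fm S' S s))) x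
      = compose S' a (compose S' (\<phi> S A h) s) x"
    proof (cases "x \<in> S'")
      case True
      then have "s x \<in> S" "\<eta> S' x \<in> und K (F S')" using that \<eta>[OF that(2)] by auto
      then show ?thesis
        using compose_eqD[OF Fm(2)[OF that(2,1,3)] True] True by (simp add: compose_def \<phi>_def)
    qed (simp add: compose_def \<phi>_def)
  qed
  ultimately show ?thesis
    unfolding has_left_adjoint_def
    by (intro exI[of _ F] exI[of _ Fm] exI[of _ \<phi>]) (simp only: SetCat_simps, blast)
qed

text \<open>The unit is the image of the identity of the free object under the adjunction bijection,
  and by naturality that bijection is composition with the unit. The classification uses free
  objects through this extension property.\<close>

lemma left_adjoint_unit:
  assumes "has_left_adjoint \<U> K" "S \<in> \<U>"
  obtains F \<eta> where "F \<in> Obj K" "\<eta> \<in> S \<rightarrow>\<^sub>E und K F"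
    "\<And>A h. A \<in> Obj K \<Longrightarrow> h \<in> S \<rightarrow>\<^sub>E und K A \<Longrightarrow> \<exists>k\<in>Mor K F A. compose S k \<eta> = h"
proof -
  obtain F Fm \<phi> where func: "is_functor_from_Set \<U> K F Fm"
    and bij: "\<forall>S\<in>\<U>. \<forall>A\<in>Obj K. bij_betw (\<phi> S A) (Mor K (F S) A) (S \<rightarrow>\<^sub>E und K A)"
    and natural: "\<forall>S\<in>\<U>. \<forall>S'\<in>\<U>. \<forall>A\<in>Obj K. \<forall>A'\<in>Obj K.
           \<forall>s\<in>S' \<rightarrow>\<^sub>E S. \<forall>a\<in>Mor K A A'. \<forall>h\<in>Mor K (F S) A.
             \<phi> S' A' (compose (und K (F S')) a (compose (und K (F S')) h (Fm S' S s)))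
               = compose S' a (compose S' (\<phi> S A h) s)"
    using assms(1) unfolding has_left_adjoint_def SetCat_simps by blast
  have F: "F S \<in> Obj K" and Fi: "Fm S S (ident (SetCat \<U>) S) = ident K (F S)"
    using func assms(2) unfolding is_functor_from_Set_def by auto
  define \<eta> where "\<eta> = \<phi> S (F S) (ident K (F S))"
  have \<eta>: "\<eta> \<in> S \<rightarrow>\<^sub>E und K (F S)"
    using bij_betw_apply[OF bij[rule_format, OF assms(2) F] ident_mor[OF F]] unfolding \<eta>_def .
  have i: "ident (SetCat \<U>) S \<in> S \<rightarrow>\<^sub>E S" using ident_PiE[of "SetCat \<U>" S] by simp
  have "\<exists>k\<in>Mor K (F S) A. compose S k \<eta> = h" if A: "A \<in> Obj K" and h: "h \<in> S \<rightarrow>\<^sub>E und K A" for A h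
  proof -
    obtain k where k: "k \<in> Mor K (F S) A" "\<phi> S A k = h"
      using bij assms(2) A h by (metis bij_betw_imp_surj_on imageE)
    \<comment> \<open>Naturality at the identities of \<open>S\<close> and of \<open>F S\<close>,
      with \<open>a\<close> taken to be \<open>k\<close>. The identities cancel and leave
      \<open>\<phi> S A k\<close>, which is \<open>h\<close>, on the left.\<close>
    have "\<phi> S A (compose (und K (F S)) k (compose (und K (F S)) (ident K (F S)) (Fm S S (ident (SetCat \<U>) S))))
      = compose S k (compose S \<eta> (ident (SetCat \<U>) S))"
      unfolding \<eta>_def using natural assms(2) F A i k(1) ident_mor[OF F] by blast
    then have "h = compose S k (compose S \<eta> (ident (SetCat \<U>) S))"
      unfolding Fi using k compose_ident_left[OF ident_PiE] compose_ident_right mor_fun[OF F A k(1)]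
      by metis
    then show ?thesis using k(1) compose_ident_right[of \<eta> "SetCat \<U>" S] \<eta> by auto
  qed
  then show ?thesis using that F \<eta> by blast
qed

text \<open>The pair coequalized by an injective morphism consists of two equal morphisms. Hence the
  identity of \<open>X\<close> coequalizes it as well and factors through \<open>f\<close>; the
  factor is the inverse.\<close>

lemma inj_regular_epi_iso:
  assumes X: "X \<in> Obj K" "Y \<in> Obj K" and "is_regular_epi K X Y f" "inj_on f (und K X)" "f ` und K X = und K Y"
  shows "is_iso K X Y f"
proof -
  obtain Z a b where c: "is_coequalizer K Z X a b Y f" and Z: "Z \<in> Obj K"
    using assms(3) unfolding is_regular_epi_def by blast
  have m: "a \<in> Mor K Z X" "b \<in> Mor K Z X" "f \<in> Mor K X Y"
    and e: "compose (und K Z) f a = compose (und K Z) f b"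
    using c by (auto simp: is_coequalizer_def)
  have "a = b"
    using inj_mono[OF X m(3) assms(4)] Z m e unfolding is_mono_def by blast
  then obtain k where k: "k \<in> Mor K Y X" "compose (und K X) k f = ident K X"
    using c X ident_mor[OF X(1)] unfolding is_coequalizer_def by metis
  have "compose (und K Y) f k = ident K Y"
  proof (rule mor_eqI[OF X(2,2) comp_mor[OF X(2,1,2) k(1) m(3)] ident_mor[OF X(2)]])
    fix y assume y: "y \<in> und K Y"
    then obtain x where x: "x \<in> und K X" "y = f x" using assms(5) by blast
    then have "k (f x) = x" using fun_cong[OF k(2), of x] by (simp add: compose_def ident_def)
    then show "compose (und K Y) f k y = ident K Y y" using x y by (simp add: compose_def ident_def)
  qed
  then show ?thesis using m(3) k unfolding is_iso_def by blast
qed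

end

text \<open>
  When all functions are morphisms, the coequalizer of a pair of maps into \<open>Y\<close> is a choice of
  representatives \<open>Y \<rightarrow> Y\<close> with its image, and a surjection with section \<open>s\<close> is the coequalizer of
  the identity and \<open>s \<circ> f\<close>.
\<close>

lemma algebraic_if_all_functions:
  fixes K :: "('o, 'u) concrete_cat"
  assumes U: "set_universe \<U>" and und: "\<And>X. X \<in> Obj K \<Longrightarrow> und K X \<in> \<U>"
    and all: "\<And>X Y. X \<in> Obj K \<Longrightarrow> Y \<in> Obj K \<Longrightarrow> Mor K X Y = und K X \<rightarrow>\<^sub>E und K Y"
    and img: "\<And>X Y f. X \<in> Obj K \<Longrightarrow> Y \<in> Obj K \<Longrightarrow> f \<in> und K X \<rightarrow>\<^sub>E und K Y \<Longrightarrow>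
      \<exists>Z\<in>Obj K. und K Z = f ` und K X"
    and F: "\<And>S. S \<in> \<U> \<Longrightarrow> F S \<in> Obj K" and \<eta>: "\<And>S. S \<in> \<U> \<Longrightarrow> \<eta> S \<in> S \<rightarrow>\<^sub>E und K (F S)"
    and univ: "\<And>S A h. S \<in> \<U> \<Longrightarrow> A \<in> Obj K \<Longrightarrow> h \<in> S \<rightarrow>\<^sub>E und K A \<Longrightarrow>
      \<exists>!k. k \<in> und K (F S) \<rightarrow>\<^sub>E und K A \<and> compose S k (\<eta> S) = h"
  shows "algebraic \<U> K"
proof -
  interpret concrete_category K
    by standard (simp_all add: all ident_PiE compose_PiE)
  have reg: "is_regular_epi K X Y f \<longleftrightarrow> f ` und K X = und K Y"
    if XY: "X \<in> Obj K" "Y \<in> Obj K" and f: "f \<in> und K X \<rightarrow>\<^sub>E und K Y" for X Y f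
  proof
    assume "is_regular_epi K X Y f"
    then obtain Z a b where c: "is_coequalizer K Z X a b Y f" and Z: "Z \<in> Obj K"
      unfolding is_regular_epi_def by blast
    have ab: "a \<in> und K Z \<rightarrow>\<^sub>E und K X" "b \<in> und K Z \<rightarrow>\<^sub>E und K X"
      and eq: "compose (und K Z) f a = compose (und K Z) f b"
      and uni: "\<And>W h. W \<in> Obj K \<Longrightarrow> h \<in> und K X \<rightarrow>\<^sub>E und K W \<Longrightarrow>
        compose (und K Z) h a = compose (und K Z) h b \<Longrightarrow>
        \<exists>!k. k \<in> und K Y \<rightarrow>\<^sub>E und K W \<and> compose (und K X) k f = h"
      using c XY Z all unfolding is_coequalizer_def by auto
    \<comment> \<open>Regarded as a map onto its image, \<open>f\<close> still coequalizes
      \<open>a\<close> and \<open>b\<close>, so it factors through itself by some \<open>k\<close>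
      with values in the image. As an endomorphism of \<open>Y\<close>, \<open>k\<close> agrees with
      the identity by uniqueness, so the image is all of \<open>Y\<close>.\<close>
    obtain W where W: "W \<in> Obj K" "und K W = f ` und K X" using img[OF XY f] by blast
    have fW: "f \<in> und K X \<rightarrow>\<^sub>E und K W" using f W(2) by (auto simp: PiE_def)
    obtain k where k: "k \<in> und K Y \<rightarrow>\<^sub>E und K W" "compose (und K X) k f = f"
      using uni[OF W(1) fW eq] by blast
    have sub: "und K W \<subseteq> und K Y" using f W(2) by auto
    have "k \<in> und K Y \<rightarrow>\<^sub>E und K Y" using k(1) sub by (auto simp: PiE_def)
    moreover have "ident K Y \<in> und K Y \<rightarrow>\<^sub>E und K Y" by (rule ident_PiE)
    ultimately have "k = ident K Y"
      using uni[OF XY(2) f eq] k(2) compose_ident_left[OF f] by metis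
    then have "\<And>y. y \<in> und K Y \<Longrightarrow> y \<in> und K W" using k(1) by (metis PiE_mem ident_apply)
    then show "f ` und K X = und K Y" using W(2) sub by blast
  next
    assume s: "f ` und K X = und K Y"
    define s where "s = inv_into (und K X) f"
    have s: "\<And>y. y \<in> und K Y \<Longrightarrow> s y \<in> und K X \<and> f (s y) = y"
      unfolding s_def using \<open>f ` und K X = und K Y\<close> by (metis f_inv_into_f inv_into_into)
    then have sf: "s (f x) \<in> und K X" "f (s (f x)) = f x" if "x \<in> und K X" for x
      using f that by auto
    have "is_coequalizer K X X (ident K X) (\<lambda>x\<in>und K X. s (f x)) Y f"
      unfolding is_coequalizer_def
    proof (intro conjI ballI impI)
      fix Z h assume Z: "Z \<in> Obj K" and "h \<in> Mor K X Z"
        and e: "compose (und K X) h (ident K X) = compose (und K X) h (\<lambda>x\<in>und K X. s (f x))"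
      then have h: "h \<in> und K X \<rightarrow>\<^sub>E und K Z" using XY by (simp add: all)
      have e': "\<And>x. x \<in> und K X \<Longrightarrow> h (s (f x)) = h x"
        using compose_eqD[OF e] by (simp add: ident_def)
      show "\<exists>!k. k \<in> Mor K Y Z \<and> compose (und K X) k f = h"
      proof
        show "(\<lambda>y\<in>und K Y. h (s y)) \<in> Mor K Y Z \<and> compose (und K X) (\<lambda>y\<in>und K Y. h (s y)) f = h"
          unfolding all[OF XY(2) Z]
          using h s f e' by (auto simp: compose_def fun_eq_iff PiE_def extensional_def)
        fix k assume k: "k \<in> Mor K Y Z \<and> compose (und K X) k f = h"
        show "k = (\<lambda>y\<in>und K Y. h (s y))"
        proof
          fix y show "k y = (\<lambda>y\<in>und K Y. h (s y)) y"
            using k s unfolding all[OF XY(2) Z]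
            by (cases "y \<in> und K Y") (auto simp: compose_def PiE_def extensional_def)
        qed
      qed
    qed (use XY sf f in \<open>auto simp: all compose_def ident_def fun_eq_iff\<close>)
    then show "is_regular_epi K X Y f" unfolding is_regular_epi_def using XY by blast
  qed
  have "has_coequalizers K"
    unfolding has_coequalizers_def
  proof (intro ballI)
    fix X Y f g assume XY: "X \<in> Obj K" "Y \<in> Obj K" and "f \<in> Mor K X Y" "g \<in> Mor K X Y"
    then have fg: "f \<in> und K X \<rightarrow>\<^sub>E und K Y" "g \<in> und K X \<rightarrow>\<^sub>E und K Y" by (simp_all add: all)
    define R where "R = {(f x, g x) | x. x \<in> und K X}"
    define E where "E = (R \<union> R\<inverse>)\<^sup>*"
    have "sym E" unfolding E_def by (intro sym_rtrancl sym_Un_converse)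
    have "trans E" unfolding E_def by (rule trans_rtrancl)
    define e where "e = (\<lambda>y\<in>und K Y. SOME z. z \<in> und K Y \<and> (y, z) \<in> E)"
    have e: "e y \<in> und K Y \<and> (y, e y) \<in> E" if "y \<in> und K Y" for y
    proof -
      have "y \<in> und K Y \<and> (y, y) \<in> E" using that by (simp add: E_def)
      then show ?thesis using someI[of "\<lambda>z. z \<in> und K Y \<and> (y, z) \<in> E" y] that by (simp add: e_def)
    qed
    \<comment> \<open>Equivalent points have the same candidates for a representative, so the choice
      operator is applied to one and the same predicate.\<close>
    have e_eq: "e y = e z" if "y \<in> und K Y" "z \<in> und K Y" "(y, z) \<in> E" for y z
    proof -
      have "(\<lambda>w. w \<in> und K Y \<and> (y, w) \<in> E) = (\<lambda>w. w \<in> und K Y \<and> (z, w) \<in> E)"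
        using that(3) \<open>sym E\<close> \<open>trans E\<close> by (meson symD transD)
      then show ?thesis using that by (simp add: e_def)
    qed
    have eE: "e \<in> und K Y \<rightarrow>\<^sub>E und K Y" using e by (auto simp: e_def)
    obtain Q where Q: "Q \<in> Obj K" "und K Q = e ` und K Y" using img[OF XY(2,2) eE] by blast
    have eQ: "e \<in> und K Y \<rightarrow>\<^sub>E und K Q" using eE Q(2) by (auto simp: PiE_def)
    have ee: "e (e y) = e y" if "y \<in> und K Y" for y
      using e_eq[of "e y" y] e[OF that] that symD[OF \<open>sym E\<close>] by blast
    have "is_coequalizer K X Y f g Q e"
      unfolding is_coequalizer_def
    proof (intro conjI ballI impI)
      show "compose (und K X) e f = compose (und K X) e g"
      proof
        fix x show "compose (und K X) e f x = compose (und K X) e g x"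
        proof (cases "x \<in> und K X")
          case True
          then have "(f x, g x) \<in> E" unfolding E_def R_def by blast
          then show ?thesis using e_eq[OF PiE_mem[OF fg(1)] PiE_mem[OF fg(2)]] True by (simp add: compose_def)
        qed (simp add: compose_def)
      qed
      fix Z h assume Z: "Z \<in> Obj K" and "h \<in> Mor K Y Z"
        and c: "compose (und K X) h f = compose (und K X) h g"
      then have h: "h \<in> und K Y \<rightarrow>\<^sub>E und K Z" using XY by (simp add: all)
      have "h y = h z" if "(y, z) \<in> E" for y z
        using that unfolding E_def
      proof (induction rule: rtrancl_induct)
        case (step u v)
        then show ?case using compose_eqD[OF c] unfolding R_def by auto
      qed simp
      then have he: "h (e y) = h y" if "y \<in> und K Y" for y using e[OF that] by metis
      show "\<exists>!k. k \<in> Mor K Q Z \<and> compose (und K Y) k e = h"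
      proof
        show "restrict h (und K Q) \<in> Mor K Q Z \<and> compose (und K Y) (restrict h (und K Q)) e = h"
          unfolding all[OF Q(1) Z] using h he e Q(2) eQ
          by (auto simp: compose_def fun_eq_iff PiE_def extensional_def)
        fix k assume k: "k \<in> Mor K Q Z \<and> compose (und K Y) k e = h"
        show "k = restrict h (und K Q)"
        proof
          fix q show "k q = restrict h (und K Q) q"
          proof (cases "q \<in> und K Q")
            case True
            then obtain y where "y \<in> und K Y" "q = e y" using Q(2) by blast
            then show ?thesis using k True ee he by (auto simp: compose_def)
          qed (use k in \<open>auto simp: all[OF Q(1) Z] PiE_def extensional_def\<close>)
        qed
      qed
    qed (use XY Q fg eQ in \<open>auto simp: all\<close>)
    then show "\<exists>Q q. is_coequalizer K X Y f g Q q" by blast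
  qed
  moreover have "has_left_adjoint \<U> K"
    by (rule left_adjointI[of \<U> F \<eta>]) (simp_all add: F \<eta> all univ)
  moreover have "preserves_regular_epis \<U> K" "reflects_regular_epis \<U> K"
    unfolding preserves_regular_epis_def reflects_regular_epis_def
    using reg Set_regular_epi_iff[OF U und und] all by auto
  ultimately show ?thesis unfolding algebraic_def by blast
qed

section \<open>Reflections and closure properties of epireflective subcategories\<close>

context concrete_category
begin

text \<open>Since \<open>r\<close> followed by \<open>h\<close> and then \<open>r\<close> is again
  \<open>r\<close>, and \<open>r\<close> can be cancelled as an epimorphism, \<open>h\<close> is
  inverse to \<open>r\<close> on both sides. So an object whose reflection splits in this way is
  isomorphic to a member of \<open>C\<close>.\<close>

lemma reflection_iso_if_split:
  assumes C: "C \<subseteq> Obj K" and X: "X \<in> Obj K" and r: "is_reflection K C X A r" "is_epi K X A r"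
    and h: "h \<in> Mor K A X" "compose (und K X) h r = ident K X"
  shows "is_iso K A X h"
proof -
  have A: "A \<in> Obj K" and rm: "r \<in> Mor K X A" using r C by (auto simp: is_reflection_def)
  have "compose (und K X) (compose (und K A) r h) r = compose (und K X) (ident K A) r"
    unfolding comp_assoc[OF X A rm] h(2)
    using compose_ident_left[OF mor_fun[OF X A rm]] compose_ident_right[OF mor_fun[OF X A rm]] by simp
  then have "compose (und K A) r h = ident K A"
    using r(2) A comp_mor[OF A X A h(1) rm] ident_mor[OF A] unfolding is_epi_def by blast
  then show ?thesis unfolding is_iso_def using h rm by blast
qed

text \<open>Each projection of \<open>P\<close> ends in a member of \<open>C\<close> and therefore
  factors through the reflection \<open>r\<close>. The product property assembles the factors into a
  morphism \<open>h\<close> that splits \<open>r\<close>.\<close>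

lemma epireflective_closed_under_products:
  assumes "subcategory K C" "epireflective K C"
  shows "closed_under_products \<U> K C"
  unfolding closed_under_products_def
proof (intro ballI allI impI)
  fix I X P p assume X: "X \<in> I \<rightarrow> C" and P: "is_product K I X P p"
  have C: "C \<subseteq> Obj K" using assms(1) by (auto simp: subcategory_def)
  have PO: "P \<in> Obj K" and p: "\<And>i. i \<in> I \<Longrightarrow> p i \<in> Mor K P (X i)"
    and univ: "\<And>Q q. Q \<in> Obj K \<Longrightarrow> (\<forall>i\<in>I. q i \<in> Mor K Q (X i)) \<Longrightarrow>
        (\<exists>!h. h \<in> Mor K Q P \<and> (\<forall>i\<in>I. compose (und K Q) (p i) h = q i))"
    using P by (auto simp: is_product_def)
  obtain A r where r: "is_reflection K C P A r" "is_epi K P A r"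
    using assms(2) PO unfolding epireflective_def reflective_def by meson
  then have A: "A \<in> C" "A \<in> Obj K" and rm: "r \<in> Mor K P A" using C by (auto simp: is_reflection_def)
  have "\<exists>q. q \<in> Mor K A (X i) \<and> compose (und K P) q r = p i" if "i \<in> I" for i
  proof -
    have "X i \<in> C" using X that by blast
    then show ?thesis using r(1) p[OF that] unfolding is_reflection_def by blast
  qed
  then obtain q where q: "\<And>i. i \<in> I \<Longrightarrow> q i \<in> Mor K A (X i)" "\<And>i. i \<in> I \<Longrightarrow> compose (und K P) (q i) r = p i"
    by metis
  obtain h where h: "h \<in> Mor K A P" "\<And>i. i \<in> I \<Longrightarrow> compose (und K A) (p i) h = q i"
    using univ[OF A(2), of q] q(1) by blast
  have "compose (und K P) h r \<in> Mor K P P" using comp_mor[OF PO A(2) PO rm h(1)] .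
  moreover have "compose (und K P) (p i) (compose (und K P) h r) = p i" if "i \<in> I" for i
    using comp_assoc[OF PO A(2) rm] h(2)[OF that] q(2)[OF that] by metis
  moreover have "compose (und K P) (p i) (ident K P) = p i" if "i \<in> I" for i
    by (rule compose_ident_right, rule mor_fun[OF PO _ p[OF that]]) (use X that C in blast)
  ultimately have "compose (und K P) h r = ident K P"
    using univ[OF PO, of p] p ident_mor[OF PO] by blast
  then have "is_iso K A P h" using reflection_iso_if_split[OF C PO r h(1)] by blast
  then show "P \<in> C" using assms(1) A(1) PO unfolding subcategory_def by blast
qed

lemma iso_inverse:
  assumes "is_iso K X Y f"
  shows "\<exists>g. is_iso K Y X g"
  using assms unfolding is_iso_def by blast

text \<open>The monomorphism factors through the reflection of its domain, which is an epimorphism;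
  extremality turns this reflection into an isomorphism.\<close>

lemma epireflective_closed_under_extremal_subobjects:
  assumes "subcategory K C" "epireflective K C"
  shows "closed_under_extremal_subobjects K C"
  unfolding closed_under_extremal_subobjects_def
proof (intro ballI allI impI)
  fix X Y m assume Y: "Y \<in> C" and X: "X \<in> Obj K" and m: "is_extremal_mono K X Y m"
  have C: "C \<subseteq> Obj K" using assms(1) by (auto simp: subcategory_def)
  obtain A r where r: "is_reflection K C X A r" "is_epi K X A r"
    using assms(2) X unfolding epireflective_def reflective_def by meson
  have "m \<in> Mor K X Y" using m by (auto simp: is_extremal_mono_def is_mono_def)
  then obtain f where "f \<in> Mor K A Y" "compose (und K X) f r = m"
    using r(1) Y unfolding is_reflection_def by blast
  moreover have A: "A \<in> C" using r by (auto simp: is_reflection_def)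
  ultimately have "is_iso K X A r" using m r(2) C unfolding is_extremal_mono_def by blast
  then show "X \<in> C" using iso_inverse A X assms(1) unfolding subcategory_def by blast
qed

text \<open>\<open>epireflective\<close> speaks of every reflection arrow. Two reflections of the
  same object differ by an isomorphism, so a single surjective one makes all of them surjective and
  hence epimorphisms.\<close>

lemma epireflectiveI:
  assumes C: "C \<subseteq> Obj K"
    and ex: "\<And>X. X \<in> Obj K \<Longrightarrow> \<exists>A r. is_reflection K C X A r \<and> r ` und K X = und K A"
  shows "epireflective K C"
  unfolding epireflective_def reflective_def
proof (intro conjI ballI allI impI)
  fix X assume "X \<in> Obj K"
  then show "\<exists>A r. is_reflection K C X A r" using ex by blast
next
  fix X A r assume X: "X \<in> Obj K" and r: "is_reflection K C X A r"
  obtain B s where s: "is_reflection K C X B s" "s ` und K X = und K B" using ex[OF X] by blast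
  have O: "A \<in> Obj K" "B \<in> Obj K" "A \<in> C" "B \<in> C" "r \<in> Mor K X A" "s \<in> Mor K X B"
    using r s C by (auto simp: is_reflection_def)
  obtain g where g: "g \<in> Mor K A B" "compose (und K X) g r = s"
    using r O unfolding is_reflection_def by blast
  obtain k where k: "k \<in> Mor K B A" "compose (und K X) k s = r"
    using s O unfolding is_reflection_def by blast
  have "compose (und K X) (compose (und K A) k g) r = r"
    using comp_assoc[OF X O(1,5)] g k by metis
  moreover have "compose (und K X) (ident K A) r = r"
    by (rule compose_ident_left[OF mor_fun[OF X O(1,5)]])
  ultimately have kg: "compose (und K A) k g = ident K A"
    using r O comp_mor[OF O(1,2,1) g(1) k(1)] ident_mor[OF O(1)] unfolding is_reflection_def by blast
  have "und K A \<subseteq> r ` und K X"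
  proof
    fix a assume a: "a \<in> und K A"
    then have "k (g a) = a" using fun_cong[OF kg, of a] by (simp add: compose_def ident_def)
    moreover obtain x where "x \<in> und K X" "g a = s x" using s(2) mor_apply[OF O(1,2) g(1) a] by blast
    ultimately show "a \<in> r ` und K X" using fun_cong[OF k(2), of x] by (auto simp: compose_def)
  qed
  then have "r ` und K X = und K A" using mor_fun[OF X O(1,5)] by auto
  then show "is_epi K X A r" using surj_epi[OF X O(1,5)] by blast
qed

end


section \<open>Categories of spaces\<close>

lemma card_le_1_iff: "finite A \<and> card A \<le> 1 \<longleftrightarrow> (\<forall>x\<in>A. \<forall>y\<in>A. x = y)"
proof
  assume "finite A \<and> card A \<le> 1"
  then show "\<forall>x\<in>A. \<forall>y\<in>A. x = y" by (metis One_nat_def card_le_Suc0_iff_eq)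
next
  assume a: "\<forall>x\<in>A. \<forall>y\<in>A. x = y"
  then have "A = {} \<or> (\<exists>x. A = {x})" by blast
  then show "finite A \<and> card A \<le> 1" by auto
qed

text \<open>
  \<open>initial_lift\<close> provides subspaces, and with \<open>disc {x}\<close> for \<open>X\<close> also the indiscrete spaces.
  The assumption \<open>cantor_object\<close> says that \<open>P\<close>, with points named by binary sequences via \<open>\<kappa>\<close>, is the
  countable power of a discrete space with two points, and that this power is not discrete.
\<close>

locale space_category = concrete_category T for T :: "('u space_obj, 'u) concrete_cat" +
  fixes \<U> :: "'u set set" and disc :: "'u set \<Rightarrow> 'u space_obj"
  assumes universe: "set_universe \<U>"
    and und_small: "X \<in> Obj T \<Longrightarrow> und T X \<in> \<U>"
    and constant_mor: "X \<in> Obj T \<Longrightarrow> Y \<in> Obj T \<Longrightarrow> f \<in> und T X \<rightarrow>\<^sub>E und T Y \<Longrightarrow>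
      (\<And>x y. x \<in> und T X \<Longrightarrow> y \<in> und T X \<Longrightarrow> f x = f y) \<Longrightarrow> f \<in> Mor T X Y"
    and initial_lift: "X \<in> Obj T \<Longrightarrow> S \<in> \<U> \<Longrightarrow> m \<in> S \<rightarrow>\<^sub>E und T X \<Longrightarrow>
      \<exists>L\<in>Obj T. und T L = S \<and> m \<in> Mor T L X \<and>
        (\<forall>Z\<in>Obj T. \<forall>g\<in>und T Z \<rightarrow>\<^sub>E S. compose (und T Z) m g \<in> Mor T Z X \<longrightarrow> g \<in> Mor T Z L)"
    and disc_obj: "S \<in> \<U> \<Longrightarrow> disc S \<in> Obj T"
    and und_disc: "S \<in> \<U> \<Longrightarrow> und T (disc S) = S"
    and disc_mor: "S \<in> \<U> \<Longrightarrow> Z \<in> Obj T \<Longrightarrow> f \<in> S \<rightarrow>\<^sub>E und T Z \<Longrightarrow> f \<in> Mor T (disc S) Z"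
    and indiscrete_mor: "X \<in> Obj T \<Longrightarrow> indiscrete X \<Longrightarrow> Z \<in> Obj T \<Longrightarrow>
      f \<in> und T Z \<rightarrow>\<^sub>E und T X \<Longrightarrow> f \<in> Mor T Z X"
    and two_points_discrete: "X \<in> Obj T \<Longrightarrow> \<not> indiscrete X \<Longrightarrow> Y \<in> Obj T \<Longrightarrow> p \<noteq> q \<Longrightarrow>
      und T Y = {p, q} \<Longrightarrow> (\<And>f. f \<in> und T Y \<rightarrow>\<^sub>E und T X \<Longrightarrow> f \<in> Mor T Y X) \<Longrightarrow>
      ident T Y \<in> Mor T Y (disc {p, q})"
    and cantor_object: "a \<noteq> b \<Longrightarrow> \<exists>P\<in>Obj T. \<exists>\<kappa>. bij_betw \<kappa> (und T P) (UNIV :: (nat \<Rightarrow> bool) set) \<and>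
      (\<forall>n. (\<lambda>x\<in>und T P. if \<kappa> x n then a else b) \<in> Mor T P (disc {a, b})) \<and>
      (\<forall>Z\<in>Obj T. \<forall>f\<in>und T Z \<rightarrow>\<^sub>E und T P.
        (\<forall>n. (\<lambda>z\<in>und T Z. if \<kappa> (f z) n then a else b) \<in> Mor T Z (disc {a, b})) \<longrightarrow> f \<in> Mor T Z P) \<and>
      (\<lambda>x\<in>und T P. if \<kappa> x = (\<lambda>n. False) then a else b) \<notin> Mor T P (disc {a, b})"
begin

text \<open>\<open>coarse\<close> and \<open>fine\<close> express indiscreteness and discreteness by
  their universal properties. Unlike the case distinction behind \<open>indiscrete\<close>, they can
  be handled in all three categories at once; \<open>indiscrete_iff_coarse\<close> links the two
  languages.\<close>

definition coarse :: "'u space_obj \<Rightarrow> bool" where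
  "coarse X \<longleftrightarrow> (\<forall>Z\<in>Obj T. \<forall>f\<in>und T Z \<rightarrow>\<^sub>E und T X. f \<in> Mor T Z X)"

definition fine :: "'u space_obj \<Rightarrow> bool" where
  "fine X \<longleftrightarrow> (\<forall>Z\<in>Obj T. \<forall>f\<in>und T X \<rightarrow>\<^sub>E und T Z. f \<in> Mor T X Z)"

text \<open>The second line is initiality: \<open>X\<close> carries the structure induced by
  \<open>m\<close>, which makes it a subspace of \<open>Y\<close> up to isomorphism.\<close>

definition embedding :: "'u space_obj \<Rightarrow> 'u space_obj \<Rightarrow> ('u \<Rightarrow> 'u) \<Rightarrow> bool" where
  "embedding X Y m \<longleftrightarrow> m \<in> Mor T X Y \<and> inj_on m (und T X) \<and>
    (\<forall>Z\<in>Obj T. \<forall>g\<in>und T Z \<rightarrow>\<^sub>E und T X. compose (und T Z) m g \<in> Mor T Z Y \<longrightarrow> g \<in> Mor T Z X)"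

lemma finite_small: "finite S \<Longrightarrow> S \<in> \<U>"
  using universe_finite[OF universe] .

lemma fine_disc: "S \<in> \<U> \<Longrightarrow> fine (disc S)"
  by (simp add: fine_def und_disc disc_mor)

lemma subsingleton_coarse:
  assumes "X \<in> Obj T" "\<forall>x\<in>und T X. \<forall>y\<in>und T X. x = y"
  shows "coarse X"
  unfolding coarse_def
proof (intro ballI)
  fix Z f assume Z: "Z \<in> Obj T" and f: "f \<in> und T Z \<rightarrow>\<^sub>E und T X"
  show "f \<in> Mor T Z X" by (rule constant_mor[OF Z assms(1) f]) (use f assms(2) in blast)
qed

lemma coarse_object:
  assumes "S \<in> \<U>"
  shows "\<exists>X\<in>Obj T. und T X = S \<and> coarse X"
proof -
  fix u :: 'u
  have u: "{u} \<in> \<U>" by (simp add: finite_small)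
  have c: "coarse (disc {u})"
    by (rule subsingleton_coarse) (simp_all add: disc_obj und_disc u)
  have "(\<lambda>x\<in>S. u) \<in> S \<rightarrow>\<^sub>E und T (disc {u})" by (simp add: und_disc u)
  from initial_lift[OF disc_obj[OF u] assms this] obtain L where L: "L \<in> Obj T" "und T L = S"
    "\<And>Z g. Z \<in> Obj T \<Longrightarrow> g \<in> und T Z \<rightarrow>\<^sub>E S \<Longrightarrow>
      compose (und T Z) (\<lambda>x\<in>S. u) g \<in> Mor T Z (disc {u}) \<Longrightarrow> g \<in> Mor T Z L" by blast
  have "coarse L"
    unfolding coarse_def L(2)
  proof (intro ballI)
    fix Z g assume Z: "Z \<in> Obj T" and g: "g \<in> und T Z \<rightarrow>\<^sub>E S"
    have "compose (und T Z) (\<lambda>x\<in>S. u) g \<in> und T Z \<rightarrow>\<^sub>E und T (disc {u})"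
      using g by (intro compose_PiE) (auto simp: und_disc u)
    then show "g \<in> Mor T Z L" using L(3)[OF Z g] c Z unfolding coarse_def by blast
  qed
  then show ?thesis using L by blast
qed

text \<open>Into a coarse two-point space every function on the Cantor object would be a morphism,
  including the indicator of the zero sequence.\<close>

lemma two_points_not_coarse:
  assumes "a \<noteq> b"
  shows "\<not> coarse (disc {a, b})"
proof
  assume c: "coarse (disc {a, b})"
  have ab: "{a, b} \<in> \<U>" by (simp add: finite_small)
  obtain P \<kappa> where P: "P \<in> Obj T"
    "(\<lambda>x\<in>und T P. if \<kappa> x = (\<lambda>n :: nat. False) then a else b) \<notin> Mor T P (disc {a, b})"
    using cantor_object[OF assms] by blast
  moreover have "(\<lambda>x\<in>und T P. if \<kappa> x = (\<lambda>n :: nat. False) then a else b) \<in> und T P \<rightarrow>\<^sub>E und T (disc {a, b})"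
    by (auto simp: und_disc ab)
  ultimately show False using c unfolding coarse_def by blast
qed

text \<open>Suppose \<open>X\<close> is coarse but not \<open>indiscrete\<close>. All maps into
  \<open>X\<close> are morphisms, so \<open>two_points_discrete\<close> applies even to a coarse
  two-point space \<open>Y\<close>. Then the identity from \<open>Y\<close> to
  \<open>disc {p, q}\<close> is a morphism, which makes the latter coarse.\<close>

lemma indiscrete_iff_coarse:
  assumes X: "X \<in> Obj T"
  shows "indiscrete X \<longleftrightarrow> coarse X"
proof
  assume "indiscrete X"
  then show "coarse X" unfolding coarse_def using indiscrete_mor[OF X] by blast
next
  assume c: "coarse X"
  show "indiscrete X"
  proof (rule ccontr)
    assume n: "\<not> indiscrete X"
    obtain p q :: 'u where pq: "p \<noteq> q" using universe_two_points[OF universe] .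
    have s: "{p, q} \<in> \<U>" by (simp add: finite_small)
    obtain Y where Y: "Y \<in> Obj T" "und T Y = {p, q}" "coarse Y" using coarse_object[OF s] by blast
    have i: "ident T Y \<in> Mor T Y (disc {p, q})"
      by (rule two_points_discrete[OF X n Y(1) pq Y(2)]) (use c Y(1) coarse_def in blast)
    have "coarse (disc {p, q})"
      unfolding coarse_def und_disc[OF s]
    proof (intro ballI)
      fix Z f assume Z: "Z \<in> Obj T" and f: "f \<in> und T Z \<rightarrow>\<^sub>E {p, q}"
      then have "f \<in> Mor T Z Y" using Y unfolding coarse_def by simp
      from comp_mor[OF Z Y(1) disc_obj[OF s] this i]
      show "f \<in> Mor T Z (disc {p, q})" using compose_ident_left[of f "und T Z" T Y] f Y(2) by simp
    qed
    then show False using two_points_not_coarse[OF pq] by simp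
  qed
qed

section \<open>Epimorphisms, embeddings and isomorphisms of spaces\<close>

text \<open>A point outside the image is told apart from it by two maps into a coarse two-point
  space, where every function counts as a morphism.\<close>

lemma epi_surj:
  assumes X: "X \<in> Obj T" and Y: "Y \<in> Obj T" and e: "is_epi T X Y f"
  shows "f ` und T X = und T Y"
proof (rule ccontr)
  have fm: "f \<in> Mor T X Y" using e by (simp add: is_epi_def)
  note f = mor_fun[OF X Y fm]
  assume "f ` und T X \<noteq> und T Y"
  then obtain y where y: "y \<in> und T Y" "y \<notin> f ` und T X" using f by blast
  obtain p q :: 'u where pq: "p \<noteq> q" using universe_two_points[OF universe] .
  obtain Z where Z: "Z \<in> Obj T" "und T Z = {p, q}" "coarse Z"
    using coarse_object[OF finite_small[of "{p, q}"]] by auto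
  let ?g = "\<lambda>z\<in>und T Y. p" and ?h = "\<lambda>z\<in>und T Y. if z = y then q else p"
  have "?g \<in> und T Y \<rightarrow>\<^sub>E und T Z" "?h \<in> und T Y \<rightarrow>\<^sub>E und T Z" using Z by auto
  then have "?g \<in> Mor T Y Z" "?h \<in> Mor T Y Z" using Z Y unfolding coarse_def by blast+
  moreover have "compose (und T X) ?g f = compose (und T X) ?h f"
    using y by (auto simp: compose_def fun_eq_iff)
  ultimately have "?g = ?h" using e Z(1) unfolding is_epi_def by blast
  from fun_cong[OF this, of y] show False using pq y by simp
qed

text \<open>If \<open>m\<close> is \<open>f\<close> after an epimorphism \<open>e\<close>, then
  \<open>e\<close> is surjective as an epimorphism and injective because \<open>m\<close> is. Its
  inverse followed by \<open>m\<close> is the morphism \<open>f\<close>, so initiality of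
  \<open>m\<close> makes the inverse a morphism.\<close>

lemma embedding_extremal_mono:
  assumes X: "X \<in> Obj T" and Y: "Y \<in> Obj T" and m: "embedding X Y m"
  shows "is_extremal_mono T X Y m"
  unfolding is_extremal_mono_def
proof (intro conjI ballI allI impI)
  show "is_mono T X Y m" using m inj_mono[OF X Y] by (auto simp: embedding_def)
  fix Z e f assume Z: "Z \<in> Obj T" and "is_epi T X Z e \<and> f \<in> Mor T Z Y \<and> m = compose (und T X) f e"
  then have e: "is_epi T X Z e" and f: "f \<in> Mor T Z Y" and fe: "m = compose (und T X) f e" by auto
  have em: "e \<in> Mor T X Z" using e by (simp add: is_epi_def)
  have inj: "inj_on e (und T X)"
    using m fe unfolding embedding_def by (auto simp: inj_on_def compose_def)
  note surj = epi_surj[OF X Z e]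
  let ?g = "\<lambda>z\<in>und T Z. inv_into (und T X) e z"
  have g: "?g z \<in> und T X" "e (?g z) = z" if "z \<in> und T Z" for z
    using that surj by (auto simp: f_inv_into_f inv_into_into)
  have "compose (und T Z) m ?g = f"
    using g mor_fun[OF Z Y f] by (auto simp: fe compose_def fun_eq_iff PiE_def extensional_def)
  then have gm: "?g \<in> Mor T Z X"
    using m f Z g(1) unfolding embedding_def by fastforce
  moreover have "compose (und T X) ?g e = ident T X"
    using inj mor_apply[OF X Z em] by (auto simp: compose_def ident_def fun_eq_iff)
  moreover have "compose (und T Z) e ?g = ident T Z"
    using g by (auto simp: compose_def ident_def fun_eq_iff)
  ultimately show "is_iso T X Z e" unfolding is_iso_def using em by blast
qed

lemma subspace:
  assumes "X \<in> Obj T" "m \<in> S \<rightarrow>\<^sub>E und T X" "inj_on m S" "S \<in> \<U>"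
  obtains L where "L \<in> Obj T" "und T L = S" "embedding L X m"
  using initial_lift[OF assms(1,4,2)] assms(3) unfolding embedding_def by blast

lemma subcategory_iso_closed:
  "subcategory T C \<Longrightarrow> X \<in> C \<Longrightarrow> is_iso T X Y f \<Longrightarrow> Y \<in> Obj T \<Longrightarrow> Y \<in> C"
  unfolding subcategory_def by blast

lemma iso_to_fine:
  assumes "X \<in> Obj T" "Y \<in> Obj T" "is_iso T X Y f" "fine X"
  shows "fine Y"
  unfolding fine_def
proof (intro ballI)
  fix Z h assume Z: "Z \<in> Obj T" and h: "h \<in> und T Y \<rightarrow>\<^sub>E und T Z"
  obtain g where f: "f \<in> Mor T X Y" and g: "g \<in> Mor T Y X" "compose (und T Y) f g = ident T Y"
    using assms(3) unfolding is_iso_def by blast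
  have "compose (und T X) h f \<in> Mor T X Z"
    using assms(4) Z compose_PiE[OF mor_fun[OF assms(1,2) f] h] unfolding fine_def by blast
  from comp_mor[OF assms(2,1) Z g(1) this]
  have "compose (und T Y) (compose (und T X) h f) g \<in> Mor T Y Z" .
  moreover have "compose (und T Y) (compose (und T X) h f) g = h"
  proof
    fix z show "compose (und T Y) (compose (und T X) h f) g z = h z"
    proof (cases "z \<in> und T Y")
      case True
      then have "g z \<in> und T X" using mor_apply[OF assms(2,1) g(1)] by blast
      then show ?thesis using fun_cong[OF g(2), of z] True by (simp add: compose_def ident_def)
    qed (use h in \<open>auto simp: compose_def PiE_def extensional_def\<close>)
  qed
  ultimately show "h \<in> Mor T Y Z" by simp
qed

lemma iso_bij:
  assumes "X \<in> Obj T" "Y \<in> Obj T" "is_iso T X Y f"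
  shows "bij_betw f (und T X) (und T Y)"
proof -
  obtain g where f: "f \<in> Mor T X Y" and g: "g \<in> Mor T Y X" "compose (und T X) g f = ident T X"
    "compose (und T Y) f g = ident T Y"
    using assms(3) unfolding is_iso_def by blast
  show ?thesis
  proof (rule bij_betw_byWitness[where f' = g])
    show "\<forall>x\<in>und T X. g (f x) = x" using fun_cong[OF g(2)] by (metis compose_eq ident_apply)
    show "\<forall>y\<in>und T Y. f (g y) = y" using fun_cong[OF g(3)] by (metis compose_eq ident_apply)
  qed (use mor_apply[OF assms(1,2) f] mor_apply[OF assms(2,1) g(1)] in auto)
qed

lemma subcategory_fine: "subcategory T {X \<in> Obj T. fine X}"
  unfolding subcategory_def using iso_to_fine by blast

lemma full_sub_category:
  "C \<subseteq> Obj T \<Longrightarrow> concrete_category (full_sub T C)"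
  by standard (auto simp: ident_def[of "full_sub T C"] ident_def[of T, symmetric]
      intro: mor_fun[THEN PiE_mem] ident_mor comp_mor dest: mor_fun)

lemma ident_full_sub [simp]: "ident (full_sub T C) X = ident T X"
  by (simp add: ident_def)


section \<open>Algebraic and epireflective subcategories\<close>

text \<open>Such a class is equivalent to the category of small sets: the free object on
  \<open>S\<close> is a member carried by \<open>S\<close>, with the identity as unit. This covers
  the indiscrete and the discrete spaces alike.\<close>

lemma algebraic_if_all_functions_all_sets:
  assumes C: "C \<subseteq> Obj T" and all: "\<And>X Y f. X \<in> C \<Longrightarrow> Y \<in> C \<Longrightarrow> f \<in> und T X \<rightarrow>\<^sub>E und T Y \<Longrightarrow> f \<in> Mor T X Y"
    and ex: "\<And>S. S \<in> \<U> \<Longrightarrow> \<exists>X\<in>C. und T X = S"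
  shows "algebraic \<U> (full_sub T C)"
proof -
  obtain F where F: "\<And>S. S \<in> \<U> \<Longrightarrow> F S \<in> C \<and> und T (F S) = S" using ex by metis
  show ?thesis
  proof (rule algebraic_if_all_functions[where F = F and \<eta> = "\<lambda>S. \<lambda>x\<in>S. x"])
    fix X Y f
    assume "X \<in> Obj (full_sub T C)" "Y \<in> Obj (full_sub T C)"
      and f: "f \<in> und (full_sub T C) X \<rightarrow>\<^sub>E und (full_sub T C) Y"
    then have "und T Y \<in> \<U>" using und_small C by auto
    then have "f ` und T X \<in> \<U>" by (rule universe_subset[OF universe]) (use f in auto)
    then show "\<exists>Z\<in>Obj (full_sub T C). und (full_sub T C) Z = f ` und (full_sub T C) X"
      using ex by simp
  next
    fix S A h assume S: "S \<in> \<U>" and h: "h \<in> S \<rightarrow>\<^sub>E und (full_sub T C) A"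
    have "compose S k (\<lambda>x\<in>S. x) = k" if "k \<in> S \<rightarrow>\<^sub>E und T A" for k
      using that by (intro compose_Id) (auto simp: PiE_def)
    then show "\<exists>!k. k \<in> und (full_sub T C) (F S) \<rightarrow>\<^sub>E und (full_sub T C) A \<and> compose S k (\<lambda>x\<in>S. x) = h"
      using F[OF S] h by (metis full_sub_simps(2))
  next
    fix X Y assume "X \<in> Obj (full_sub T C)" "Y \<in> Obj (full_sub T C)"
    then show "Mor (full_sub T C) X Y = und (full_sub T C) X \<rightarrow>\<^sub>E und (full_sub T C) Y"
      using mor_fun all C by (simp add: subset_iff) blast
  qed (use F C und_small universe in auto)
qed

text \<open>\<open>E\<close> is the free object on the empty set, the one point in which the two
  applications differ: it is the empty space for the class of spaces with at most one point, and
  \<open>disc {u}\<close> for the class of one-point spaces. On a nonempty set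
  \<open>disc {u}\<close> is free, because all maps into a set with at most one point are
  constant.\<close>

lemma algebraic_if_subsingletons:
  assumes C: "C \<subseteq> Obj T" and sub: "\<And>X. X \<in> C \<Longrightarrow> \<forall>x\<in>und T X. \<forall>y\<in>und T X. x = y"
    and "disc {u} \<in> C" and E: "E \<in> C" "\<And>A. A \<in> C \<Longrightarrow> \<exists>!k. k \<in> und T E \<rightarrow>\<^sub>E und T A"
  shows "algebraic \<U> (full_sub T C)"
proof -
  have u: "und T (disc {u}) = {u}" by (simp add: und_disc finite_small)
  show ?thesis
  proof (rule algebraic_if_all_functions[where F = "\<lambda>S. if S = {} then E else disc {u}"
        and \<eta> = "\<lambda>S. \<lambda>x\<in>S. u"])
    fix X Y f
    assume XY: "X \<in> Obj (full_sub T C)" "Y \<in> Obj (full_sub T C)"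
      and f: "f \<in> und (full_sub T C) X \<rightarrow>\<^sub>E und (full_sub T C) Y"
    show "\<exists>Z\<in>Obj (full_sub T C). und (full_sub T C) Z = f ` und (full_sub T C) X"
    proof (cases "und T X = {}")
      case True
      then show ?thesis using XY by auto
    next
      case False
      then obtain x where "x \<in> und T X" by blast
      moreover have "\<forall>x\<in>und T Y. \<forall>y\<in>und T Y. x = y" "f \<in> und T X \<rightarrow>\<^sub>E und T Y"
        using sub XY f by simp_all
      ultimately have "und T Y = f ` und T X" by blast
      then show ?thesis using XY by auto
    qed
  next
    fix S A h assume S: "S \<in> \<U>" and "A \<in> Obj (full_sub T C)" and "h \<in> S \<rightarrow>\<^sub>E und (full_sub T C) A"
    then have A: "A \<in> C" and h: "h \<in> S \<rightarrow>\<^sub>E und T A" by auto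
    show "\<exists>!k. k \<in> und (full_sub T C) (if S = {} then E else disc {u}) \<rightarrow>\<^sub>E und (full_sub T C) A \<and>
        compose S k (\<lambda>x\<in>S. u) = h"
    proof (cases "S = {}")
      case True
      then have "compose S k (\<lambda>x\<in>S. u) = h" for k using h by (simp add: compose_def restrict_def)
      then show ?thesis using E(2)[OF A] True by simp
    next
      case False
      then obtain x where x: "x \<in> S" by blast
      then have c: "h x \<in> und T A" using h by blast
      then have A': "y = h x" if "y \<in> und T A" for y using sub[OF A] that by blast
      have hx: "h y = h x" if "y \<in> S" for y using A' h that by blast
      have "(\<lambda>z\<in>{u}. h x) \<in> {u} \<rightarrow>\<^sub>E und T A" using c by auto
      moreover have "compose S (\<lambda>z\<in>{u}. h x) (\<lambda>x\<in>S. u) = h"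
        using hx h by (auto simp: compose_def fun_eq_iff PiE_def extensional_def)
      moreover have "k = (\<lambda>z\<in>{u}. h x)" if "k \<in> {u} \<rightarrow>\<^sub>E und T A" for k
      proof (rule PiE_ext[OF that])
        show "(\<lambda>z\<in>{u}. h x) \<in> {u} \<rightarrow>\<^sub>E und T A" using c by auto
        fix z assume "z \<in> {u}"
        then show "k z = (\<lambda>z\<in>{u}. h x) z" using A'[OF PiE_mem[OF that]] by simp
      qed
      ultimately have "\<exists>!k. k \<in> {u} \<rightarrow>\<^sub>E und T A \<and> compose S k (\<lambda>x\<in>S. u) = h" by metis
      then show ?thesis using False u by simp
    qed
  next
    fix X Y assume XY: "X \<in> Obj (full_sub T C)" "Y \<in> Obj (full_sub T C)"
    then have "coarse Y" "X \<in> Obj T" "Y \<in> Obj T" using subsingleton_coarse sub C by auto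
    then show "Mor (full_sub T C) X Y = und (full_sub T C) X \<rightarrow>\<^sub>E und (full_sub T C) Y"
      using mor_fun unfolding coarse_def full_sub_simps by blast
  next
    show "set_universe \<U>" by (rule universe)
    show "und (full_sub T C) X \<in> \<U>" if "X \<in> Obj (full_sub T C)" for X
      using that C und_small by auto
    show "(if S = {} then E else disc {u}) \<in> Obj (full_sub T C)" for S
      using assms(3) E(1) by simp
    show "(\<lambda>x\<in>S. u) \<in> S \<rightarrow>\<^sub>E und (full_sub T C) (if S = {} then E else disc {u})" for S
      by (simp add: u)
  qed
qed

lemma indiscrete_algebraic: "algebraic \<U> (full_sub T {X \<in> Obj T. indiscrete X})"
proof (rule algebraic_if_all_functions_all_sets)
  fix S assume "S \<in> \<U>"
  then show "\<exists>X\<in>{X \<in> Obj T. indiscrete X}. und T X = S"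
    using coarse_object indiscrete_iff_coarse by blast
qed (use indiscrete_mor in auto)

lemma fine_algebraic: "algebraic \<U> (full_sub T {X \<in> Obj T. fine X})"
proof (rule algebraic_if_all_functions_all_sets)
  fix S assume "S \<in> \<U>"
  then show "\<exists>X\<in>{X \<in> Obj T. fine X}. und T X = S"
    using disc_obj und_disc fine_disc by blast
qed (auto simp: fine_def)

lemma subsingletons_algebraic:
  "algebraic \<U> (full_sub T {X \<in> Obj T. finite (und T X) \<and> card (und T X) \<le> 1})"
proof (rule algebraic_if_subsingletons)
  fix u :: 'u
  show "disc {u} \<in> {X \<in> Obj T. finite (und T X) \<and> card (und T X) \<le> 1}"
    "disc {} \<in> {X \<in> Obj T. finite (und T X) \<and> card (und T X) \<le> 1}"
    by (simp_all add: disc_obj und_disc finite_small)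
  show "\<exists>!k. k \<in> und T (disc {}) \<rightarrow>\<^sub>E und T A" for A
    by (simp add: und_disc finite_small)
next
  fix X assume "X \<in> {X \<in> Obj T. finite (und T X) \<and> card (und T X) \<le> 1}"
  then show "\<forall>x\<in>und T X. \<forall>y\<in>und T X. x = y"
    unfolding card_le_1_iff by blast
qed auto

lemma singletons_algebraic: "algebraic \<U> (full_sub T {X \<in> Obj T. \<exists>x. und T X = {x}})"
proof (rule algebraic_if_subsingletons)
  fix u :: 'u
  show "disc {u} \<in> {X \<in> Obj T. \<exists>x. und T X = {x}}"
    "disc {u} \<in> {X \<in> Obj T. \<exists>x. und T X = {x}}"
    by (simp_all add: disc_obj und_disc finite_small)
  fix A assume "A \<in> {X \<in> Obj T. \<exists>x. und T X = {x}}"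
  then obtain c where c: "und T A = {c}" by blast
  show "\<exists>!k. k \<in> und T (disc {u}) \<rightarrow>\<^sub>E und T A"
  proof (rule ex1I)
    show "(\<lambda>x\<in>{u}. c) \<in> und T (disc {u}) \<rightarrow>\<^sub>E und T A" by (simp add: c und_disc finite_small)
    fix k assume "k \<in> und T (disc {u}) \<rightarrow>\<^sub>E und T A"
    then have k: "k \<in> {u} \<rightarrow>\<^sub>E {c}" by (simp add: c und_disc finite_small)
    show "k = (\<lambda>x\<in>{u}. c)" by (rule PiE_ext[OF k]) (use k in auto)
  qed
qed auto

text \<open>The reflection keeps the points and replaces the structure by the coarse one, with the
  identity function as reflection arrow.\<close>

lemma indiscrete_epireflective: "epireflective T {X \<in> Obj T. indiscrete X}"
proof (rule epireflectiveI)
  fix X assume X: "X \<in> Obj T"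
  obtain A where A: "A \<in> Obj T" "und T A = und T X" "coarse A"
    using coarse_object[OF und_small[OF X]] by blast
  have iA: "ident T X \<in> Mor T X A"
    using A X ident_PiE[of T X] unfolding coarse_def by simp
  have "\<exists>!g. g \<in> Mor T A B \<and> compose (und T X) g (ident T X) = f"
    if "B \<in> {X \<in> Obj T. indiscrete X}" "f \<in> Mor T X B" for B f
  proof
    have B: "B \<in> Obj T" "indiscrete B" using that by auto
    have f: "f \<in> und T X \<rightarrow>\<^sub>E und T B" using mor_fun[OF X B(1) that(2)] .
    show "f \<in> Mor T A B \<and> compose (und T X) f (ident T X) = f"
      using indiscrete_mor[OF B A(1)] f A(2) compose_ident_right by simp
    fix g assume g: "g \<in> Mor T A B \<and> compose (und T X) g (ident T X) = f"
    then have "g \<in> und T X \<rightarrow>\<^sub>E und T B" using mor_fun[OF A(1) B(1)] A(2) by simp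
    then show "g = f" using compose_ident_right[of g T X] g by simp
  qed
  then have "is_reflection T {X \<in> Obj T. indiscrete X} X A (ident T X)"
    unfolding is_reflection_def using A iA indiscrete_iff_coarse by simp
  moreover have "ident T X ` und T X = und T A" using A(2) by (simp add: ident_def)
  ultimately show "\<exists>A r. is_reflection T {X \<in> Obj T. indiscrete X} X A r \<and> r ` und T X = und T A" by blast
qed auto

text \<open>A nonempty space is collapsed to one of its points. The empty space already belongs to
  the class and is its own reflection; a map from it to a point would not be surjective.\<close>

lemma subsingletons_epireflective:
  "epireflective T {X \<in> Obj T. finite (und T X) \<and> card (und T X) \<le> 1}" (is "epireflective T ?C")
proof (rule epireflectiveI)
  fix X assume X: "X \<in> Obj T"
  show "\<exists>A r. is_reflection T ?C X A r \<and> r ` und T X = und T A"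
  proof (cases "und T X = {}")
    case True
    have "\<exists>!g. g \<in> Mor T X B \<and> compose (und T X) g (ident T X) = f"
      if B: "B \<in> ?C" and f: "f \<in> Mor T X B" for B f
    proof -
      have "compose (und T X) g (ident T X) = g" if "g \<in> Mor T X B" for g
        by (rule compose_ident_right[OF mor_fun[OF X _ that]]) (use B in blast)
      then show ?thesis using f by metis
    qed
    then have "is_reflection T ?C X X (ident T X)"
      unfolding is_reflection_def using X True ident_mor[OF X] by simp
    then show ?thesis using True by (intro exI[of _ X] exI[of _ "ident T X"]) simp
  next
    case False
    then obtain x where x: "x \<in> und T X" by blast
    let ?A = "disc {x}" and ?r = "\<lambda>y\<in>und T X. x"
    have s: "{x} \<in> \<U>" by (simp add: finite_small)
    note A = disc_obj[OF s] und_disc[OF s]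
    have "?r \<in> und T X \<rightarrow>\<^sub>E und T ?A" by (simp add: A(2))
    then have r: "?r \<in> Mor T X ?A" by (rule constant_mor[OF X A(1)]) simp
    have "\<exists>!g. g \<in> Mor T ?A B \<and> compose (und T X) g ?r = f"
      if B: "B \<in> ?C" and f: "f \<in> Mor T X B" for B f
    proof (rule ex1I[of _ "\<lambda>z\<in>{x}. f x"])
      have BO: "B \<in> Obj T" and sub: "\<forall>u\<in>und T B. \<forall>v\<in>und T B. u = v"
        using B unfolding card_le_1_iff by blast+
      note fB = mor_fun[OF X BO f]
      have c: "f y = f x" if "y \<in> und T X" for y using sub fB x that by blast
      have "(\<lambda>z\<in>{x}. f x) \<in> {x} \<rightarrow>\<^sub>E und T B" using fB x by auto
      then have "(\<lambda>z\<in>{x}. f x) \<in> Mor T ?A B" by (rule disc_mor[OF s BO])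
      moreover have "compose (und T X) (\<lambda>z\<in>{x}. f x) ?r = f"
        using c fB by (auto simp: compose_def fun_eq_iff PiE_def extensional_def)
      ultimately show "(\<lambda>z\<in>{x}. f x) \<in> Mor T ?A B \<and> compose (und T X) (\<lambda>z\<in>{x}. f x) ?r = f" by blast
      fix g assume g: "g \<in> Mor T ?A B \<and> compose (und T X) g ?r = f"
      then have gB: "g \<in> {x} \<rightarrow>\<^sub>E und T B" using mor_fun[OF A(1) BO] A(2) by simp
      show "g = (\<lambda>z\<in>{x}. f x)"
        by (rule PiE_ext[OF gB]) (use gB fB x sub in auto)
    qed
    then have "is_reflection T ?C X ?A ?r"
      unfolding is_reflection_def using A r by simp
    moreover have "?r ` und T X = und T ?A" using x A(2) by auto
    ultimately show ?thesis by blast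
  qed
qed auto

lemma trivial_or_indiscrete_epireflective_algebraic:
  assumes "trivial_or_indiscrete_class T C"
  shows "epireflective T C \<and> algebraic \<U> (full_sub T C)"
  using assms subsingletons_epireflective indiscrete_epireflective subsingletons_algebraic
    indiscrete_algebraic unfolding trivial_or_indiscrete_class_def by blast


section \<open>The classification\<close>

lemma bijective_mor_iso:
  assumes C: "C \<subseteq> Obj T" and "reflects_regular_epis \<U> (full_sub T C)"
    and X: "X \<in> C" and Y: "Y \<in> C" and f: "f \<in> Mor T X Y" "bij_betw f (und T X) (und T Y)"
  shows "is_iso T X Y f"
proof -
  interpret C: concrete_category "full_sub T C" by (rule full_sub_category[OF C])
  have XY: "X \<in> Obj T" "Y \<in> Obj T" using X Y C by auto
  have "is_regular_epi (SetCat \<U>) (und T X) (und T Y) f"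
    using Set_regular_epi_iff[OF universe und_small[OF XY(1)] und_small[OF XY(2)] mor_fun[OF XY f(1)]]
      f(2) by (simp add: bij_betw_def)
  then have "is_regular_epi (full_sub T C) X Y f"
    using assms(2) X Y f(1) unfolding reflects_regular_epis_def by simp
  from C.inj_regular_epi_iso[OF _ _ this] have "is_iso (full_sub T C) X Y f"
    using X Y f(2) by (simp add: bij_betw_def)
  then show ?thesis by (simp add: is_iso_def)
qed

text \<open>The inverse prepends to \<open>y\<close> the truth value of \<open>y\<close> being zero,
  which is the only head that the domain allows for the tail \<open>y\<close>.\<close>

lemma shift_bij:
  fixes \<sigma> :: "(nat \<Rightarrow> bool) \<Rightarrow> nat \<Rightarrow> bool"
  defines "\<sigma> \<equiv> \<lambda>x n. x (Suc n)"
  shows "bij_betw \<sigma> {x. x 0 \<longleftrightarrow> \<sigma> x = (\<lambda>n. False)} UNIV"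
proof (rule bij_betw_byWitness[where f' = "\<lambda>y n. if n = 0 then y = (\<lambda>n. False) else y (n - 1)"])
  show "\<forall>x\<in>{x. x 0 \<longleftrightarrow> \<sigma> x = (\<lambda>n. False)}.
      (\<lambda>n. if n = 0 then \<sigma> x = (\<lambda>n. False) else \<sigma> x (n - 1)) = x"
    by (auto simp: \<sigma>_def fun_eq_iff)
qed (auto simp: \<sigma>_def)

text \<open>
  The shift map on binary sequences is a bijection from
  \<open>{x. x 0 \<longleftrightarrow> tail of x is zero}\<close> onto all binary sequences, and a continuous inverse would make the
  zero sequence an isolated point.
\<close>

lemma closed_algebraic_not_two_points_disc:
  assumes sub: "subcategory T C" and prod: "closed_under_products \<U> T C"
    and ext: "closed_under_extremal_subobjects T C" and alg: "algebraic \<U> (full_sub T C)"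
    and ab: "a \<noteq> b" and D: "disc {a, b} \<in> C"
  shows False
proof -
  have C: "C \<subseteq> Obj T" using sub by (simp add: subcategory_def)
  let ?D = "disc {a, b}"
  have DO: "?D \<in> Obj T" using D C by blast
  have uD: "und T ?D = {a, b}" by (simp add: und_disc finite_small)
  obtain P and \<kappa> :: "'u \<Rightarrow> nat \<Rightarrow> bool" where P: "P \<in> Obj T" and \<kappa>: "bij_betw \<kappa> (und T P) UNIV"
    and proj: "\<And>n. (\<lambda>x\<in>und T P. if \<kappa> x n then a else b) \<in> Mor T P ?D"
    and univ: "\<And>Z f. Z \<in> Obj T \<Longrightarrow> f \<in> und T Z \<rightarrow>\<^sub>E und T P \<Longrightarrow>
      (\<And>n. (\<lambda>z\<in>und T Z. if \<kappa> (f z) n then a else b) \<in> Mor T Z ?D) \<Longrightarrow> f \<in> Mor T Z P"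
    and zero: "(\<lambda>x\<in>und T P. if \<kappa> x = (\<lambda>n. False) then a else b) \<notin> Mor T P ?D"
    using cantor_object[OF ab] by blast
  define \<rho> where "\<rho> = inv_into (und T P) \<kappa>"
  have \<rho>: "\<rho> s \<in> und T P" "\<kappa> (\<rho> s) = s" for s
    using \<kappa> unfolding \<rho>_def by (auto simp: bij_betw_def inv_into_into f_inv_into_f)
  have \<kappa>_inj: "x = y" if "x \<in> und T P" "y \<in> und T P" "\<kappa> x = \<kappa> y" for x y
    using \<kappa> that by (meson bij_betw_def inj_onD)
  obtain h :: "nat \<Rightarrow> 'u" where h: "inj h" "range h \<in> \<U>" using universe_nat[OF universe] .
  let ?p = "\<lambda>i. \<lambda>x\<in>und T P. if \<kappa> x (inv h i) then a else b"
  have "is_product T (range h) (\<lambda>i. ?D) P ?p"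
    unfolding is_product_def
  proof (intro conjI ballI allI impI)
    fix Q q assume Q: "Q \<in> Obj T" and q: "\<forall>i\<in>range h. q i \<in> Mor T Q ?D"
    have qu: "q (h n) \<in> und T Q \<rightarrow>\<^sub>E {a, b}" for n using mor_fun[OF Q DO] q uD by auto
    \<comment> \<open>The point with prescribed coordinates: bit \<open>n\<close> records whether
      the component \<open>q (h n)\<close> takes the value \<open>a\<close>.\<close>
    let ?f = "\<lambda>z\<in>und T Q. \<rho> (\<lambda>n. q (h n) z = a)"
    have f: "?f \<in> und T Q \<rightarrow>\<^sub>E und T P" using \<rho>(1) by auto
    have coord: "(\<lambda>z\<in>und T Q. if \<kappa> (?f z) n then a else b) = q (h n)" for n
    proof (rule PiE_ext[OF _ qu])
      show "(\<lambda>z\<in>und T Q. if \<kappa> (?f z) n then a else b) \<in> und T Q \<rightarrow>\<^sub>E {a, b}" by auto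
      fix z assume "z \<in> und T Q"
      then show "(\<lambda>z\<in>und T Q. if \<kappa> (?f z) n then a else b) z = q (h n) z"
        using qu[of n] \<rho>(2) by auto
    qed
    show "\<exists>!g. g \<in> Mor T Q P \<and> (\<forall>i\<in>range h. compose (und T Q) (?p i) g = q i)"
    proof (rule ex1I[of _ ?f])
      have "?f \<in> Mor T Q P" by (rule univ[OF Q f]) (use coord q in simp)
      moreover have "compose (und T Q) (?p (h n)) ?f = q (h n)" for n
        unfolding coord[of n, symmetric] using \<rho>(1) h(1) by (simp add: compose_def fun_eq_iff)
      ultimately show "?f \<in> Mor T Q P \<and> (\<forall>i\<in>range h. compose (und T Q) (?p i) ?f = q i)" by blast
      fix g assume g: "g \<in> Mor T Q P \<and> (\<forall>i\<in>range h. compose (und T Q) (?p i) g = q i)"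
      note gP = mor_fun[OF Q P conjunct1[OF g]]
      show "g = ?f"
      proof (rule PiE_ext[OF gP f])
        fix z assume z: "z \<in> und T Q"
        have gz: "g z \<in> und T P" using gP z by blast
        have "\<kappa> (g z) n = (q (h n) z = a)" for n
        proof -
          have "compose (und T Q) (?p (h n)) g z = q (h n) z" using g by (metis rangeI)
          then show ?thesis using z gz h(1) ab by (auto simp: compose_def split: if_splits)
        qed
        then have "\<kappa> (g z) = \<kappa> (?f z)" using \<rho>(2) z by auto
        then show "g z = ?f z" using \<kappa>_inj gz f z by blast
      qed
    qed
  qed (use P proj in auto)
  then have PC: "P \<in> C" using prod h(2) D unfolding closed_under_products_def by blast
  define \<sigma> :: "(nat \<Rightarrow> bool) \<Rightarrow> nat \<Rightarrow> bool" where "\<sigma> = (\<lambda>x n. x (Suc n))"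
  \<comment> \<open>The domain of \<open>shift_bij\<close>, transported to the points of
    \<open>P\<close>; the map \<open>f\<close> below is the shift on it.\<close>
  define S where "S = {x \<in> und T P. \<kappa> x 0 \<longleftrightarrow> \<sigma> (\<kappa> x) = (\<lambda>n. False)}"
  have SP: "S \<subseteq> und T P" by (auto simp: S_def)
  have SU: "S \<in> \<U>" using universe_subset[OF universe und_small[OF P] SP] .
  have "(\<lambda>x\<in>S. x) \<in> S \<rightarrow>\<^sub>E und T P" "inj_on (\<lambda>x\<in>S. x) S" using SP by (auto simp: inj_on_def)
  then obtain L where L: "L \<in> Obj T" "und T L = S" "embedding L P (\<lambda>x\<in>S. x)"
    using subspace[OF P _ _ SU] by blast
  have LC: "L \<in> C"
    using ext PC L(1) embedding_extremal_mono[OF L(1) P L(3)]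
    unfolding closed_under_extremal_subobjects_def by blast
  have incl: "(\<lambda>x\<in>S. x) \<in> Mor T L P" using L(3) by (simp add: embedding_def)
  define f where "f = (\<lambda>x\<in>S. \<rho> (\<sigma> (\<kappa> x)))"
  have f: "f \<in> und T L \<rightarrow>\<^sub>E und T P" using \<rho>(1) by (auto simp: f_def L(2))
  have coordL: "(\<lambda>x\<in>S. if \<kappa> x n then a else b) \<in> Mor T L ?D" for n
  proof -
    have "compose (und T L) (\<lambda>x\<in>und T P. if \<kappa> x n then a else b) (\<lambda>x\<in>S. x) \<in> Mor T L ?D"
      by (rule comp_mor[OF L(1) P DO incl proj])
    also have "compose (und T L) (\<lambda>x\<in>und T P. if \<kappa> x n then a else b) (\<lambda>x\<in>S. x)
        = (\<lambda>x\<in>S. if \<kappa> x n then a else b)"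
      using SP by (auto simp: compose_def L(2) fun_eq_iff)
    finally show ?thesis .
  qed
  have fm: "f \<in> Mor T L P"
  proof (rule univ[OF L(1) f])
    fix n
    \<comment> \<open>Coordinate \<open>n\<close> of the shifted sequence is coordinate
      \<open>Suc n\<close> of the original one, so the shift is a morphism by the product
      property.\<close>
    have "(\<lambda>z\<in>und T L. if \<kappa> (f z) n then a else b) = (\<lambda>x\<in>S. if \<kappa> x (Suc n) then a else b)"
      by (auto simp: L(2) f_def \<rho>(2) \<sigma>_def fun_eq_iff)
    then show "(\<lambda>z\<in>und T L. if \<kappa> (f z) n then a else b) \<in> Mor T L ?D" using coordL by simp
  qed
  have "bij_betw \<kappa> S {x. x 0 \<longleftrightarrow> \<sigma> x = (\<lambda>n. False)}"
  proof (rule bij_betw_subset[OF \<kappa> SP], intro equalityI subsetI)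
    fix s assume "s \<in> {x. x 0 \<longleftrightarrow> \<sigma> x = (\<lambda>n. False)}"
    then have "\<rho> s \<in> S" using \<rho>[of s] by (simp add: S_def)
    then show "s \<in> \<kappa> ` S" using \<rho>(2)[of s] by force
  qed (auto simp: S_def)
  then have "bij_betw (\<sigma> \<circ> \<kappa>) S UNIV"
    using shift_bij unfolding \<sigma>_def by (rule bij_betw_trans)
  moreover have "bij_betw \<rho> UNIV (und T P)"
    unfolding \<rho>_def by (rule bij_betw_inv_into[OF \<kappa>])
  ultimately have "bij_betw (\<rho> \<circ> (\<sigma> \<circ> \<kappa>)) S (und T P)" by (rule bij_betw_trans)
  then have "bij_betw f (und T L) (und T P)"
    unfolding L(2) by (rule bij_betw_cong[THEN iffD1, rotated]) (simp add: f_def)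
  from bijective_mor_iso[OF C _ LC PC fm this] have "is_iso T L P f"
    using alg unfolding algebraic_def by blast
  then obtain g where g: "g \<in> Mor T P L" "compose (und T P) f g = ident T P"
    unfolding is_iso_def by blast
  \<comment> \<open>The head of \<open>g x\<close> says whether its tail \<open>x\<close> is zero.
    So the inverse \<open>g\<close> followed by coordinate \<open>0\<close> is the indicator of the
    zero sequence, which \<open>zero\<close> excludes.\<close>
  have "compose (und T P) (\<lambda>x\<in>S. if \<kappa> x 0 then a else b) g \<in> Mor T P ?D"
    by (rule comp_mor[OF P L(1) DO g(1) coordL])
  also have "compose (und T P) (\<lambda>x\<in>S. if \<kappa> x 0 then a else b) g
    = (\<lambda>x\<in>und T P. if \<kappa> x = (\<lambda>n. False) then a else b)"
  proof
    fix x show "compose (und T P) (\<lambda>x\<in>S. if \<kappa> x 0 then a else b) g x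
        = (\<lambda>x\<in>und T P. if \<kappa> x = (\<lambda>n. False) then a else b) x"
    proof (cases "x \<in> und T P")
      case True
      then have gS: "g x \<in> S" using mor_apply[OF P L(1) g(1)] L(2) by blast
      have "f (g x) = x" using fun_cong[OF g(2), of x] True by (simp add: compose_def ident_def)
      then have "\<rho> (\<sigma> (\<kappa> (g x))) = x" using gS by (simp add: f_def)
      then have "\<sigma> (\<kappa> (g x)) = \<kappa> x" using \<rho>(2) by metis
      then show ?thesis using gS True by (auto simp: compose_def S_def)
    qed (simp add: compose_def)
  qed
  finally show False using zero by contradiction
qed

lemma closed_algebraic_trivial_or_indiscrete:
  assumes sub: "subcategory T C" and prod: "closed_under_products \<U> T C"
    and ext: "closed_under_extremal_subobjects T C" and alg: "algebraic \<U> (full_sub T C)"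
  shows "trivial_or_indiscrete_class T C"
proof -
  have C: "C \<subseteq> Obj T" using sub by (simp add: subcategory_def)
  interpret C: concrete_category "full_sub T C" by (rule full_sub_category[OF C])
  have extC: "X \<in> C" if "Y \<in> C" "X \<in> Obj T" "embedding X Y m" for X Y m
    using ext that embedding_extremal_mono[OF that(2) _ that(3)] C
    unfolding closed_under_extremal_subobjects_def by blast
  \<comment> \<open>The unit of a free object is injective once some member of \<open>C\<close> has
    two points \<open>x\<close> and \<open>y\<close>: the map sending \<open>s\<close> to
    \<open>x\<close> and all other generators to \<open>y\<close> factors through it.\<close>
  have unit: "\<exists>F\<in>C. \<exists>\<eta>\<in>S \<rightarrow>\<^sub>E und T F. inj_on \<eta> S \<and>
      (\<forall>h\<in>S \<rightarrow>\<^sub>E und T X. \<exists>k\<in>Mor T F X. compose S k \<eta> = h)"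
    if S: "S \<in> \<U>" and X: "X \<in> C" and xy: "x \<in> und T X" "y \<in> und T X" "x \<noteq> y" for S X x y
  proof -
    have "has_left_adjoint \<U> (full_sub T C)" using alg by (simp add: algebraic_def)
    note unit = C.left_adjoint_unit[OF this S, unfolded full_sub_simps]
    obtain F \<eta> where F: "F \<in> C" "\<eta> \<in> S \<rightarrow>\<^sub>E und T F"
      and univ: "\<And>A h. A \<in> C \<Longrightarrow> h \<in> S \<rightarrow>\<^sub>E und T A \<Longrightarrow> \<exists>k\<in>Mor T F A. compose S k \<eta> = h"
      by (rule unit) (blast intro: that)
    have "inj_on \<eta> S"
    proof (rule inj_onI)
      fix s t assume st: "s \<in> S" "t \<in> S" "\<eta> s = \<eta> t"
      have "(\<lambda>r\<in>S. if r = s then x else y) \<in> S \<rightarrow>\<^sub>E und T X" using xy by auto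
      then obtain k where "compose S k \<eta> = (\<lambda>r\<in>S. if r = s then x else y)" using univ[OF X] by blast
      from fun_cong[OF this, of s] fun_cong[OF this, of t] show "s = t"
        using st xy by (auto simp: compose_def split: if_splits)
    qed
    then show ?thesis using F univ[OF X] by blast
  qed
  show ?thesis
  proof (cases "\<exists>X\<in>C. \<not> indiscrete X")
    case True
    then obtain X where X: "X \<in> C" "\<not> indiscrete X" by blast
    then have XO: "X \<in> Obj T" using C by blast
    then have "\<not> coarse X" using X indiscrete_iff_coarse by blast
    then obtain x y where xy: "x \<in> und T X" "y \<in> und T X" "x \<noteq> y"
      using subsingleton_coarse[OF XO] by blast
    have s: "{x, y} \<in> \<U>" by (simp add: finite_small)
    obtain F \<eta> where F: "F \<in> C" "\<eta> \<in> {x, y} \<rightarrow>\<^sub>E und T F" "inj_on \<eta> {x, y}"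
      and univ: "\<forall>h\<in>{x, y} \<rightarrow>\<^sub>E und T X. \<exists>k\<in>Mor T F X. compose {x, y} k \<eta> = h"
      using unit[OF s X(1) xy] by (elim bexE conjE)
    have FO: "F \<in> Obj T" using F C by blast
    obtain Y where Y: "Y \<in> Obj T" "und T Y = {x, y}" "embedding Y F \<eta>"
      using subspace[OF FO F(2,3) s] .
    have \<eta>: "\<eta> \<in> Mor T Y F" using Y(3) by (simp add: embedding_def)
    have i: "ident T Y \<in> Mor T Y (disc {x, y})"
    proof (rule two_points_discrete[OF XO X(2) Y(1) xy(3) Y(2)])
      fix f assume "f \<in> und T Y \<rightarrow>\<^sub>E und T X"
      then obtain k where "k \<in> Mor T F X" "compose {x, y} k \<eta> = f" using univ Y(2) by auto
      then show "f \<in> Mor T Y X" using comp_mor[OF Y(1) FO XO \<eta>] Y(2) by auto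
    qed
    have D: "disc {x, y} \<in> Obj T" "und T (disc {x, y}) = {x, y}" using disc_obj und_disc s by auto
    have idI: "ident T (disc {x, y}) = ident T Y" by (simp add: ident_def D(2) Y(2))
    have j: "ident T Y \<in> Mor T (disc {x, y}) Y"
      using disc_mor[OF s Y(1), of "ident T Y"] ident_PiE[of T Y] Y(2) by simp
    have "compose (und T Y) (ident T Y) (ident T Y) = ident T Y"
      by (rule compose_ident_left[OF ident_PiE])
    then have "is_iso T Y (disc {x, y}) (ident T Y)"
      unfolding is_iso_def using i j idI Y(2) D(2) by auto
    then have "disc {x, y} \<in> C"
      using subcategory_iso_closed[OF sub extC[OF F(1) Y(1,3)]] D(1) by blast
    then show ?thesis
      using closed_algebraic_not_two_points_disc[OF assms xy(3)] by blast
  next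
    case ind: False
    show ?thesis
    proof (cases "\<exists>X\<in>C. \<exists>x\<in>und T X. \<exists>y\<in>und T X. x \<noteq> y")
      case True
      then obtain X x y where X: "X \<in> C" "x \<in> und T X" "y \<in> und T X" "x \<noteq> y" by blast
      have "Y \<in> C" if Y: "Y \<in> Obj T" "indiscrete Y" for Y
      proof -
        obtain F \<eta> where F: "F \<in> C" "\<eta> \<in> und T Y \<rightarrow>\<^sub>E und T F" "inj_on \<eta> (und T Y)"
          using unit[OF und_small[OF Y(1)] X] by blast
        have FO: "F \<in> Obj T" using F(1) C by blast
        \<comment> \<open>Both spaces are indiscrete here, so every function into them is a morphism
          and an injection between them is an embedding.\<close>
        have "embedding Y F \<eta>"
          unfolding embedding_def
          using F ind indiscrete_mor[OF Y] indiscrete_mor[OF FO _ Y(1) F(2)] by blast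
        then show ?thesis using extC F(1) Y(1) by blast
      qed
      then have "C = {X \<in> Obj T. indiscrete X}" using C ind by blast
      then show ?thesis unfolding trivial_or_indiscrete_class_def by blast
    next
      case False
      fix u :: 'u
      have s: "{u} \<in> \<U>" by (simp add: finite_small)
      note D = disc_obj[OF s] und_disc[OF s]
      have coarse_D: "coarse (disc {u})" by (rule subsingleton_coarse) (simp_all add: D)
      \<comment> \<open>The one-point space is the empty product. This puts it into \<open>C\<close>
        even though \<open>C\<close> might have been empty so far; all spaces with at most one point
        then follow as its subspaces.\<close>
      have "is_product T {} (\<lambda>i. disc {u}) (disc {u}) (\<lambda>i. undefined)"
        unfolding is_product_def
      proof (intro conjI ballI allI impI)
        fix Q q assume Q: "Q \<in> Obj T"
        have "(\<lambda>x\<in>und T Q. u) \<in> und T Q \<rightarrow>\<^sub>E und T (disc {u})" by (simp add: D)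
        moreover have "g = (\<lambda>x\<in>und T Q. u)" if "g \<in> Mor T Q (disc {u})" for g
          using mor_fun[OF Q D(1) that] D(2) by (intro PiE_ext[of g "und T Q" "\<lambda>_. {u}"]) auto
        ultimately show "\<exists>!h. h \<in> Mor T Q (disc {u}) \<and> (\<forall>i\<in>{}. compose (und T Q) undefined h = q i)"
          using coarse_D Q unfolding coarse_def by blast
      qed (use D in auto)
      moreover have "{} \<in> \<U>" by (simp add: finite_small)
      ultimately have DC: "disc {u} \<in> C"
        using prod unfolding closed_under_products_def by blast
      have "X \<in> C" if X: "X \<in> Obj T" "\<forall>x\<in>und T X. \<forall>y\<in>und T X. x = y" for X
      proof -
        have "(\<lambda>x\<in>und T X. u) \<in> und T X \<rightarrow>\<^sub>E und T (disc {u})" by (simp add: D)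
        then have "(\<lambda>x\<in>und T X. u) \<in> Mor T X (disc {u})" using coarse_D X(1) unfolding coarse_def by blast
        moreover have "inj_on (\<lambda>x\<in>und T X. u) (und T X)" using X(2) by (auto simp: inj_on_def)
        ultimately have "embedding X (disc {u}) (\<lambda>x\<in>und T X. u)"
          using subsingleton_coarse[OF X] unfolding embedding_def coarse_def by blast
        then show ?thesis using extC DC X(1) by blast
      qed
      then have "C = {X \<in> Obj T. finite (und T X) \<and> card (und T X) \<le> 1}"
        unfolding card_le_1_iff using C False by blast
      then show ?thesis unfolding trivial_or_indiscrete_class_def by blast
    qed
  qed
qed


section \<open>Independence of the three properties\<close>

text \<open>A discrete space with two points belongs to neither class of the classification. This
  serves for the class of discrete spaces as well as for the class of all spaces.\<close>

lemma not_trivial_or_indiscrete: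
  assumes "\<And>a b. disc {a, b} \<in> C"
  shows "\<not> trivial_or_indiscrete_class T C"
proof
  assume t: "trivial_or_indiscrete_class T C"
  obtain p q :: 'u where pq: "p \<noteq> q" using universe_two_points[OF universe] .
  have s: "{p, q} \<in> \<U>" by (simp add: finite_small)
  have "\<not> indiscrete (disc {p, q})"
    using two_points_not_coarse[OF pq] indiscrete_iff_coarse[OF disc_obj[OF s]] by blast
  moreover have "\<not> (\<forall>x\<in>und T (disc {p, q}). \<forall>y\<in>und T (disc {p, q}). x = y)"
    using pq by (simp add: und_disc s)
  ultimately show False
    using t assms[of p q] unfolding trivial_or_indiscrete_class_def card_le_1_iff by blast
qed

lemma fine_closed_under_extremal_subobjects:
  "closed_under_extremal_subobjects T {X \<in> Obj T. fine X}"
  unfolding closed_under_extremal_subobjects_def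
proof (intro ballI allI impI)
  fix Y X m assume Y: "Y \<in> {X \<in> Obj T. fine X}" and X: "X \<in> Obj T" and m: "is_extremal_mono T X Y m"
  have mm: "m \<in> Mor T X Y" using m by (simp add: is_extremal_mono_def is_mono_def)
  have YO: "Y \<in> Obj T" and fY: "fine Y" using Y by auto
  have mf: "m \<in> und T X \<rightarrow>\<^sub>E und T Y" using mor_fun[OF X YO mm] .
  let ?S = "m ` und T X"
  have s: "?S \<in> \<U>" by (rule universe_subset[OF universe und_small[OF YO]]) (use mf in auto)
  note D = disc_obj[OF s] und_disc[OF s]
  \<comment> \<open>A retraction of \<open>Y\<close> onto the image is a morphism because \<open>Y\<close> is discrete; so \<open>m\<close> factors through
    an epimorphism onto the discrete space on its image.\<close>
  show "X \<in> {X \<in> Obj T. fine X}"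
  proof (cases "?S = {}")
    \<comment> \<open>A nonempty \<open>Y\<close> has no retraction onto an empty image. In this
      case \<open>X\<close> is empty, and its maps are morphisms because they are constant.\<close>
    case True
    then have "\<And>Z f. Z \<in> Obj T \<Longrightarrow> f \<in> und T X \<rightarrow>\<^sub>E und T Z \<Longrightarrow> f \<in> Mor T X Z"
      using constant_mor[OF X] by auto
    then show ?thesis using X unfolding fine_def by blast
  next
    case False
    then obtain c where c: "c \<in> ?S" by blast
    let ?r = "\<lambda>y\<in>und T Y. if y \<in> ?S then y else c"
    have "?r \<in> und T Y \<rightarrow>\<^sub>E und T (disc ?S)" using c D(2) by auto
    then have r: "?r \<in> Mor T Y (disc ?S)" using fY D(1) unfolding fine_def by blast
    let ?e = "compose (und T X) ?r m"
    have e: "?e \<in> Mor T X (disc ?S)" by (rule comp_mor[OF X YO D(1) mm r])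
    have ex: "?e x = m x" if "x \<in> und T X" for x using that mf by (auto simp: compose_def)
    have "is_epi T X (disc ?S) ?e"
      by (rule surj_epi[OF X D(1) e]) (simp add: D(2) ex)
    moreover have "(\<lambda>y\<in>?S. y) \<in> Mor T (disc ?S) Y"
      by (rule disc_mor[OF s YO]) (use mf in auto)
    moreover have "m = compose (und T X) (\<lambda>y\<in>?S. y) ?e"
      using mf ex by (auto simp: compose_def fun_eq_iff PiE_def extensional_def)
    ultimately have "is_iso T X (disc ?S) ?e"
      using m D(1) unfolding is_extremal_mono_def by blast
    then obtain k where "is_iso T (disc ?S) X k" using iso_inverse by blast
    then show ?thesis using iso_to_fine[OF D(1) X] fine_disc[OF s] X by blast
  qed
qed

text \<open>The product \<open>P\<close> is known only through its universal property. Its points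
  are the morphisms from the one-point space \<open>disc {u}\<close> to \<open>P\<close>, and these
  correspond to families of morphisms into the one-point factors, of which there is exactly
  one.\<close>

lemma singletons_closed_under_products:
  "closed_under_products \<U> T {X \<in> Obj T. \<exists>x. und T X = {x}}"
  unfolding closed_under_products_def
proof (intro ballI allI impI)
  fix I X P p assume X: "X \<in> I \<rightarrow> {X \<in> Obj T. \<exists>x. und T X = {x}}" and P: "is_product T I X P p"
  fix u :: 'u
  have s: "{u} \<in> \<U>" by (simp add: finite_small)
  note D = disc_obj[OF s] und_disc[OF s]
  have PO: "P \<in> Obj T" and p: "\<And>i. i \<in> I \<Longrightarrow> p i \<in> Mor T P (X i)" using P by (auto simp: is_product_def)
  have XI: "X i \<in> Obj T" "\<exists>x. und T (X i) = {x}" if "i \<in> I" for i using X that by auto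
  obtain c where c: "\<And>i. i \<in> I \<Longrightarrow> und T (X i) = {c i}" using XI(2) by metis
  let ?q = "\<lambda>i. \<lambda>x\<in>{u}. c i"
  have q: "?q i \<in> Mor T (disc {u}) (X i)" if "i \<in> I" for i
    by (rule disc_mor[OF s XI(1)[OF that]]) (simp add: c[OF that])
  have "\<exists>!h. h \<in> Mor T (disc {u}) P \<and> (\<forall>i\<in>I. compose (und T (disc {u})) (p i) h = ?q i)"
    using P[unfolded is_product_def, THEN conjunct2, THEN conjunct2, rule_format, OF D(1), of ?q] q
    by simp
  then have uni: "\<And>h h'. h \<in> Mor T (disc {u}) P \<Longrightarrow> h' \<in> Mor T (disc {u}) P \<Longrightarrow>
      \<forall>i\<in>I. compose {u} (p i) h = ?q i \<Longrightarrow> \<forall>i\<in>I. compose {u} (p i) h' = ?q i \<Longrightarrow> h = h'"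
    and ex: "\<exists>h. h \<in> Mor T (disc {u}) P" unfolding D(2) by blast+
  then obtain h where "h \<in> Mor T (disc {u}) P" by blast
  then have "h u \<in> und T P" using mor_apply[OF D(1) PO] D(2) by blast
  moreover have "x = y" if "x \<in> und T P" "y \<in> und T P" for x y
  proof -
    have m: "(\<lambda>z\<in>{u}. w) \<in> Mor T (disc {u}) P" if "w \<in> und T P" for w
      by (rule disc_mor[OF s PO]) (use that in auto)
    have comp: "\<forall>i\<in>I. compose {u} (p i) (\<lambda>z\<in>{u}. w) = ?q i" if w: "w \<in> und T P" for w
    proof
      fix i assume i: "i \<in> I"
      have "p i w = c i" using mor_apply[OF PO XI(1)[OF i] p[OF i] w] c[OF i] by simp
      then show "compose {u} (p i) (\<lambda>z\<in>{u}. w) = ?q i" by (auto simp: compose_def fun_eq_iff)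
    qed
    have "(\<lambda>z\<in>{u}. x) = (\<lambda>z\<in>{u}. y)" using uni m comp that by blast
    from fun_cong[OF this, of u] show ?thesis by simp
  qed
  ultimately show "P \<in> {X \<in> Obj T. \<exists>x. und T X = {x}}" using PO by blast
qed

lemma subcategory_singletons: "subcategory T {X \<in> Obj T. \<exists>x. und T X = {x}}"
  unfolding subcategory_def
proof (intro conjI ballI impI)
  fix X Y assume X: "X \<in> {X \<in> Obj T. \<exists>x. und T X = {x}}" and Y: "Y \<in> Obj T" and "\<exists>f. is_iso T X Y f"
  then obtain f x where f: "is_iso T X Y f" and x: "und T X = {x}" using X by blast
  then have "bij_betw f {x} (und T Y)" using X Y iso_bij by fastforce
  then have "und T Y = {f x}" by (auto simp: bij_betw_def)
  then show "Y \<in> {X \<in> Obj T. \<exists>x. und T X = {x}}" 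
    using X Y unfolding bij_betw_def by blast
qed auto

text \<open>The empty space decides: it has at most one point and is indiscrete, so both classes of
  the classification contain it.\<close>

lemma singletons_not_trivial_or_indiscrete:
  "\<not> trivial_or_indiscrete_class T {X \<in> Obj T. \<exists>x. und T X = {x}}"
proof -
  have s: "{} \<in> \<U>" by (simp add: finite_small)
  have "coarse (disc {})" by (rule subsingleton_coarse) (simp_all add: disc_obj und_disc s)
  then have "indiscrete (disc {})" using indiscrete_iff_coarse[OF disc_obj[OF s]] by blast
  moreover have "finite (und T (disc {})) \<and> card (und T (disc {})) \<le> 1" by (simp add: und_disc s)
  moreover have "disc {} \<notin> {X \<in> Obj T. \<exists>x. und T X = {x}}" by (simp add: und_disc s)
  ultimately show ?thesis
    unfolding trivial_or_indiscrete_class_def using disc_obj[OF s] by blast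
qed

theorem classification:
  assumes C: "subcategory T C"
  shows "(epireflective T C \<and> algebraic \<U> (full_sub T C) \<longleftrightarrow> trivial_or_indiscrete_class T C) \<and>
    (epireflective T C \<and> algebraic \<U> (full_sub T C) \<longleftrightarrow>
       closed_under_products \<U> T C \<and> closed_under_extremal_subobjects T C \<and>
       algebraic \<U> (full_sub T C)) \<and>
    (\<exists>D. subcategory T D \<and> closed_under_extremal_subobjects T D \<and>
       algebraic \<U> (full_sub T D) \<and> \<not> trivial_or_indiscrete_class T D) \<and>
    (\<exists>D. subcategory T D \<and> closed_under_products \<U> T D \<and>
       algebraic \<U> (full_sub T D) \<and> \<not> trivial_or_indiscrete_class T D) \<and>
    (\<exists>D. subcategory T D \<and> closed_under_products \<U> T D \<and>
       closed_under_extremal_subobjects T D \<and> \<not> trivial_or_indiscrete_class T D)"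
    (is "?main \<and> ?closed \<and> ?no_prod \<and> ?no_ext \<and> ?no_alg")
proof -
  have 1: ?closed ?main
    using epireflective_closed_under_products[OF C]
      epireflective_closed_under_extremal_subobjects[OF C]
      closed_algebraic_trivial_or_indiscrete[OF C] trivial_or_indiscrete_epireflective_algebraic
    by blast+
  have "\<not> trivial_or_indiscrete_class T {X \<in> Obj T. fine X}"
    by (rule not_trivial_or_indiscrete) (simp add: disc_obj fine_disc finite_small)
  then have 2: ?no_prod
    using subcategory_fine fine_closed_under_extremal_subobjects fine_algebraic by blast
  have 3: ?no_ext
    using subcategory_singletons singletons_closed_under_products singletons_algebraic
      singletons_not_trivial_or_indiscrete by blast
  have "\<not> trivial_or_indiscrete_class T (Obj T)"
    by (rule not_trivial_or_indiscrete) (simp add: disc_obj finite_small)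
  moreover have "subcategory T (Obj T)" "closed_under_products \<U> T (Obj T)"
    "closed_under_extremal_subobjects T (Obj T)"
    by (auto simp: subcategory_def closed_under_products_def is_product_def
        closed_under_extremal_subobjects_def)
  ultimately have 4: ?no_alg by blast
  show ?thesis using 1 2 3 4 by blast
qed

end


section \<open>Topological spaces\<close>

lemma TopCat_simps [simp]:
  "Obj (TopCat \<U>) = {TopSpace X | X. topspace X \<in> \<U>}" "und (TopCat \<U>) = pts" "Mor (TopCat \<U>) = space_maps"
  by (simp_all add: TopCat_def)

text \<open>The product topology on binary sequences, pulled back along \<open>\<kappa>\<close>: the
  points that share the first \<open>n\<close> terms with \<open>x\<close> form a basic
  neighbourhood of \<open>x\<close>.\<close>

definition cantor_topology :: "'u set \<Rightarrow> ('u \<Rightarrow> nat \<Rightarrow> bool) \<Rightarrow> 'u topology" where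
  "cantor_topology B \<kappa> =
    topology (\<lambda>V. V \<subseteq> B \<and> (\<forall>x\<in>V. \<exists>n. \<forall>y\<in>B. (\<forall>i<n. \<kappa> y i = \<kappa> x i) \<longrightarrow> y \<in> V))"

lemma openin_cantor_topology:
  "openin (cantor_topology B \<kappa>) V \<longleftrightarrow>
    V \<subseteq> B \<and> (\<forall>x\<in>V. \<exists>n. \<forall>y\<in>B. (\<forall>i<n. \<kappa> y i = \<kappa> x i) \<longrightarrow> y \<in> V)"
proof -
  have "istopology (\<lambda>V. V \<subseteq> B \<and> (\<forall>x\<in>V. \<exists>n. \<forall>y\<in>B. (\<forall>i<n. \<kappa> y i = \<kappa> x i) \<longrightarrow> y \<in> V))"
    unfolding istopology_def
  proof (intro conjI allI impI)
    fix V W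
    assume V: "V \<subseteq> B \<and> (\<forall>x\<in>V. \<exists>n. \<forall>y\<in>B. (\<forall>i<n. \<kappa> y i = \<kappa> x i) \<longrightarrow> y \<in> V)"
      and W: "W \<subseteq> B \<and> (\<forall>x\<in>W. \<exists>n. \<forall>y\<in>B. (\<forall>i<n. \<kappa> y i = \<kappa> x i) \<longrightarrow> y \<in> W)"
    show "V \<inter> W \<subseteq> B" using V by blast
    show "\<forall>x\<in>V \<inter> W. \<exists>n. \<forall>y\<in>B. (\<forall>i<n. \<kappa> y i = \<kappa> x i) \<longrightarrow> y \<in> V \<inter> W"
    proof
      fix x assume "x \<in> V \<inter> W"
      then obtain m n where "\<forall>y\<in>B. (\<forall>i<m. \<kappa> y i = \<kappa> x i) \<longrightarrow> y \<in> V"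
        "\<forall>y\<in>B. (\<forall>i<n. \<kappa> y i = \<kappa> x i) \<longrightarrow> y \<in> W" using V W by blast
      then have "\<forall>y\<in>B. (\<forall>i<max m n. \<kappa> y i = \<kappa> x i) \<longrightarrow> y \<in> V \<inter> W" by simp
      then show "\<exists>n. \<forall>y\<in>B. (\<forall>i<n. \<kappa> y i = \<kappa> x i) \<longrightarrow> y \<in> V \<inter> W" by blast
    qed
  next
    fix K assume K: "\<forall>V\<in>K. V \<subseteq> B \<and> (\<forall>x\<in>V. \<exists>n. \<forall>y\<in>B. (\<forall>i<n. \<kappa> y i = \<kappa> x i) \<longrightarrow> y \<in> V)"
    then show "\<Union> K \<subseteq> B" by blast
    show "\<forall>x\<in>\<Union> K. \<exists>n. \<forall>y\<in>B. (\<forall>i<n. \<kappa> y i = \<kappa> x i) \<longrightarrow> y \<in> \<Union> K"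
    proof
      fix x assume "x \<in> \<Union> K"
      then obtain V where "V \<in> K" "x \<in> V" by blast
      moreover from this obtain n where "\<forall>y\<in>B. (\<forall>i<n. \<kappa> y i = \<kappa> x i) \<longrightarrow> y \<in> V" using K by blast
      ultimately show "\<exists>n. \<forall>y\<in>B. (\<forall>i<n. \<kappa> y i = \<kappa> x i) \<longrightarrow> y \<in> \<Union> K" by blast
    qed
  qed
  then show ?thesis unfolding cantor_topology_def by (simp add: topology_inverse')
qed

lemma topspace_cantor_topology: "topspace (cantor_topology B \<kappa>) = B"
proof -
  have "openin (cantor_topology B \<kappa>) B" by (simp add: openin_cantor_topology)
  then have "B \<subseteq> topspace (cantor_topology B \<kappa>)" by (rule openin_subset)
  moreover have "topspace (cantor_topology B \<kappa>) \<subseteq> B"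
    using openin_topspace[of "cantor_topology B \<kappa>"] unfolding openin_cantor_topology by (rule conjunct1)
  ultimately show ?thesis by (rule subset_antisym[rotated])
qed

text \<open>A basic neighbourhood constrains finitely many coordinates, so its preimage is a finite
  intersection of the open sets in \<open>coord\<close>.\<close>

lemma continuous_map_cantor_topology:
  assumes f: "f \<in> topspace X \<rightarrow> B"
    and coord: "\<And>n. openin X {x \<in> topspace X. \<kappa> (f x) n}" "\<And>n. openin X {x \<in> topspace X. \<not> \<kappa> (f x) n}"
  shows "continuous_map X (cantor_topology B \<kappa>) f"
  unfolding continuous_map_def topspace_cantor_topology
proof (intro conjI allI impI)
  show "f \<in> topspace X \<rightarrow> B" by (fact f)
  have nbhd: "openin X {x \<in> topspace X. \<forall>i<n. \<kappa> (f x) i = s i}" for n :: nat and s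
  proof (induction n)
    case (Suc n)
    have "openin X {x \<in> topspace X. \<kappa> (f x) n = s n}" using coord[of n] by (cases "s n") simp_all
    with Suc have "openin X ({x \<in> topspace X. \<forall>i<n. \<kappa> (f x) i = s i} \<inter> {x \<in> topspace X. \<kappa> (f x) n = s n})"
      by (rule openin_Int)
    also have "\<dots> = {x \<in> topspace X. \<forall>i<Suc n. \<kappa> (f x) i = s i}" by (auto simp: less_Suc_eq)
    finally show ?case .
  qed simp
  fix V assume V: "openin (cantor_topology B \<kappa>) V"
  show "openin X {x \<in> topspace X. f x \<in> V}"
  proof (subst openin_subopen, intro ballI)
    fix x assume x: "x \<in> {x \<in> topspace X. f x \<in> V}"
    then obtain n where n: "\<forall>y\<in>B. (\<forall>i<n. \<kappa> y i = \<kappa> (f x) i) \<longrightarrow> y \<in> V"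
      using V unfolding openin_cantor_topology by blast
    show "\<exists>W. openin X W \<and> x \<in> W \<and> W \<subseteq> {x \<in> topspace X. f x \<in> V}"
      using nbhd[of n "\<kappa> (f x)"] n x f
      by (intro exI[of _ "{z \<in> topspace X. \<forall>i<n. \<kappa> (f z) i = \<kappa> (f x) i}"]) auto
  qed
qed

text \<open>The map sending \<open>p\<close> into \<open>V\<close> and \<open>q\<close> outside
  pulls \<open>V\<close> back to \<open>{p}\<close>. Used a second time with the points exchanged,
  this makes \<open>Y\<close> discrete; a single such map would still allow the Sierpinski
  space.\<close>

lemma two_point_continuous_maps:
  assumes X: "openin X V" "x \<in> V" "y \<in> topspace X" "y \<notin> V"
    and Y: "topspace Y = {p, q}" "p \<noteq> q"
    and all: "\<And>f. f \<in> {p, q} \<rightarrow>\<^sub>E topspace X \<Longrightarrow> continuous_map Y X f"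
  shows "openin Y {p}"
proof -
  let ?f = "\<lambda>z\<in>{p, q}. if z = p then x else y"
  have "?f \<in> {p, q} \<rightarrow>\<^sub>E topspace X" using X(2,3) openin_subset[OF X(1)] by auto
  from openin_continuous_map_preimage[OF all[OF this] X(1)]
  have "openin Y {z \<in> topspace Y. ?f z \<in> V}" .
  also have "{z \<in> topspace Y. ?f z \<in> V} = {p}" using X Y by auto
  finally show ?thesis .
qed

lemma space_category_Top:
  assumes U: "set_universe \<U>"
  shows "space_category (TopCat \<U>) \<U> (\<lambda>S. TopSpace (discrete_topology S))"
proof
  fix X Y f assume "X \<in> Obj (TopCat \<U>)" "Y \<in> Obj (TopCat \<U>)" "f \<in> Mor (TopCat \<U>) X Y"
  then show "f \<in> und (TopCat \<U>) X \<rightarrow>\<^sub>E und (TopCat \<U>) Y" by auto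
next
  fix X assume "X \<in> Obj (TopCat \<U>)"
  then obtain t where "X = TopSpace t" by auto
  then show "ident (TopCat \<U>) X \<in> Mor (TopCat \<U>) X X"
    by (auto simp: ident_def intro: continuous_map_eq[OF continuous_map_id])
next
  fix X Y Z f g
  assume "X \<in> Obj (TopCat \<U>)" "Y \<in> Obj (TopCat \<U>)" "Z \<in> Obj (TopCat \<U>)"
    and fg: "f \<in> Mor (TopCat \<U>) X Y" "g \<in> Mor (TopCat \<U>) Y Z"
  then obtain s t u where st: "X = TopSpace s" "Y = TopSpace t" "Z = TopSpace u" by auto
  have "continuous_map s u (g \<circ> f)" using fg unfolding st by (auto intro: continuous_map_compose)
  then have "continuous_map s u (compose (topspace s) g f)"
    by (rule continuous_map_eq) (simp add: compose_def)
  moreover have "compose (topspace s) g f \<in> topspace s \<rightarrow>\<^sub>E topspace u"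
    by (rule compose_PiE[where B = "topspace t"]) (use fg st in auto)
  ultimately show "compose (und (TopCat \<U>) X) g f \<in> Mor (TopCat \<U>) X Z" unfolding st by simp
next
  show "set_universe \<U>" by (fact U)
next
  fix X assume "X \<in> Obj (TopCat \<U>)"
  then show "und (TopCat \<U>) X \<in> \<U>" by auto
next
  fix X Y f
  assume "X \<in> Obj (TopCat \<U>)" "Y \<in> Obj (TopCat \<U>)" and f: "f \<in> und (TopCat \<U>) X \<rightarrow>\<^sub>E und (TopCat \<U>) Y"
    and c: "\<And>x y. x \<in> und (TopCat \<U>) X \<Longrightarrow> y \<in> und (TopCat \<U>) X \<Longrightarrow> f x = f y"
  then obtain s t where st: "X = TopSpace s" "Y = TopSpace t" by auto
  have "continuous_map s t f"
  proof (cases "topspace s = {}")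
    case True
    then show ?thesis by (simp add: continuous_map_on_empty)
  next
    case False
    then obtain x where x: "x \<in> topspace s" by blast
    have "continuous_map s t (\<lambda>_. f x)" using f x st by auto
    then show ?thesis
    proof (rule continuous_map_eq)
      fix y assume "y \<in> topspace s"
      then show "f x = f y" using c[of x y] x st by simp
    qed
  qed
  then show "f \<in> Mor (TopCat \<U>) X Y" using f st by simp
next
  fix X S m
  assume X: "X \<in> Obj (TopCat \<U>)" and S: "S \<in> \<U>" and m: "m \<in> S \<rightarrow>\<^sub>E und (TopCat \<U>) X"
  then obtain t where t: "X = TopSpace t" by auto
  have mS: "m ` S \<subseteq> topspace t" using m t by auto
  let ?L = "pullback_topology S m t"
  have tL: "topspace ?L = S" using mS by (auto simp: topspace_pullback_topology)
  have "continuous_map ?L t m"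
    using continuous_map_pullback[of t t id S m] by simp
  moreover have "g \<in> Mor (TopCat \<U>) Z (TopSpace ?L)"
    if Z: "Z \<in> Obj (TopCat \<U>)" and gS: "g \<in> und (TopCat \<U>) Z \<rightarrow>\<^sub>E S"
      and mg: "compose (und (TopCat \<U>) Z) m g \<in> Mor (TopCat \<U>) Z X" for Z g
  proof -
    obtain s where s: "Z = TopSpace s" using Z by auto
    have "continuous_map s t (compose (topspace s) m g)" using mg unfolding s t by simp
    then have "continuous_map s t (m \<circ> g)" by (rule continuous_map_eq) (simp add: compose_def)
    then have "continuous_map s ?L g"
      by (rule continuous_map_pullback') (use gS s in auto)
    then show ?thesis using gS s tL by simp
  qed
  ultimately show "\<exists>L\<in>Obj (TopCat \<U>). und (TopCat \<U>) L = S \<and> m \<in> Mor (TopCat \<U>) L X \<and>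
        (\<forall>Z\<in>Obj (TopCat \<U>). \<forall>g\<in>und (TopCat \<U>) Z \<rightarrow>\<^sub>E S.
          compose (und (TopCat \<U>) Z) m g \<in> Mor (TopCat \<U>) Z X \<longrightarrow> g \<in> Mor (TopCat \<U>) Z L)"
    using S m tL t by (intro bexI[of _ "TopSpace ?L"]) auto
next
  fix S assume "S \<in> \<U>"
  then show "TopSpace (discrete_topology S) \<in> Obj (TopCat \<U>)"
    "und (TopCat \<U>) (TopSpace (discrete_topology S)) = S" by auto
next
  fix S Z f assume "S \<in> \<U>" "Z \<in> Obj (TopCat \<U>)" "f \<in> S \<rightarrow>\<^sub>E und (TopCat \<U>) Z"
  then show "f \<in> Mor (TopCat \<U>) (TopSpace (discrete_topology S)) Z" by (auto simp: PiE_def)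
next
  fix X Z f
  assume "X \<in> Obj (TopCat \<U>)" and ind: "indiscrete X" and "Z \<in> Obj (TopCat \<U>)"
    and f: "f \<in> und (TopCat \<U>) Z \<rightarrow>\<^sub>E und (TopCat \<U>) X"
  then obtain s t where st: "X = TopSpace s" "Z = TopSpace t" by auto
  have i: "V = {} \<or> V = topspace s" if "openin s V" for V using ind that unfolding st by simp
  have "openin t {x \<in> topspace t. f x \<in> V}" if "openin s V" for V
  proof -
    have "{x \<in> topspace t. f x \<in> V} = {} \<or> {x \<in> topspace t. f x \<in> V} = topspace t"
      using i[OF that] f st by auto
    then show ?thesis by (metis openin_empty openin_topspace)
  qed
  then show "f \<in> Mor (TopCat \<U>) Z X" using f st by (auto simp: continuous_map_def)
next
  fix X Y and p q :: 'a
  assume "X \<in> Obj (TopCat \<U>)" "\<not> indiscrete X" "Y \<in> Obj (TopCat \<U>)" and pq: "p \<noteq> q"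
    and Y: "und (TopCat \<U>) Y = {p, q}"
    and all: "\<And>f. f \<in> und (TopCat \<U>) Y \<rightarrow>\<^sub>E und (TopCat \<U>) X \<Longrightarrow> f \<in> Mor (TopCat \<U>) Y X"
  then obtain s t where st: "X = TopSpace s" "Y = TopSpace t" by auto
  have t: "topspace t = {p, q}" using Y st by simp
  obtain V where V: "openin s V" "V \<noteq> {}" "V \<noteq> topspace s"
    using \<open>\<not> indiscrete X\<close> st by auto
  moreover have "V \<subseteq> topspace s" using V(1) by (rule openin_subset)
  ultimately obtain x y where xy: "x \<in> V" "y \<in> topspace s" "y \<notin> V" by blast
  have all': "continuous_map t s f" if "f \<in> {p, q} \<rightarrow>\<^sub>E topspace s" for f
    using all[of f] that st t by simp
  have "openin t {p}" by (rule two_point_continuous_maps[OF V(1) xy t pq all'])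
  moreover have "openin t {q}"
    by (rule two_point_continuous_maps[OF V(1) xy, of t q p]) (use t pq all' in \<open>auto simp: insert_commute\<close>)
  ultimately have "discrete_topology {p, q} = t"
    using t by (simp add: discrete_topology_unique)
  then show "ident (TopCat \<U>) Y \<in> Mor (TopCat \<U>) Y (TopSpace (discrete_topology {p, q}))"
    using st by (auto simp: ident_def)
next
  fix a b :: 'a
  assume ab: "a \<noteq> b"
  obtain B and \<kappa> :: "'a \<Rightarrow> nat \<Rightarrow> bool" where B: "B \<in> \<U>" and \<kappa>: "bij_betw \<kappa> B UNIV"
    using universe_binary_sequences[OF U] .
  let ?P = "cantor_topology B \<kappa>" and ?D = "discrete_topology {a, b}"
  let ?proj = "\<lambda>n. \<lambda>x\<in>B. if \<kappa> x n then a else b"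
  have "continuous_map ?P ?D (?proj n)" for n
    unfolding continuous_map_def topspace_cantor_topology openin_cantor_topology
  proof (intro conjI allI impI)
    fix W
    show "\<forall>x\<in>{x \<in> B. ?proj n x \<in> W}. \<exists>k. \<forall>y\<in>B. (\<forall>i<k. \<kappa> y i = \<kappa> x i) \<longrightarrow> y \<in> {x \<in> B. ?proj n x \<in> W}"
      \<comment> \<open>Coordinate \<open>n\<close> is constant on points that agree in the first
        \<open>Suc n\<close> terms.\<close>
      by (intro ballI exI[of _ "Suc n"]) auto
  qed auto
  moreover have "f \<in> Mor (TopCat \<U>) Z (TopSpace ?P)"
    if Z: "Z \<in> Obj (TopCat \<U>)" and f: "f \<in> und (TopCat \<U>) Z \<rightarrow>\<^sub>E B"
      and coord: "\<forall>n. (\<lambda>z\<in>und (TopCat \<U>) Z. if \<kappa> (f z) n then a else b) \<in> Mor (TopCat \<U>) Z (TopSpace ?D)"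
    for Z f
  proof -
    obtain t where t: "Z = TopSpace t" using Z by auto
    have c: "continuous_map t ?D (\<lambda>z\<in>topspace t. if \<kappa> (f z) n then a else b)" for n
      using coord t by simp
    have "openin t {x \<in> topspace t. \<kappa> (f x) n}" for n
    proof -
      have "openin t {x \<in> topspace t. (\<lambda>z\<in>topspace t. if \<kappa> (f z) n then a else b) x \<in> {a}}"
        by (rule openin_continuous_map_preimage[OF c]) simp
      also have "\<dots> = {x \<in> topspace t. \<kappa> (f x) n}" using ab by auto
      finally show ?thesis .
    qed
    moreover have "openin t {x \<in> topspace t. \<not> \<kappa> (f x) n}" for n
    proof -
      have "openin t {x \<in> topspace t. (\<lambda>z\<in>topspace t. if \<kappa> (f z) n then a else b) x \<in> {b}}"
        by (rule openin_continuous_map_preimage[OF c]) simp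
      also have "\<dots> = {x \<in> topspace t. \<not> \<kappa> (f x) n}" using ab by auto
      finally show ?thesis .
    qed
    ultimately have "continuous_map t ?P f"
      by (intro continuous_map_cantor_topology) (use f t in auto)
    then show ?thesis using f t by (simp add: topspace_cantor_topology)
  qed
  moreover have "\<not> continuous_map ?P ?D (\<lambda>x\<in>B. if \<kappa> x = (\<lambda>n. False) then a else b)"
  proof
    assume "continuous_map ?P ?D (\<lambda>x\<in>B. if \<kappa> x = (\<lambda>n. False) then a else b)"
    then have "openin ?P {x \<in> topspace ?P. (\<lambda>x\<in>B. if \<kappa> x = (\<lambda>n. False) then a else b) x \<in> {a}}"
      by (rule openin_continuous_map_preimage) simp
    also have "\<dots> = {x \<in> B. \<kappa> x = (\<lambda>n. False)}" using ab by (auto simp: topspace_cantor_topology)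
    finally have o: "openin ?P {x \<in> B. \<kappa> x = (\<lambda>n. False)}" .
    have sur: "\<exists>z\<in>B. \<kappa> z = s" for s using \<kappa> by (metis UNIV_I bij_betw_imp_surj_on imageE)
    obtain z where z: "z \<in> B" "\<kappa> z = (\<lambda>n. False)" using sur by blast
    have "\<exists>n. \<forall>y\<in>B. (\<forall>i<n. \<kappa> y i = \<kappa> z i) \<longrightarrow> y \<in> {x \<in> B. \<kappa> x = (\<lambda>n. False)}"
      by (rule bspec[OF o[unfolded openin_cantor_topology, THEN conjunct2]]) (simp add: z)
    then obtain n where n: "\<And>y. y \<in> B \<Longrightarrow> (\<forall>i<n. \<kappa> y i = \<kappa> z i) \<Longrightarrow> \<kappa> y = (\<lambda>n. False)"
      by auto
    \<comment> \<open>The sequence whose only true term is at position \<open>n\<close> agrees with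
      zero in the terms before \<open>n\<close>, so it lies in every such neighbourhood of
      zero.\<close>
    obtain w where "w \<in> B" "\<kappa> w = (\<lambda>i. i = n)" using sur by blast
    then have "(\<lambda>i. i = n) = (\<lambda>i. False)" using n[of w] z(2) by simp
    then show False by (simp add: fun_eq_iff)
  qed
  ultimately show "\<exists>P\<in>Obj (TopCat \<U>). \<exists>\<kappa>. bij_betw \<kappa> (und (TopCat \<U>) P) (UNIV :: (nat \<Rightarrow> bool) set) \<and>
      (\<forall>n. (\<lambda>x\<in>und (TopCat \<U>) P. if \<kappa> x n then a else b) \<in> Mor (TopCat \<U>) P (TopSpace ?D)) \<and>
      (\<forall>Z\<in>Obj (TopCat \<U>). \<forall>f\<in>und (TopCat \<U>) Z \<rightarrow>\<^sub>E und (TopCat \<U>) P.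
        (\<forall>n. (\<lambda>z\<in>und (TopCat \<U>) Z. if \<kappa> (f z) n then a else b) \<in> Mor (TopCat \<U>) Z (TopSpace ?D))
          \<longrightarrow> f \<in> Mor (TopCat \<U>) Z P) \<and>
      (\<lambda>x\<in>und (TopCat \<U>) P. if \<kappa> x = (\<lambda>n. False) then a else b) \<notin> Mor (TopCat \<U>) P (TopSpace ?D)"
    using B \<kappa> by (intro bexI[of _ "TopSpace ?P"] exI[of _ \<kappa>]) (auto simp: topspace_cantor_topology)
qed


section \<open>Proximity spaces\<close>

lemma ProxCat_simps [simp]:
  "Obj (ProxCat \<U>) = {ProxSpace S near | S near. S \<in> \<U> \<and> proximity_on S near}"
  "und (ProxCat \<U>) = pts" "Mor (ProxCat \<U>) = space_maps"
  by (simp_all add: ProxCat_def)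

definition discrete_near :: "'u set \<Rightarrow> 'u set \<Rightarrow> 'u set \<Rightarrow> bool" where
  "discrete_near S A B \<longleftrightarrow> A \<subseteq> S \<and> B \<subseteq> S \<and> A \<inter> B \<noteq> {}"

definition pullback_near :: "'u set \<Rightarrow> ('u \<Rightarrow> 'v) \<Rightarrow> ('v set \<Rightarrow> 'v set \<Rightarrow> bool) \<Rightarrow> 'u set \<Rightarrow> 'u set \<Rightarrow> bool" where
  "pullback_near S m near A B \<longleftrightarrow> A \<subseteq> S \<and> B \<subseteq> S \<and> near (m ` A) (m ` B)"

text \<open>Two sets are near when their distance is zero, closeness of points being measured by the
  length of the common initial segment of their sequences.\<close>

definition cantor_near :: "'u set \<Rightarrow> ('u \<Rightarrow> nat \<Rightarrow> bool) \<Rightarrow> 'u set \<Rightarrow> 'u set \<Rightarrow> bool" where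
  "cantor_near S \<kappa> A B \<longleftrightarrow> A \<subseteq> S \<and> B \<subseteq> S \<and> (\<forall>n. \<exists>x\<in>A. \<exists>y\<in>B. \<forall>i<n. \<kappa> x i = \<kappa> y i)"

lemma proximityD:
  assumes "proximity_on S near"
  shows "near A B \<Longrightarrow> A \<subseteq> S" "near A B \<Longrightarrow> B \<subseteq> S" "near A B \<Longrightarrow> A \<noteq> {}" "near A B \<Longrightarrow> B \<noteq> {}"
    "near A B \<Longrightarrow> near B A" "A \<subseteq> S \<Longrightarrow> B \<subseteq> S \<Longrightarrow> A \<inter> B \<noteq> {} \<Longrightarrow> near A B"
    "A \<subseteq> S \<Longrightarrow> B \<subseteq> S \<Longrightarrow> D \<subseteq> S \<Longrightarrow> near (A \<union> B) D \<longleftrightarrow> near A D \<or> near B D"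
    "A \<subseteq> S \<Longrightarrow> B \<subseteq> S \<Longrightarrow> \<not> near A B \<Longrightarrow> \<exists>E\<subseteq>S. \<not> near A E \<and> \<not> near (S - E) B"
proof -
  note P = assms[unfolded proximity_on_def]
  note P1 = P[THEN conjunct1, rule_format] and P2 = P[THEN conjunct2, THEN conjunct1, rule_format]
    and P3 = P[THEN conjunct2, THEN conjunct2, THEN conjunct1, rule_format]
    and P4 = P[THEN conjunct2, THEN conjunct2, THEN conjunct2, THEN conjunct1, rule_format]
    and P5 = P[THEN conjunct2, THEN conjunct2, THEN conjunct2, THEN conjunct2, rule_format]
  show "near A B \<Longrightarrow> A \<subseteq> S" "near A B \<Longrightarrow> B \<subseteq> S" "near A B \<Longrightarrow> A \<noteq> {}" "near A B \<Longrightarrow> B \<noteq> {}"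
    using P1 by metis+
  show "near A B \<Longrightarrow> near B A" by (rule P2)
  show "A \<subseteq> S \<Longrightarrow> B \<subseteq> S \<Longrightarrow> A \<inter> B \<noteq> {} \<Longrightarrow> near A B" by (rule P3) simp
  show "A \<subseteq> S \<Longrightarrow> B \<subseteq> S \<Longrightarrow> D \<subseteq> S \<Longrightarrow> near (A \<union> B) D \<longleftrightarrow> near A D \<or> near B D" by (rule P4) simp
  show "A \<subseteq> S \<Longrightarrow> B \<subseteq> S \<Longrightarrow> \<not> near A B \<Longrightarrow> \<exists>E\<subseteq>S. \<not> near A E \<and> \<not> near (S - E) B"
    by (rule P5) simp
qed

lemma proximity_mono:
  assumes P: "proximity_on S near" and n: "near A B" and A: "A \<subseteq> A'" "A' \<subseteq> S" and B: "B \<subseteq> B'" "B' \<subseteq> S"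
  shows "near A' B'"
proof -
  have "near (A \<union> A') B" using n A proximityD(2)[OF P n] proximityD(7)[OF P, of A A' B] by blast
  then have "near A' B" using A by (simp add: Un_absorb1)
  then have n': "near B A'" by (rule proximityD(5)[OF P])
  have "near (B \<union> B') A'" using n' A B proximityD(7)[OF P, of B B' A'] by blast
  then have "near B' A'" using B by (simp add: Un_absorb1)
  then show ?thesis by (rule proximityD(5)[OF P])
qed

lemma proximity_on_discrete_near: "proximity_on S (discrete_near S)"
  unfolding proximity_on_def
proof (intro conjI allI impI)
  fix A B assume "A \<subseteq> S \<and> B \<subseteq> S \<and> \<not> discrete_near S A B"
  then show "\<exists>E\<subseteq>S. \<not> discrete_near S A E \<and> \<not> discrete_near S (S - E) B"
    by (intro exI[of _ B]) (auto simp: discrete_near_def)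
qed (auto simp: discrete_near_def)

text \<open>For the separation axiom a set separating the images is pulled back along
  \<open>m\<close>. The images of the preimages may be smaller than the sets in \<open>S\<close>,
  which does no harm, since subsets of far sets are far.\<close>

lemma proximity_on_pullback_near:
  assumes P: "proximity_on S near" and m: "m \<in> R \<rightarrow> S"
  shows "proximity_on R (pullback_near R m near)"
  unfolding proximity_on_def
proof (intro conjI allI impI)
  fix A B assume "pullback_near R m near A B"
  then show "A \<subseteq> R" "B \<subseteq> R" "A \<noteq> {}" "B \<noteq> {}" "pullback_near R m near B A"
    using proximityD(3-5)[OF P] by (auto simp: pullback_near_def)
next
  fix A B assume "A \<subseteq> R \<and> B \<subseteq> R \<and> A \<inter> B \<noteq> {}"
  then show "pullback_near R m near A B"
    using m unfolding pullback_near_def by (intro conjI proximityD(6)[OF P]) blast+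
next
  fix A B D assume "A \<subseteq> R \<and> B \<subseteq> R \<and> D \<subseteq> R"
  moreover from this have "near (m ` A \<union> m ` B) (m ` D) \<longleftrightarrow> near (m ` A) (m ` D) \<or> near (m ` B) (m ` D)"
    using m by (intro proximityD(7)[OF P]) blast+
  ultimately show "pullback_near R m near (A \<union> B) D \<longleftrightarrow> pullback_near R m near A D \<or> pullback_near R m near B D"
    by (auto simp: pullback_near_def image_Un)
next
  fix A B assume AB: "A \<subseteq> R \<and> B \<subseteq> R \<and> \<not> pullback_near R m near A B"
  then have s: "m ` A \<subseteq> S" "m ` B \<subseteq> S" and far: "\<not> near (m ` A) (m ` B)"
    using m by (auto simp: pullback_near_def)
  obtain E where E: "E \<subseteq> S" "\<not> near (m ` A) E" "\<not> near (S - E) (m ` B)"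
    using proximityD(8)[OF P s far] by blast
  let ?E = "{x \<in> R. m x \<in> E}"
  have "\<not> near (m ` A) (m ` ?E)"
    using E proximity_mono[OF P _ order_refl s(1), of "m ` ?E" E] by blast
  moreover have "\<not> near (m ` (R - ?E)) (m ` B)"
    using E m proximity_mono[OF P _ _ _ order_refl s(2), of "m ` (R - ?E)" "S - E"] by blast
  ultimately show "\<exists>E\<subseteq>R. \<not> pullback_near R m near A E \<and> \<not> pullback_near R m near (R - E) B"
    by (intro exI[of _ ?E]) (auto simp: pullback_near_def)
qed

lemma proximity_on_cantor_near: "proximity_on S (cantor_near S \<kappa>)"
  unfolding proximity_on_def
proof (intro conjI allI impI)
  fix A B assume n: "cantor_near S \<kappa> A B"
  then show "A \<subseteq> S" "B \<subseteq> S" "A \<noteq> {}" "B \<noteq> {}" by (auto simp: cantor_near_def)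
  show "cantor_near S \<kappa> B A" using n unfolding cantor_near_def by metis
next
  fix A B assume "A \<subseteq> S \<and> B \<subseteq> S \<and> A \<inter> B \<noteq> {}"
  then show "cantor_near S \<kappa> A B" unfolding cantor_near_def by blast
next
  fix A B D assume s: "A \<subseteq> S \<and> B \<subseteq> S \<and> D \<subseteq> S"
  show "cantor_near S \<kappa> (A \<union> B) D \<longleftrightarrow> cantor_near S \<kappa> A D \<or> cantor_near S \<kappa> B D"
  proof
    assume n: "cantor_near S \<kappa> (A \<union> B) D"
    show "cantor_near S \<kappa> A D \<or> cantor_near S \<kappa> B D"
    proof (rule ccontr)
      assume "\<not> (cantor_near S \<kappa> A D \<or> cantor_near S \<kappa> B D)"
      then obtain k l where kl: "\<not> (\<exists>x\<in>A. \<exists>y\<in>D. \<forall>i<k. \<kappa> x i = \<kappa> y i)"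
        "\<not> (\<exists>x\<in>B. \<exists>y\<in>D. \<forall>i<l. \<kappa> x i = \<kappa> y i)"
        using s unfolding cantor_near_def by blast
      obtain x y where "x \<in> A \<union> B" "y \<in> D" "\<forall>i<max k l. \<kappa> x i = \<kappa> y i"
        using n unfolding cantor_near_def by blast
      then show False using kl by (metis UnE less_max_iff_disj)
    qed
  next
    assume "cantor_near S \<kappa> A D \<or> cantor_near S \<kappa> B D"
    then show "cantor_near S \<kappa> (A \<union> B) D" using s unfolding cantor_near_def by blast
  qed
next
  fix A B assume s: "A \<subseteq> S \<and> B \<subseteq> S \<and> \<not> cantor_near S \<kappa> A B"
  then obtain n where n: "\<not> (\<exists>x\<in>A. \<exists>y\<in>B. \<forall>i<n. \<kappa> x i = \<kappa> y i)" unfolding cantor_near_def by blast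
  \<comment> \<open>The neighbourhood of \<open>B\<close> at the length \<open>n\<close> at which
    \<open>A\<close> and \<open>B\<close> are separated. Agreement in the first \<open>n\<close>
    terms is transitive, so the same \<open>n\<close> separates \<open>A\<close> from this set and
    its complement from \<open>B\<close>.\<close>
  let ?E = "{x \<in> S. \<exists>y\<in>B. \<forall>i<n. \<kappa> x i = \<kappa> y i}"
  have "\<not> cantor_near S \<kappa> A ?E"
  proof
    assume "cantor_near S \<kappa> A ?E"
    then obtain x e where "x \<in> A" "e \<in> ?E" "\<forall>i<n. \<kappa> x i = \<kappa> e i" unfolding cantor_near_def by blast
    moreover from this obtain y where "y \<in> B" "\<forall>i<n. \<kappa> e i = \<kappa> y i" by blast
    ultimately show False using n by metis
  qed
  moreover have "\<not> cantor_near S \<kappa> (S - ?E) B"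
    unfolding cantor_near_def by blast
  ultimately show "\<exists>E\<subseteq>S. \<not> cantor_near S \<kappa> A E \<and> \<not> cantor_near S \<kappa> (S - E) B"
    by (intro exI[of _ ?E]) auto
qed

text \<open>The assumption treats one coordinate at a time, whereas nearness in the Cantor space
  asks for two points that agree in \<open>k\<close> coordinates simultaneously. Therefore near
  pairs of subsets are refined step by step: if both sets are split by the value of the next
  coordinate, additivity of nearness leaves a near pair \<open>H v\<close>, \<open>H' w\<close>.
  Their images under that coordinate are near in a discrete space, hence meet, and so
  \<open>v = w\<close>.\<close>

lemma cantor_near_map:
  assumes P: "proximity_on S near" and f: "f \<in> S \<rightarrow> B" and ab: "a \<noteq> b"
    and coord: "\<And>n A A'. near A A' \<Longrightarrow>
      discrete_near {a, b} ((\<lambda>z\<in>S. if \<kappa> (f z) n then a else b) ` A) ((\<lambda>z\<in>S. if \<kappa> (f z) n then a else b) ` A')"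
    and n: "near A A'"
  shows "cantor_near B \<kappa> (f ` A) (f ` A')"
proof -
  have "\<exists>G G'. G \<subseteq> A \<and> G' \<subseteq> A' \<and> near G G' \<and> (\<forall>x\<in>G. \<forall>y\<in>G'. \<forall>i<k. \<kappa> (f x) i = \<kappa> (f y) i)" for k :: nat
  proof (induction k)
    case 0
    then show ?case using n by blast
  next
    case (Suc k)
    then obtain G G' where G: "G \<subseteq> A" "G' \<subseteq> A'" "near G G'"
      "\<forall>x\<in>G. \<forall>y\<in>G'. \<forall>i<k. \<kappa> (f x) i = \<kappa> (f y) i" by blast
    have s: "G \<subseteq> S" "G' \<subseteq> S" using proximityD(1,2)[OF P G(3)] .
    define H where "H v = {x \<in> G. \<kappa> (f x) k = v}" for v
    define H' where "H' v = {x \<in> G'. \<kappa> (f x) k = v}" for v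
    have HS: "H v \<subseteq> S" "H' v \<subseteq> S" for v using s by (auto simp: H_def H'_def)
    have "G = H True \<union> H False" "G' = H' True \<union> H' False" by (auto simp: H_def H'_def)
    then have "near (H True \<union> H False) G'" using G(3) by simp
    then obtain v where "near (H v) G'" using proximityD(7)[OF P HS(1,1) s(2)] by blast
    then have "near G' (H v)" by (rule proximityD(5)[OF P])
    then have "near (H' True \<union> H' False) (H v)" using \<open>G' = _\<close> by simp
    then obtain w where "near (H' w) (H v)" using proximityD(7)[OF P HS(2,2) HS(1)] by blast
    then have vw: "near (H v) (H' w)" by (rule proximityD(5)[OF P])
    obtain c where "c \<in> (\<lambda>z\<in>S. if \<kappa> (f z) k then a else b) ` H v" "c \<in> (\<lambda>z\<in>S. if \<kappa> (f z) k then a else b) ` H' w"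
      using coord[OF vw, of k] by (auto simp: discrete_near_def)
    then obtain x y where xy: "x \<in> H v" "y \<in> H' w"
      "(\<lambda>z\<in>S. if \<kappa> (f z) k then a else b) x = (\<lambda>z\<in>S. if \<kappa> (f z) k then a else b) y" by auto
    moreover have "x \<in> S" "y \<in> S" using xy HS by blast+
    ultimately have "v = w" using ab by (auto simp: H_def H'_def split: if_splits)
    then have "\<forall>x\<in>H v. \<forall>y\<in>H' w. \<forall>i<Suc k. \<kappa> (f x) i = \<kappa> (f y) i"
      using G(4) by (auto simp: H_def H'_def less_Suc_eq)
    moreover have "H v \<subseteq> A" "H' w \<subseteq> A'" using G by (auto simp: H_def H'_def)
    ultimately show ?case using vw by blast
  qed
  note approx = this
  have "\<exists>x\<in>f ` A. \<exists>y\<in>f ` A'. \<forall>i<k. \<kappa> x i = \<kappa> y i" for k :: nat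
  proof -
    from approx[of k] obtain G G' where G: "G \<subseteq> A" "G' \<subseteq> A'" "near G G'"
      "\<forall>x\<in>G. \<forall>y\<in>G'. \<forall>i<k. \<kappa> (f x) i = \<kappa> (f y) i" by blast
    obtain x y where "x \<in> G" "y \<in> G'" using proximityD(3,4)[OF P G(3)] by blast
    then show ?thesis using G by blast
  qed
  then show ?thesis
    using f proximityD(1,2)[OF P n] unfolding cantor_near_def by blast
qed

text \<open>Far sets have far points \<open>x\<close> and \<open>y\<close>. Sending one of
  \<open>p\<close>, \<open>q\<close> to \<open>x\<close> and the other to \<open>y\<close> shows
  that the two singletons are far, and disjoint nonempty subsets of \<open>{p, q}\<close> are these
  singletons.\<close>

lemma two_point_proximity_maps:
  assumes P: "proximity_on S near" "A \<subseteq> S" "B \<subseteq> S" "A \<noteq> {}" "B \<noteq> {}" "\<not> near A B"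
    and Q: "proximity_on {p, q} near'" "p \<noteq> q"
    and all: "\<And>f A B. f \<in> {p, q} \<rightarrow>\<^sub>E S \<Longrightarrow> near' A B \<Longrightarrow> near (f ` A) (f ` B)"
  shows "near' A' B' \<Longrightarrow> discrete_near {p, q} A' B'"
proof -
  assume n: "near' A' B'"
  obtain x y where xy: "x \<in> A" "y \<in> B" using P by blast
  have f: "(\<lambda>z\<in>{p, q}. if z = c then x else y) \<in> {p, q} \<rightarrow>\<^sub>E S" for c using xy P by auto
  have far: "\<not> near {x} {y}" using xy P proximity_mono[OF P(1), of "{x}" "{y}" A B] by blast
  have pq: "\<not> near' {p} {q}" "\<not> near' {q} {p}"
    using all[OF f[of p], of "{p}" "{q}"] all[OF f[of q], of "{q}" "{p}"] far Q(2) by auto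
  have "A' \<inter> B' \<noteq> {}"
  proof
    assume e: "A' \<inter> B' = {}"
    have "A' \<subseteq> {p, q}" "B' \<subseteq> {p, q}" "A' \<noteq> {}" "B' \<noteq> {}" using proximityD(1-4)[OF Q(1) n] by auto
    then have "A' = {p} \<and> B' = {q} \<or> A' = {q} \<and> B' = {p}" using e by blast
    then show False using n pq by blast
  qed
  then show "discrete_near {p, q} A' B'" using proximityD(1,2)[OF Q(1) n] by (simp add: discrete_near_def)
qed

lemma space_category_Prox:
  assumes U: "set_universe \<U>"
  shows "space_category (ProxCat \<U>) \<U> (\<lambda>S. ProxSpace S (discrete_near S))"
proof
  fix X Y f assume "X \<in> Obj (ProxCat \<U>)" "Y \<in> Obj (ProxCat \<U>)" "f \<in> Mor (ProxCat \<U>) X Y"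
  then show "f \<in> und (ProxCat \<U>) X \<rightarrow>\<^sub>E und (ProxCat \<U>) Y" by auto
next
  fix X assume "X \<in> Obj (ProxCat \<U>)"
  then obtain S near where X: "X = ProxSpace S near" "proximity_on S near" by auto
  have "near ((\<lambda>x\<in>S. x) ` A) ((\<lambda>x\<in>S. x) ` B)" if "near A B" for A B
  proof -
    have "(\<lambda>x\<in>S. x) ` A = A" "(\<lambda>x\<in>S. x) ` B = B" using proximityD(1,2)[OF X(2) that] by force+
    then show ?thesis using that by simp
  qed
  then show "ident (ProxCat \<U>) X \<in> Mor (ProxCat \<U>) X X" using X by (auto simp: ident_def)
next
  fix X Y Z f g
  assume "X \<in> Obj (ProxCat \<U>)" "Y \<in> Obj (ProxCat \<U>)" "Z \<in> Obj (ProxCat \<U>)"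
    and fg: "f \<in> Mor (ProxCat \<U>) X Y" "g \<in> Mor (ProxCat \<U>) Y Z"
  then obtain S near S' near' S'' near'' where st: "X = ProxSpace S near" "Y = ProxSpace S' near'"
    "Z = ProxSpace S'' near''" and P: "proximity_on S near" by auto
  have "near'' (compose S g f ` A) (compose S g f ` B)" if "near A B" for A B
  proof -
    have "compose S g f ` A = g ` f ` A" "compose S g f ` B = g ` f ` B"
      using proximityD(1,2)[OF P that] by (force simp: compose_def)+
    then show ?thesis using fg that unfolding st by simp
  qed
  moreover have "compose S g f \<in> S \<rightarrow>\<^sub>E S''"
    by (rule compose_PiE[where B = S']) (use fg st in auto)
  ultimately show "compose (und (ProxCat \<U>) X) g f \<in> Mor (ProxCat \<U>) X Z" unfolding st by simp
next
  show "set_universe \<U>" by (fact U)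
next
  fix X assume "X \<in> Obj (ProxCat \<U>)"
  then show "und (ProxCat \<U>) X \<in> \<U>" by auto
next
  fix X Y f
  assume "X \<in> Obj (ProxCat \<U>)" "Y \<in> Obj (ProxCat \<U>)" and f: "f \<in> und (ProxCat \<U>) X \<rightarrow>\<^sub>E und (ProxCat \<U>) Y"
    and c: "\<And>x y. x \<in> und (ProxCat \<U>) X \<Longrightarrow> y \<in> und (ProxCat \<U>) X \<Longrightarrow> f x = f y"
  then obtain S near S' near' where st: "X = ProxSpace S near" "Y = ProxSpace S' near'"
    and P: "proximity_on S near" "proximity_on S' near'" by auto
  have "near' (f ` A) (f ` B)" if n: "near A B" for A B
  proof (rule proximityD(6)[OF P(2)])
    show "f ` A \<subseteq> S'" "f ` B \<subseteq> S'" using f st proximityD(1,2)[OF P(1) n] by auto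
    obtain x y where xy: "x \<in> A" "y \<in> B" using proximityD(3,4)[OF P(1) n] by blast
    then have "f x = f y" using c st proximityD(1,2)[OF P(1) n] by (metis pts.simps(2) subsetD ProxCat_simps(2))
    then show "f ` A \<inter> f ` B \<noteq> {}" using xy by blast
  qed
  then show "f \<in> Mor (ProxCat \<U>) X Y" using f st by simp
next
  fix X S m
  assume X: "X \<in> Obj (ProxCat \<U>)" and S: "S \<in> \<U>" and m: "m \<in> S \<rightarrow>\<^sub>E und (ProxCat \<U>) X"
  then obtain R near where t: "X = ProxSpace R near" and P: "proximity_on R near" by auto
  have mS: "m \<in> S \<rightarrow> R" using m t by auto
  let ?L = "pullback_near S m near"
  have "g \<in> Mor (ProxCat \<U>) Z (ProxSpace S ?L)"
    if Z: "Z \<in> Obj (ProxCat \<U>)" and gS: "g \<in> und (ProxCat \<U>) Z \<rightarrow>\<^sub>E S"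
      and mg: "compose (und (ProxCat \<U>) Z) m g \<in> Mor (ProxCat \<U>) Z X" for Z g
  proof -
    obtain V nearV where s: "Z = ProxSpace V nearV" and PV: "proximity_on V nearV" using Z by auto
    have g: "g \<in> V \<rightarrow>\<^sub>E S" using gS s by simp
    have "?L (g ` A) (g ` B)" if n: "nearV A B" for A B
    proof -
      note AB = proximityD(1,2)[OF PV n]
      have "near (compose V m g ` A) (compose V m g ` B)"
        using mg n s t by simp
      moreover have "compose V m g ` A = m ` g ` A" "compose V m g ` B = m ` g ` B"
        using AB by (force simp: compose_def)+
      ultimately show ?thesis using AB g unfolding pullback_near_def by auto
    qed
    then show ?thesis using g s by simp
  qed
  moreover have "m \<in> Mor (ProxCat \<U>) (ProxSpace S ?L) X" using m t by (simp add: pullback_near_def)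
  ultimately show "\<exists>L\<in>Obj (ProxCat \<U>). und (ProxCat \<U>) L = S \<and> m \<in> Mor (ProxCat \<U>) L X \<and>
        (\<forall>Z\<in>Obj (ProxCat \<U>). \<forall>g\<in>und (ProxCat \<U>) Z \<rightarrow>\<^sub>E S.
          compose (und (ProxCat \<U>) Z) m g \<in> Mor (ProxCat \<U>) Z X \<longrightarrow> g \<in> Mor (ProxCat \<U>) Z L)"
    using S proximity_on_pullback_near[OF P mS] by (intro bexI[of _ "ProxSpace S ?L"]) auto
next
  fix S assume "S \<in> \<U>"
  then show "ProxSpace S (discrete_near S) \<in> Obj (ProxCat \<U>)"
    "und (ProxCat \<U>) (ProxSpace S (discrete_near S)) = S"
    by (auto simp: proximity_on_discrete_near)
next
  fix S Z f assume "S \<in> \<U>" "Z \<in> Obj (ProxCat \<U>)" and f: "f \<in> S \<rightarrow>\<^sub>E und (ProxCat \<U>) Z"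
  then obtain R near where t: "Z = ProxSpace R near" and P: "proximity_on R near" by auto
  have "near (f ` A) (f ` B)" if "discrete_near S A B" for A B
    by (rule proximityD(6)[OF P]) (use that f t in \<open>auto simp: discrete_near_def\<close>)
  then show "f \<in> Mor (ProxCat \<U>) (ProxSpace S (discrete_near S)) Z" using f t by simp
next
  fix X Z f
  assume "X \<in> Obj (ProxCat \<U>)" and i: "indiscrete X" and "Z \<in> Obj (ProxCat \<U>)"
    and f: "f \<in> und (ProxCat \<U>) Z \<rightarrow>\<^sub>E und (ProxCat \<U>) X"
  then obtain S near S' near' where st: "X = ProxSpace S near" "Z = ProxSpace S' near'"
    and P: "proximity_on S' near'" by auto
  have "near (f ` A) (f ` B)" if n: "near' A B" for A B
    using i f st proximityD(1-4)[OF P n] by auto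
  then show "f \<in> Mor (ProxCat \<U>) Z X" using f st by simp
next
  fix X Y and p q :: 'a
  assume "X \<in> Obj (ProxCat \<U>)" and i: "\<not> indiscrete X" and "Y \<in> Obj (ProxCat \<U>)" and pq: "p \<noteq> q"
    and Y: "und (ProxCat \<U>) Y = {p, q}"
    and all: "\<And>f. f \<in> und (ProxCat \<U>) Y \<rightarrow>\<^sub>E und (ProxCat \<U>) X \<Longrightarrow> f \<in> Mor (ProxCat \<U>) Y X"
  then obtain S near near' where st: "X = ProxSpace S near" "Y = ProxSpace {p, q} near'"
    and P: "proximity_on S near" "proximity_on {p, q} near'" by auto
  obtain A B where n: "near A B \<noteq> (A \<subseteq> S \<and> B \<subseteq> S \<and> A \<noteq> {} \<and> B \<noteq> {})"
    using i unfolding st indiscrete.simps not_all by (elim exE)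
  moreover have "A \<subseteq> S \<and> B \<subseteq> S \<and> A \<noteq> {} \<and> B \<noteq> {}" if "near A B"
    using proximityD(1-4)[OF P(1) that] by simp
  ultimately have AB: "A \<subseteq> S" "B \<subseteq> S" "A \<noteq> {}" "B \<noteq> {}" "\<not> near A B" by argo+
  have all': "near (f ` A) (f ` B)" if "f \<in> {p, q} \<rightarrow>\<^sub>E S" "near' A B" for f A B
    using all[of f] that unfolding st by simp
  have "discrete_near {p, q} ((\<lambda>x\<in>{p, q}. x) ` A) ((\<lambda>x\<in>{p, q}. x) ` B)" if n: "near' A B" for A B
  proof -
    have "(\<lambda>x\<in>{p, q}. x) ` A = A" "(\<lambda>x\<in>{p, q}. x) ` B = B"
      using proximityD(1,2)[OF P(2) n] by force+
    then show ?thesis using two_point_proximity_maps[OF P(1) AB P(2) pq all' n] by simp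
  qed
  then show "ident (ProxCat \<U>) Y \<in> Mor (ProxCat \<U>) Y (ProxSpace {p, q} (discrete_near {p, q}))"
    unfolding st by (auto simp: ident_def)
next
  fix a b :: 'a
  assume ab: "a \<noteq> b"
  obtain B and \<kappa> :: "'a \<Rightarrow> nat \<Rightarrow> bool" where B: "B \<in> \<U>" and \<kappa>: "bij_betw \<kappa> B UNIV"
    using universe_binary_sequences[OF U] .
  let ?P = "ProxSpace B (cantor_near B \<kappa>)" and ?D = "ProxSpace {a, b} (discrete_near {a, b})"
  let ?proj = "\<lambda>n. \<lambda>x\<in>B. if \<kappa> x n then a else b"
  have "discrete_near {a, b} (?proj n ` A) (?proj n ` A')" if n: "cantor_near B \<kappa> A A'" for n A A'
  proof -
    obtain x y where xy: "x \<in> A" "y \<in> A'" "\<forall>i<Suc n. \<kappa> x i = \<kappa> y i" and s: "A \<subseteq> B" "A' \<subseteq> B"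
      using n unfolding cantor_near_def by blast
    then have "?proj n x = ?proj n y" by (simp add: subset_iff)
    then have "?proj n ` A \<inter> ?proj n ` A' \<noteq> {}" using xy by blast
    then show ?thesis using s by (auto simp: discrete_near_def)
  qed
  moreover have "f \<in> Mor (ProxCat \<U>) Z ?P"
    if Z: "Z \<in> Obj (ProxCat \<U>)" and f: "f \<in> und (ProxCat \<U>) Z \<rightarrow>\<^sub>E B"
      and coord: "\<forall>n. (\<lambda>z\<in>und (ProxCat \<U>) Z. if \<kappa> (f z) n then a else b) \<in> Mor (ProxCat \<U>) Z ?D"
    for Z f
  proof -
    obtain R near where t: "Z = ProxSpace R near" "proximity_on R near" using Z by auto
    have "cantor_near B \<kappa> (f ` A) (f ` A')" if "near A A'" for A A'
      by (rule cantor_near_map[OF t(2) _ ab _ that]) (use f coord t in auto)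
    then show ?thesis using f t by simp
  qed
  moreover have "(\<lambda>x\<in>B. if \<kappa> x = (\<lambda>n. False) then a else b) \<notin> Mor (ProxCat \<U>) ?P ?D" (is "?h \<notin> _")
  proof
    assume h: "?h \<in> Mor (ProxCat \<U>) ?P ?D"
    have sur: "\<exists>z\<in>B. \<kappa> z = s" for s using \<kappa> by (metis UNIV_I bij_betw_imp_surj_on imageE)
    \<comment> \<open>The zero sequence is near the set of all other sequences, because for every
      \<open>n\<close> some nonzero sequence agrees with it in the first \<open>n\<close> terms; but
      \<open>?h\<close> sends these two sets to different points.\<close>
    let ?A = "{x \<in> B. \<kappa> x = (\<lambda>n. False)}" and ?A' = "{x \<in> B. \<kappa> x \<noteq> (\<lambda>n. False)}"
    have "\<exists>x\<in>?A. \<exists>y\<in>?A'. \<forall>i<n. \<kappa> x i = \<kappa> y i" for n :: nat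
    proof -
      obtain z where z: "z \<in> B" "\<kappa> z = (\<lambda>n. False)" using sur by blast
      obtain w where w: "w \<in> B" "\<kappa> w = (\<lambda>i. i = n)" using sur by blast
      have "(\<lambda>i. i = n) \<noteq> (\<lambda>i. False)" by (simp add: fun_eq_iff)
      then show ?thesis using z w by (intro bexI[of _ z] bexI[of _ w]) auto
    qed
    then have "cantor_near B \<kappa> ?A ?A'" by (auto simp: cantor_near_def)
    moreover have "\<forall>A A'. cantor_near B \<kappa> A A' \<longrightarrow> discrete_near {a, b} (?h ` A) (?h ` A')"
      using h unfolding ProxCat_simps space_maps.simps by blast
    ultimately have "discrete_near {a, b} (?h ` ?A) (?h ` ?A')" by blast
    then show False using ab by (auto simp: discrete_near_def)
  qed
  ultimately show "\<exists>P\<in>Obj (ProxCat \<U>). \<exists>\<kappa>. bij_betw \<kappa> (und (ProxCat \<U>) P) (UNIV :: (nat \<Rightarrow> bool) set) \<and>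
      (\<forall>n. (\<lambda>x\<in>und (ProxCat \<U>) P. if \<kappa> x n then a else b) \<in> Mor (ProxCat \<U>) P ?D) \<and>
      (\<forall>Z\<in>Obj (ProxCat \<U>). \<forall>f\<in>und (ProxCat \<U>) Z \<rightarrow>\<^sub>E und (ProxCat \<U>) P.
        (\<forall>n. (\<lambda>z\<in>und (ProxCat \<U>) Z. if \<kappa> (f z) n then a else b) \<in> Mor (ProxCat \<U>) Z ?D)
          \<longrightarrow> f \<in> Mor (ProxCat \<U>) Z P) \<and>
      (\<lambda>x\<in>und (ProxCat \<U>) P. if \<kappa> x = (\<lambda>n. False) then a else b) \<notin> Mor (ProxCat \<U>) P ?D"
    using B \<kappa> proximity_on_cantor_near[of B \<kappa>]
    by (intro bexI[of _ ?P] exI[of _ \<kappa>]) (auto simp del: space_maps.simps, simp)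
qed


section \<open>Uniform spaces\<close>

lemma UnifCat_simps [simp]:
  "Obj (UnifCat \<U>) = {UnifSpace S \<D> | S \<D>. S \<in> \<U> \<and> uniformity_on S \<D>}"
  "und (UnifCat \<U>) = pts" "Mor (UnifCat \<U>) = space_maps"
  by (simp_all add: UnifCat_def)

definition discrete_uniformity :: "'u set \<Rightarrow> ('u \<times> 'u) set set" where
  "discrete_uniformity S = {D. Id_on S \<subseteq> D \<and> D \<subseteq> S \<times> S}"

text \<open>Preimages of entourages need not be closed under supersets when \<open>m\<close> is not
  injective; they form a base, and the supersets are added.\<close>

definition pullback_uniformity :: "'u set \<Rightarrow> ('u \<Rightarrow> 'v) \<Rightarrow> ('v \<times> 'v) set set \<Rightarrow> ('u \<times> 'u) set set" where
  "pullback_uniformity S m \<D> = {E. E \<subseteq> S \<times> S \<and> (\<exists>D\<in>\<D>. {(x, y) \<in> S \<times> S. (m x, m y) \<in> D} \<subseteq> E)}"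

text \<open>The product uniformity on binary sequences, read through \<open>\<kappa>\<close>. Its
  base consists of the equivalence relations of agreement in the first \<open>n\<close>
  terms.\<close>

definition cantor_uniformity :: "'u set \<Rightarrow> ('u \<Rightarrow> nat \<Rightarrow> bool) \<Rightarrow> ('u \<times> 'u) set set" where
  "cantor_uniformity S \<kappa> = {E. E \<subseteq> S \<times> S \<and> (\<exists>n. {(x, y) \<in> S \<times> S. \<forall>i<n. \<kappa> x i = \<kappa> y i} \<subseteq> E)}"

lemma uniformityD:
  assumes "uniformity_on S \<D>"
  shows "D \<in> \<D> \<Longrightarrow> x \<in> S \<Longrightarrow> (x, x) \<in> D" "D \<in> \<D> \<Longrightarrow> D \<subseteq> S \<times> S" "D \<in> \<D> \<Longrightarrow> D\<inverse> \<in> \<D>"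
    "D \<in> \<D> \<Longrightarrow> \<exists>E\<in>\<D>. E O E \<subseteq> D" "D \<in> \<D> \<Longrightarrow> E \<in> \<D> \<Longrightarrow> D \<inter> E \<in> \<D>"
    "D \<in> \<D> \<Longrightarrow> D \<subseteq> E \<Longrightarrow> E \<subseteq> S \<times> S \<Longrightarrow> E \<in> \<D>" "S \<times> S \<in> \<D>"
proof -
  note P = assms[unfolded uniformity_on_def]
  note P1 = P[THEN conjunct1] and P2 = P[THEN conjunct2, THEN conjunct1, rule_format]
    and P3 = P[THEN conjunct2, THEN conjunct2, THEN conjunct1, rule_format]
    and P4 = P[THEN conjunct2, THEN conjunct2, THEN conjunct2, rule_format]
  show "D \<in> \<D> \<Longrightarrow> x \<in> S \<Longrightarrow> (x, x) \<in> D" "D \<in> \<D> \<Longrightarrow> D \<subseteq> S \<times> S" "D \<in> \<D> \<Longrightarrow> D\<inverse> \<in> \<D>"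
    "D \<in> \<D> \<Longrightarrow> \<exists>E\<in>\<D>. E O E \<subseteq> D"
    using P2[of D] by (auto simp: Id_on_def)
  show "D \<in> \<D> \<Longrightarrow> E \<in> \<D> \<Longrightarrow> D \<inter> E \<in> \<D>" by (rule P3)
  show up: "D \<in> \<D> \<Longrightarrow> D \<subseteq> E \<Longrightarrow> E \<subseteq> S \<times> S \<Longrightarrow> E \<in> \<D>" for D E by (rule P4) simp_all
  obtain D where D: "D \<in> \<D>" using P1 by blast
  show "S \<times> S \<in> \<D>"
    by (rule up[OF D P2[OF D, THEN conjunct2, THEN conjunct1] order_refl])
qed

lemma uniformity_on_discrete_uniformity: "uniformity_on S (discrete_uniformity S)"
  unfolding uniformity_on_def
proof (intro conjI ballI allI impI)
  show "discrete_uniformity S \<noteq> {}" by (auto simp: discrete_uniformity_def)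
  fix D assume "D \<in> discrete_uniformity S"
  then show "\<exists>E\<in>discrete_uniformity S. E O E \<subseteq> D"
    by (intro bexI[of _ "Id_on S"]) (auto simp: discrete_uniformity_def)
qed (auto simp: discrete_uniformity_def)

lemma pullback_uniformityI:
  assumes "D \<in> \<D>" "\<And>x y. x \<in> S \<Longrightarrow> y \<in> S \<Longrightarrow> (m x, m y) \<in> D \<Longrightarrow> (x, y) \<in> E" "E \<subseteq> S \<times> S"
  shows "E \<in> pullback_uniformity S m \<D>"
  using assms unfolding pullback_uniformity_def by auto

lemma pullback_uniformityE:
  assumes "E \<in> pullback_uniformity S m \<D>"
  obtains D where "D \<in> \<D>" "\<And>x y. x \<in> S \<Longrightarrow> y \<in> S \<Longrightarrow> (m x, m y) \<in> D \<Longrightarrow> (x, y) \<in> E" "E \<subseteq> S \<times> S"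
  using assms unfolding pullback_uniformity_def by auto

lemma cantor_uniformityI:
  assumes "\<And>x y. x \<in> S \<Longrightarrow> y \<in> S \<Longrightarrow> \<forall>i<n. \<kappa> x i = \<kappa> y i \<Longrightarrow> (x, y) \<in> E" "E \<subseteq> S \<times> S"
  shows "E \<in> cantor_uniformity S \<kappa>"
  using assms unfolding cantor_uniformity_def by auto

lemma cantor_uniformityE:
  assumes "E \<in> cantor_uniformity S \<kappa>"
  obtains n where "\<And>x y. x \<in> S \<Longrightarrow> y \<in> S \<Longrightarrow> \<forall>i<n. \<kappa> x i = \<kappa> y i \<Longrightarrow> (x, y) \<in> E" "E \<subseteq> S \<times> S"
proof -
  obtain n where "{(x, y) \<in> S \<times> S. \<forall>i<n. \<kappa> x i = \<kappa> y i} \<subseteq> E" "E \<subseteq> S \<times> S"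
    using assms unfolding cantor_uniformity_def by auto
  then show ?thesis by (intro that[of n]) auto
qed

lemma uniformity_on_pullback_uniformity:
  assumes P: "uniformity_on R \<D>" and m: "m \<in> S \<rightarrow> R"
  shows "uniformity_on S (pullback_uniformity S m \<D>)"
  unfolding uniformity_on_def
proof (intro conjI ballI allI impI)
  show "pullback_uniformity S m \<D> \<noteq> {}"
    using pullback_uniformityI[OF uniformityD(7)[OF P], of S m "S \<times> S"] by auto
next
  fix E assume "E \<in> pullback_uniformity S m \<D>"
  then obtain D where D: "D \<in> \<D>" "\<And>x y. x \<in> S \<Longrightarrow> y \<in> S \<Longrightarrow> (m x, m y) \<in> D \<Longrightarrow> (x, y) \<in> E" "E \<subseteq> S \<times> S"
    by (rule pullback_uniformityE) blast
  show "Id_on S \<subseteq> E"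
  proof
    fix z assume "z \<in> Id_on S"
    then obtain x where x: "x \<in> S" "z = (x, x)" by blast
    then have "m x \<in> R" using m by blast
    then show "z \<in> E" using D(2) x uniformityD(1)[OF P D(1)] by blast
  qed
  show "E \<subseteq> S \<times> S" by (fact D(3))
  show "E\<inverse> \<in> pullback_uniformity S m \<D>"
    by (rule pullback_uniformityI[OF uniformityD(3)[OF P D(1)]]) (use D in auto)
  obtain D' where D': "D' \<in> \<D>" "D' O D' \<subseteq> D" using uniformityD(4)[OF P D(1)] by blast
  let ?E = "{(x, y) \<in> S \<times> S. (m x, m y) \<in> D'}"
  have "?E \<in> pullback_uniformity S m \<D>" by (rule pullback_uniformityI[OF D'(1)]) auto
  moreover have "?E O ?E \<subseteq> E"
  proof
    fix z assume "z \<in> ?E O ?E"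
    then obtain u v w where z: "z = (u, w)" "u \<in> S" "w \<in> S" "(m u, m v) \<in> D'" "(m v, m w) \<in> D'" by blast
    then have "(m u, m w) \<in> D" using D'(2) by blast
    then show "z \<in> E" using D(2) z by blast
  qed
  ultimately show "\<exists>F\<in>pullback_uniformity S m \<D>. F O F \<subseteq> E" by blast
next
  fix E F assume EF: "E \<in> pullback_uniformity S m \<D>" "F \<in> pullback_uniformity S m \<D>"
  obtain D where D: "D \<in> \<D>" "\<And>x y. x \<in> S \<Longrightarrow> y \<in> S \<Longrightarrow> (m x, m y) \<in> D \<Longrightarrow> (x, y) \<in> E" "E \<subseteq> S \<times> S"
    by (rule pullback_uniformityE[OF EF(1)]) blast
  obtain D' where D': "D' \<in> \<D>" "\<And>x y. x \<in> S \<Longrightarrow> y \<in> S \<Longrightarrow> (m x, m y) \<in> D' \<Longrightarrow> (x, y) \<in> F"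
    by (rule pullback_uniformityE[OF EF(2)]) blast
  show "E \<inter> F \<in> pullback_uniformity S m \<D>"
    by (rule pullback_uniformityI[OF uniformityD(5)[OF P D(1) D'(1)]]) (use D D' in auto)
next
  fix D E assume D: "D \<in> pullback_uniformity S m \<D>" and E: "D \<subseteq> E \<and> E \<subseteq> S \<times> S"
  obtain D' where D': "D' \<in> \<D>" "\<And>x y. x \<in> S \<Longrightarrow> y \<in> S \<Longrightarrow> (m x, m y) \<in> D' \<Longrightarrow> (x, y) \<in> D"
    by (rule pullback_uniformityE[OF D]) blast
  show "E \<in> pullback_uniformity S m \<D>"
    by (rule pullback_uniformityI[OF D'(1)]) (use D' E in auto)
qed

lemma uniformity_on_cantor_uniformity: "uniformity_on S (cantor_uniformity S \<kappa>)"
  unfolding uniformity_on_def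
proof (intro conjI ballI allI impI)
  show "cantor_uniformity S \<kappa> \<noteq> {}"
    using cantor_uniformityI[of S 0 \<kappa> "S \<times> S"] by auto
next
  fix E assume "E \<in> cantor_uniformity S \<kappa>"
  then obtain n where n: "\<And>x y. x \<in> S \<Longrightarrow> y \<in> S \<Longrightarrow> \<forall>i<n. \<kappa> x i = \<kappa> y i \<Longrightarrow> (x, y) \<in> E" and E: "E \<subseteq> S \<times> S"
    by (rule cantor_uniformityE) blast
  show "Id_on S \<subseteq> E" using n by auto
  show "E \<subseteq> S \<times> S" by (fact E)
  show "E\<inverse> \<in> cantor_uniformity S \<kappa>"
    by (rule cantor_uniformityI[of S n]) (use n E in auto)
  \<comment> \<open>Agreement in the first \<open>n\<close> terms is transitive, so this entourage
    can be composed with itself without leaving \<open>E\<close>.\<close>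
  let ?E = "{(x, y) \<in> S \<times> S. \<forall>i<n. \<kappa> x i = \<kappa> y i}"
  have "?E \<in> cantor_uniformity S \<kappa>" by (rule cantor_uniformityI[of S n]) auto
  moreover have "?E O ?E \<subseteq> E"
  proof
    fix z assume "z \<in> ?E O ?E"
    then obtain u v w where z: "z = (u, w)" "u \<in> S" "w \<in> S" "\<forall>i<n. \<kappa> u i = \<kappa> v i" "\<forall>i<n. \<kappa> v i = \<kappa> w i"
      by blast
    then show "z \<in> E" using n[of u w] by simp
  qed
  ultimately show "\<exists>F\<in>cantor_uniformity S \<kappa>. F O F \<subseteq> E" by blast
next
  fix E F assume EF: "E \<in> cantor_uniformity S \<kappa>" "F \<in> cantor_uniformity S \<kappa>"
  obtain k where k: "\<And>x y. x \<in> S \<Longrightarrow> y \<in> S \<Longrightarrow> \<forall>i<k. \<kappa> x i = \<kappa> y i \<Longrightarrow> (x, y) \<in> E" "E \<subseteq> S \<times> S"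
    by (rule cantor_uniformityE[OF EF(1)]) blast
  obtain l where l: "\<And>x y. x \<in> S \<Longrightarrow> y \<in> S \<Longrightarrow> \<forall>i<l. \<kappa> x i = \<kappa> y i \<Longrightarrow> (x, y) \<in> F"
    by (rule cantor_uniformityE[OF EF(2)]) blast
  show "E \<inter> F \<in> cantor_uniformity S \<kappa>"
    by (rule cantor_uniformityI[of S "max k l"]) (use k l in auto)
next
  fix D E assume D: "D \<in> cantor_uniformity S \<kappa>" and E: "D \<subseteq> E \<and> E \<subseteq> S \<times> S"
  obtain n where n: "\<And>x y. x \<in> S \<Longrightarrow> y \<in> S \<Longrightarrow> \<forall>i<n. \<kappa> x i = \<kappa> y i \<Longrightarrow> (x, y) \<in> D"
    by (rule cantor_uniformityE[OF D]) blast
  show "E \<in> cantor_uniformity S \<kappa>" by (rule cantor_uniformityI[of S n]) (use n E in auto)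
qed

lemma space_category_Unif:
  assumes U: "set_universe \<U>"
  shows "space_category (UnifCat \<U>) \<U> (\<lambda>S. UnifSpace S (discrete_uniformity S))"
proof
  fix X Y f assume "X \<in> Obj (UnifCat \<U>)" "Y \<in> Obj (UnifCat \<U>)" "f \<in> Mor (UnifCat \<U>) X Y"
  then show "f \<in> und (UnifCat \<U>) X \<rightarrow>\<^sub>E und (UnifCat \<U>) Y" by auto
next
  fix X assume "X \<in> Obj (UnifCat \<U>)"
  then obtain S \<D> where X: "X = UnifSpace S \<D>" "uniformity_on S \<D>" by auto
  have "{(x, y) \<in> S \<times> S. ((\<lambda>x\<in>S. x) x, (\<lambda>x\<in>S. x) y) \<in> E} \<in> \<D>" if "E \<in> \<D>" for E
  proof -
    have "{(x, y) \<in> S \<times> S. ((\<lambda>x\<in>S. x) x, (\<lambda>x\<in>S. x) y) \<in> E} = E" using uniformityD(2)[OF X(2) that] by auto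
    then show ?thesis using that by simp
  qed
  then show "ident (UnifCat \<U>) X \<in> Mor (UnifCat \<U>) X X" using X by (auto simp: ident_def)
next
  fix X Y Z f g
  assume "X \<in> Obj (UnifCat \<U>)" "Y \<in> Obj (UnifCat \<U>)" "Z \<in> Obj (UnifCat \<U>)"
    and fg: "f \<in> Mor (UnifCat \<U>) X Y" "g \<in> Mor (UnifCat \<U>) Y Z"
  then obtain S \<D> S' \<D>' S'' \<D>'' where st: "X = UnifSpace S \<D>" "Y = UnifSpace S' \<D>'"
    "Z = UnifSpace S'' \<D>''" by auto
  have f: "f \<in> S \<rightarrow>\<^sub>E S'" "\<And>E. E \<in> \<D>' \<Longrightarrow> {(x, y) \<in> S \<times> S. (f x, f y) \<in> E} \<in> \<D>"
    and g: "g \<in> S' \<rightarrow>\<^sub>E S''" "\<And>E. E \<in> \<D>'' \<Longrightarrow> {(x, y) \<in> S' \<times> S'. (g x, g y) \<in> E} \<in> \<D>'"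
    using fg unfolding st by auto
  have "{(x, y) \<in> S \<times> S. (compose S g f x, compose S g f y) \<in> E} \<in> \<D>" if "E \<in> \<D>''" for E
  proof -
    have "{(x, y) \<in> S \<times> S. (compose S g f x, compose S g f y) \<in> E}
      = {(x, y) \<in> S \<times> S. (f x, f y) \<in> {(x, y) \<in> S' \<times> S'. (g x, g y) \<in> E}}"
      using f(1) by (auto simp: compose_def)
    then show ?thesis using f(2)[OF g(2)[OF that]] by simp
  qed
  moreover have "compose S g f \<in> S \<rightarrow>\<^sub>E S''" using f(1) g(1) by (rule compose_PiE)
  ultimately show "compose (und (UnifCat \<U>) X) g f \<in> Mor (UnifCat \<U>) X Z" unfolding st by simp
next
  show "set_universe \<U>" by (fact U)
next
  fix X assume "X \<in> Obj (UnifCat \<U>)"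
  then show "und (UnifCat \<U>) X \<in> \<U>" by auto
next
  fix X Y f
  assume "X \<in> Obj (UnifCat \<U>)" "Y \<in> Obj (UnifCat \<U>)" and f: "f \<in> und (UnifCat \<U>) X \<rightarrow>\<^sub>E und (UnifCat \<U>) Y"
    and c: "\<And>x y. x \<in> und (UnifCat \<U>) X \<Longrightarrow> y \<in> und (UnifCat \<U>) X \<Longrightarrow> f x = f y"
  then obtain S \<D> S' \<D>' where st: "X = UnifSpace S \<D>" "Y = UnifSpace S' \<D>'"
    and P: "uniformity_on S \<D>" "uniformity_on S' \<D>'" by auto
  have c': "f x = f y" if "x \<in> S" "y \<in> S" for x y using c[of x y] that st by simp
  have "{(x, y) \<in> S \<times> S. (f x, f y) \<in> E} \<in> \<D>" if E: "E \<in> \<D>'" for E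
  proof -
    have "(f x, f y) \<in> E" if "x \<in> S" "y \<in> S" for x y
      using uniformityD(1)[OF P(2) E, of "f x"] c'[OF that] f that st by auto
    then have "{(x, y) \<in> S \<times> S. (f x, f y) \<in> E} = S \<times> S" by auto
    then show ?thesis using uniformityD(7)[OF P(1)] by simp
  qed
  then show "f \<in> Mor (UnifCat \<U>) X Y" using f st by simp
next
  fix X S m
  assume X: "X \<in> Obj (UnifCat \<U>)" and S: "S \<in> \<U>" and m: "m \<in> S \<rightarrow>\<^sub>E und (UnifCat \<U>) X"
  then obtain R \<D> where t: "X = UnifSpace R \<D>" and P: "uniformity_on R \<D>" by auto
  have mS: "m \<in> S \<rightarrow> R" using m t by auto
  let ?L = "pullback_uniformity S m \<D>"
  have "g \<in> Mor (UnifCat \<U>) Z (UnifSpace S ?L)"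
    if Z: "Z \<in> Obj (UnifCat \<U>)" and gS: "g \<in> und (UnifCat \<U>) Z \<rightarrow>\<^sub>E S"
      and mg: "compose (und (UnifCat \<U>) Z) m g \<in> Mor (UnifCat \<U>) Z X" for Z g
  proof -
    obtain V \<E> where s: "Z = UnifSpace V \<E>" and PV: "uniformity_on V \<E>" using Z by auto
    have g: "g \<in> V \<rightarrow>\<^sub>E S" using gS s by simp
    have mgV: "{(x, y) \<in> V \<times> V. (compose V m g x, compose V m g y) \<in> D} \<in> \<E>" if "D \<in> \<D>" for D
      using mg that s t by simp
    have "{(x, y) \<in> V \<times> V. (g x, g y) \<in> E} \<in> \<E>" if E: "E \<in> ?L" for E
    proof -
      obtain D where D: "D \<in> \<D>" "\<And>x y. x \<in> S \<Longrightarrow> y \<in> S \<Longrightarrow> (m x, m y) \<in> D \<Longrightarrow> (x, y) \<in> E"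
        by (rule pullback_uniformityE[OF E]) blast
      show ?thesis
        by (rule uniformityD(6)[OF PV mgV[OF D(1)]]) 
          (use D(2) PiE_mem[OF g] in \<open>auto simp: compose_def\<close>)
    qed
    then show ?thesis using g s by simp
  qed
  moreover have "m \<in> Mor (UnifCat \<U>) (UnifSpace S ?L) X"
    using m t by (auto simp: pullback_uniformity_def)
  ultimately show "\<exists>L\<in>Obj (UnifCat \<U>). und (UnifCat \<U>) L = S \<and> m \<in> Mor (UnifCat \<U>) L X \<and>
        (\<forall>Z\<in>Obj (UnifCat \<U>). \<forall>g\<in>und (UnifCat \<U>) Z \<rightarrow>\<^sub>E S.
          compose (und (UnifCat \<U>) Z) m g \<in> Mor (UnifCat \<U>) Z X \<longrightarrow> g \<in> Mor (UnifCat \<U>) Z L)"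
    using S uniformity_on_pullback_uniformity[OF P mS] by (intro bexI[of _ "UnifSpace S ?L"]) auto
next
  fix S assume "S \<in> \<U>"
  then show "UnifSpace S (discrete_uniformity S) \<in> Obj (UnifCat \<U>)"
    "und (UnifCat \<U>) (UnifSpace S (discrete_uniformity S)) = S"
    by (auto simp: uniformity_on_discrete_uniformity)
next
  fix S Z f assume "S \<in> \<U>" "Z \<in> Obj (UnifCat \<U>)" and f: "f \<in> S \<rightarrow>\<^sub>E und (UnifCat \<U>) Z"
  then obtain R \<D> where t: "Z = UnifSpace R \<D>" and P: "uniformity_on R \<D>" by auto
  have "{(x, y) \<in> S \<times> S. (f x, f y) \<in> E} \<in> discrete_uniformity S" if "E \<in> \<D>" for E
    using uniformityD(1)[OF P that] f t by (auto simp: discrete_uniformity_def)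
  then show "f \<in> Mor (UnifCat \<U>) (UnifSpace S (discrete_uniformity S)) Z" using f t by simp
next
  fix X Z f
  assume "X \<in> Obj (UnifCat \<U>)" and i: "indiscrete X" and "Z \<in> Obj (UnifCat \<U>)"
    and f: "f \<in> und (UnifCat \<U>) Z \<rightarrow>\<^sub>E und (UnifCat \<U>) X"
  then obtain S \<D> S' \<D>' where st: "X = UnifSpace S \<D>" "Z = UnifSpace S' \<D>'"
    and P: "uniformity_on S' \<D>'" by auto
  have "{(x, y) \<in> S' \<times> S'. (f x, f y) \<in> S \<times> S} = S' \<times> S'" using f st by auto
  then show "f \<in> Mor (UnifCat \<U>) Z X" using f st i uniformityD(7)[OF P] by simp
next
  fix X Y and p q :: 'a
  assume "X \<in> Obj (UnifCat \<U>)" and i: "\<not> indiscrete X" and "Y \<in> Obj (UnifCat \<U>)" and pq: "p \<noteq> q"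
    and Y: "und (UnifCat \<U>) Y = {p, q}"
    and all: "\<And>f. f \<in> und (UnifCat \<U>) Y \<rightarrow>\<^sub>E und (UnifCat \<U>) X \<Longrightarrow> f \<in> Mor (UnifCat \<U>) Y X"
  then obtain S \<D> \<D>' where st: "X = UnifSpace S \<D>" "Y = UnifSpace {p, q} \<D>'"
    and P: "uniformity_on S \<D>" "uniformity_on {p, q} \<D>'" by auto
  have "\<exists>D\<in>\<D>. D \<noteq> S \<times> S" using i uniformityD(7)[OF P(1)] unfolding st indiscrete.simps by blast
  then obtain D x y where D: "D \<in> \<D>" "x \<in> S" "y \<in> S" "(x, y) \<notin> D"
    using uniformityD(2)[OF P(1)] by blast
  have pre: "{(u, v) \<in> {p, q} \<times> {p, q}. (f u, f v) \<in> D} \<in> \<D>'" if "f \<in> {p, q} \<rightarrow>\<^sub>E S" for f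
    using all[of f] that D(1) unfolding st by simp
  \<comment> \<open>An entourage need not be symmetric, and only \<open>(x, y)\<close> is known to
    be missing from \<open>D\<close>. The map for \<open>c = p\<close> removes the pair
    \<open>(p, q)\<close>, the one for \<open>c = q\<close> removes \<open>(q, p)\<close>, and the
    intersection is the diagonal.\<close>
  let ?f = "\<lambda>c. \<lambda>z\<in>{p, q}. if z = c then x else y"
  let ?E = "\<lambda>c. {(u, v) \<in> {p, q} \<times> {p, q}. (?f c u, ?f c v) \<in> D}"
  have "?E p \<inter> ?E q \<in> \<D>'"
    by (intro uniformityD(5)[OF P(2)] pre) (use D in \<open>auto split: if_splits\<close>)
  moreover have "?E p \<inter> ?E q \<subseteq> Id_on {p, q}" using D(4) pq by auto
  ultimately have "Id_on {p, q} \<in> \<D>'" by (rule uniformityD(6)[OF P(2)]) auto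
  then have disc: "E \<in> \<D>'" if "Id_on {p, q} \<subseteq> E" "E \<subseteq> {p, q} \<times> {p, q}" for E
    using uniformityD(6)[OF P(2)] that by blast
  have "{(u, v) \<in> {p, q} \<times> {p, q}. ((\<lambda>x\<in>{p, q}. x) u, (\<lambda>x\<in>{p, q}. x) v) \<in> E} \<in> \<D>'"
    if "E \<in> discrete_uniformity {p, q}" for E
    by (rule disc) (use that in \<open>auto simp: discrete_uniformity_def\<close>)
  then show "ident (UnifCat \<U>) Y \<in> Mor (UnifCat \<U>) Y (UnifSpace {p, q} (discrete_uniformity {p, q}))"
    unfolding st by (auto simp: ident_def)
next
  fix a b :: 'a
  assume ab: "a \<noteq> b"
  obtain B and \<kappa> :: "'a \<Rightarrow> nat \<Rightarrow> bool" where B: "B \<in> \<U>" and \<kappa>: "bij_betw \<kappa> B UNIV"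
    using universe_binary_sequences[OF U] .
  let ?P = "UnifSpace B (cantor_uniformity B \<kappa>)" and ?D = "UnifSpace {a, b} (discrete_uniformity {a, b})"
  let ?proj = "\<lambda>n. \<lambda>x\<in>B. if \<kappa> x n then a else b"
  have "?proj n \<in> Mor (UnifCat \<U>) ?P ?D" for n
  proof -
    have "{(x, y) \<in> B \<times> B. (?proj n x, ?proj n y) \<in> E} \<in> cantor_uniformity B \<kappa>"
      if "E \<in> discrete_uniformity {a, b}" for E
    proof -
      have E: "(a, a) \<in> E" "(b, b) \<in> E" using that by (auto simp: discrete_uniformity_def)
      show ?thesis by (rule cantor_uniformityI[of B "Suc n"]) (use E in auto)
    qed
    then show ?thesis by auto
  qed
  moreover have "f \<in> Mor (UnifCat \<U>) Z ?P"
    if Z: "Z \<in> Obj (UnifCat \<U>)" and f: "f \<in> und (UnifCat \<U>) Z \<rightarrow>\<^sub>E B"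
      and coord: "\<forall>n. (\<lambda>z\<in>und (UnifCat \<U>) Z. if \<kappa> (f z) n then a else b) \<in> Mor (UnifCat \<U>) Z ?D"
    for Z f
  proof -
    obtain R \<D> where t: "Z = UnifSpace R \<D>" and P: "uniformity_on R \<D>" using Z by auto
    have fR: "f \<in> R \<rightarrow>\<^sub>E B" using f t by simp
    \<comment> \<open>The diagonal is an entourage of the discrete two-point space. Its preimage
      under coordinate \<open>n\<close> is agreement at \<open>n\<close>, and finite intersections
      of these give the base of the Cantor uniformity.\<close>
    have Id: "Id_on {a, b} \<in> discrete_uniformity {a, b}" by (auto simp: discrete_uniformity_def)
    have c: "{(x, y) \<in> R \<times> R. \<kappa> (f x) n = \<kappa> (f y) n} \<in> \<D>" for n
    proof -
      have "{(x, y) \<in> R \<times> R. ((\<lambda>z\<in>R. if \<kappa> (f z) n then a else b) x, (\<lambda>z\<in>R. if \<kappa> (f z) n then a else b) y)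
          \<in> Id_on {a, b}} \<in> \<D>"
        using coord Id t by simp
      also have "{(x, y) \<in> R \<times> R. ((\<lambda>z\<in>R. if \<kappa> (f z) n then a else b) x, (\<lambda>z\<in>R. if \<kappa> (f z) n then a else b) y)
          \<in> Id_on {a, b}} = {(x, y) \<in> R \<times> R. \<kappa> (f x) n = \<kappa> (f y) n}"
        using ab by (auto simp: Id_on_iff split: if_splits)
      finally show ?thesis .
    qed
    have ball: "{(x, y) \<in> R \<times> R. \<forall>i<n. \<kappa> (f x) i = \<kappa> (f y) i} \<in> \<D>" for n :: nat
    proof (induction n)
      case 0
      have "{(x, y) \<in> R \<times> R. \<forall>i<0. \<kappa> (f x) i = \<kappa> (f y) i} = R \<times> R" by auto
      then show ?case using uniformityD(7)[OF P] by simp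
    next
      case (Suc n)
      have "{(x, y) \<in> R \<times> R. \<forall>i<Suc n. \<kappa> (f x) i = \<kappa> (f y) i} =
        {(x, y) \<in> R \<times> R. \<forall>i<n. \<kappa> (f x) i = \<kappa> (f y) i} \<inter> {(x, y) \<in> R \<times> R. \<kappa> (f x) n = \<kappa> (f y) n}"
        by (auto simp: less_Suc_eq)
      then show ?case using uniformityD(5)[OF P Suc c[of n]] by simp
    qed
    have "{(x, y) \<in> R \<times> R. (f x, f y) \<in> E} \<in> \<D>" if E: "E \<in> cantor_uniformity B \<kappa>" for E
    proof -
      obtain n where n: "\<And>x y. x \<in> B \<Longrightarrow> y \<in> B \<Longrightarrow> \<forall>i<n. \<kappa> x i = \<kappa> y i \<Longrightarrow> (x, y) \<in> E"
        by (rule cantor_uniformityE[OF E]) blast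
      show ?thesis by (rule uniformityD(6)[OF P ball[of n]]) (use n fR in auto)
    qed
    then show ?thesis using fR t by simp
  qed
  moreover have "(\<lambda>x\<in>B. if \<kappa> x = (\<lambda>n. False) then a else b) \<notin> Mor (UnifCat \<U>) ?P ?D" (is "?h \<notin> _")
  proof
    assume h: "?h \<in> Mor (UnifCat \<U>) ?P ?D"
    have "Id_on {a, b} \<in> discrete_uniformity {a, b}" by (auto simp: discrete_uniformity_def)
    then have "{(x, y) \<in> B \<times> B. (?h x, ?h y) \<in> Id_on {a, b}} \<in> cantor_uniformity B \<kappa>"
      using h by simp
    then obtain n where n: "\<And>x y. x \<in> B \<Longrightarrow> y \<in> B \<Longrightarrow> \<forall>i<n. \<kappa> x i = \<kappa> y i \<Longrightarrow>
        (x, y) \<in> {(x, y) \<in> B \<times> B. (?h x, ?h y) \<in> Id_on {a, b}}"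
      by (rule cantor_uniformityE) blast
    have sur: "\<exists>z\<in>B. \<kappa> z = s" for s using \<kappa> by (metis UNIV_I bij_betw_imp_surj_on imageE)
    obtain z where z: "z \<in> B" "\<kappa> z = (\<lambda>n. False)" using sur by blast
    \<comment> \<open>Distinct from zero, but related to it by agreement in the first
      \<open>n\<close> terms, so \<open>?h\<close> would have to identify the two.\<close>
    obtain w where w: "w \<in> B" "\<kappa> w = (\<lambda>i. i = n)" using sur by blast
    have ne: "(\<lambda>i. i = n) \<noteq> (\<lambda>i. False)" by (simp add: fun_eq_iff)
    have "\<forall>i<n. \<kappa> z i = \<kappa> w i" using z w by simp
    from n[OF z(1) w(1) this] have "(?h z, ?h w) \<in> Id_on {a, b}"
      by (simp only: mem_Collect_eq case_prod_conv)
    then show False using z w ne ab by (simp add: Id_on_iff)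
  qed
  ultimately show "\<exists>P\<in>Obj (UnifCat \<U>). \<exists>\<kappa>. bij_betw \<kappa> (und (UnifCat \<U>) P) (UNIV :: (nat \<Rightarrow> bool) set) \<and>
      (\<forall>n. (\<lambda>x\<in>und (UnifCat \<U>) P. if \<kappa> x n then a else b) \<in> Mor (UnifCat \<U>) P ?D) \<and>
      (\<forall>Z\<in>Obj (UnifCat \<U>). \<forall>f\<in>und (UnifCat \<U>) Z \<rightarrow>\<^sub>E und (UnifCat \<U>) P.
        (\<forall>n. (\<lambda>z\<in>und (UnifCat \<U>) Z. if \<kappa> (f z) n then a else b) \<in> Mor (UnifCat \<U>) Z ?D)
          \<longrightarrow> f \<in> Mor (UnifCat \<U>) Z P) \<and>
      (\<lambda>x\<in>und (UnifCat \<U>) P. if \<kappa> x = (\<lambda>n. False) then a else b) \<notin> Mor (UnifCat \<U>) P ?D"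
    using B \<kappa> uniformity_on_cantor_uniformity[of B \<kappa>]
    by (intro bexI[of _ ?P] exI[of _ \<kappa>]) (auto simp del: space_maps.simps)
qed


theorem theorem4:
  fixes \<U> :: "'u set set" and T :: "('u space_obj, 'u) concrete_cat" and C :: "'u space_obj set"
  assumes "set_universe \<U>"
    and "T = TopCat \<U> \<or> T = ProxCat \<U> \<or> T = UnifCat \<U>"
    and "subcategory T C"
  shows "(epireflective T C \<and> algebraic \<U> (full_sub T C) \<longleftrightarrow> trivial_or_indiscrete_class T C) \<and>
    (epireflective T C \<and> algebraic \<U> (full_sub T C) \<longleftrightarrow>
       closed_under_products \<U> T C \<and> closed_under_extremal_subobjects T C \<and>
       algebraic \<U> (full_sub T C)) \<and>
    (\<exists>D. subcategory T D \<and> closed_under_extremal_subobjects T D \<and>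
       algebraic \<U> (full_sub T D) \<and> \<not> trivial_or_indiscrete_class T D) \<and>
    (\<exists>D. subcategory T D \<and> closed_under_products \<U> T D \<and>
       algebraic \<U> (full_sub T D) \<and> \<not> trivial_or_indiscrete_class T D) \<and>
    (\<exists>D. subcategory T D \<and> closed_under_products \<U> T D \<and>
       closed_under_extremal_subobjects T D \<and> \<not> trivial_or_indiscrete_class T D)"
proof -
  obtain disc where "space_category T \<U> disc"
    using assms(2) space_category_Top[OF assms(1)] space_category_Prox[OF assms(1)]
      space_category_Unif[OF assms(1)] by blast
  then show ?thesis using assms(3) by (rule space_category.classification)
qed

end
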